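(* Let $(M,g)$ be a transverse Riemann-Lorentz space with tangent radical and singular hypersurface $\Sigma$. Let $A,B,C,D\in\mathfrak{X}_\Sigma$. Then $\langle R(A,B)C,D\rangle$ is well-defined if and only if, on $\Sigma$, $$\Upsilon(\cdot,B,C,D)=\Upsilon(A,\cdot,C,D)=\Upsilon(A,B,\cdot,D)=\Upsilon(A,B,C,\cdot)=0 .$$ If moreover $\Sigma$ is $II$-flat, these conditions are equivalent to the following: at each point of $\Sigma$, either $$\det\begin{pmatrix}\nu(A)&\nu(B)\\ \rho(A)&\rho(B)\end{pmatrix}=0=\det\begin{pmatrix}\nu(C)&\nu(D)\\ \rho(C)&\rho(D)\end{pmatrix},$$ or one of these two matrices vanishes.
   Context: $M$ is a connected smooth manifold of dimension $m>2$ with a smooth symmetric $(0,2)$-tensor field $g=\langle\cdot,\cdot\rangle$ which fails to have maximal rank exactly on a nonempty set $\Sigma\subset M$. $(M,g)$ is a transverse singular space if in every local coordinate system $\det(g_{ab})$ has nonzero differential at the points of $\Sigma$; then $\Sigma$ is a smooth hypersurface (the singular hypersurface) and the radical $Rad_p=\{v\in T_pM: g(v,\cdot)=0\}$, $p\in\Sigma$, is one-dimensional. Tangent radical: $Rad_p\subset T_p\Sigma$ for all $p\in\Sigma$. Riemann-Lorentz: the signature of $g$ changes from Riemannian to Lorentzian across $\Sigma$. $\mathfrak{X}_\Sigma$: smooth vector fields along $\Sigma$; $\mathfrak{X}(\Sigma)$: those tangent to $\Sigma$. For $\mathcal A\in\mathfrak{X}(M)$, $\mathcal A^o=\mathcal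 A|_{M-\Sigma}$; $\mathcal A$ is an extension of $A=\mathcal A|_\Sigma$. Everything is local: $M$ may be replaced by a small neighbourhood of (a point of) $\Sigma$, and vector fields may be only locally defined. Dual connection: $2\square_{\mathcal A}\mathcal B(\mathcal C)=\mathcal A\langle\mathcal B,\mathcal C\rangle+\mathcal B\langle\mathcal C,\mathcal A\rangle-\mathcal C\langle\mathcal A,\mathcal B\rangle+\langle[\mathcal A,\mathcal B],\mathcal C\rangle-\langle[\mathcal B,\mathcal C],\mathcal A\rangle+\langle[\mathcal C,\mathcal A],\mathcal B\rangle$. For a radical vector field $R'$ along $\Sigma$, $II_{R'}(A,B):=\square_AB(R')$ is a well-defined symmetric $C^\infty(\Sigma)$-bilinear map on $\mathfrak{X}_\Sigma$. The main normal $N\in\mathfrak{X}_\Sigma$ satisfies $\langle N,T\Sigma\rangle=0$, $II_{R'}(N,N)=0$ for radical $R'$, $\langle N,N\rangle=1$ (unique up to sign). Second fundamental form: the symmetric tensor $\mathcal H(X,Y):=\square_XY(N)=-\square_XN(Y)$ on $\Sigma$. The main radical vector field $R\in\mathfrak{X}(\Sigma)$ is in the radical distribution with $\mathcal H(R,R)=-1$ (unique up to sign, the sign of $N$ being chosen to make this possible). $II:=II_R$. Canonical screen distribution: $S_p:=\{v\in T_p\Sigma:\mathcal H(v,R(p))=0\}$, a complement of $Rad_p$ in $T_p\Sigma$; $\Gamma(S)$ is its module of sections. $\Sigma$ is $II$-flat if $II(V,W)=0$ for all $V,W\in\Gamma(S)$ (equivalently $II(X,Y)=0$ for all $X,Y\in\mathfrak{X}(\Sigma)$).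 Each $A\in\mathfrak{X}_\Sigma$ decomposes as $A=\nu(A)N+A^S+\rho(A)R$ with $A^S\in\Gamma(S)$, $\nu(A)=\langle A,N\rangle$, $\rho(A)=-\mathcal H(A-\nu(A)N,R)$. Let $\nabla$ be the Levi-Civita connection on $M-\Sigma$, with curvature $R(\mathcal A,\mathcal B)\mathcal C=\nabla_{\mathcal A}\nabla_{\mathcal B}\mathcal C-\nabla_{\mathcal B}\nabla_{\mathcal A}\mathcal C-\nabla_{[\mathcal A,\mathcal B]}\mathcal C$. $N$ has a unique local extension $\mathcal N\in\mathfrak{X}(M)$ which is $\nabla$-geodesic on $M-\Sigma$; the canonical extension of $A\in\mathfrak{X}_\Sigma$ is the unique extension $\mathcal A$ with $[\mathcal N,\mathcal A]=0$. Let $\mathcal R$ be the canonical extension of $R$ and $\tau:=\langle\mathcal R,\mathcal R\rangle$ (then $\tau=0$ on $\Sigma$ and $d\tau\neq0$ there). $\Upsilon$ is the smooth $(0,4)$-tensor field on $M$ given on $M-\Sigma$ by $\Upsilon(\mathcal A,\mathcal B,\mathcal C,\mathcal D)=\tau\langle R(\mathcal A,\mathcal B)\mathcal C,\mathcal D\rangle$; on $\Sigma$, $\Upsilon(A,B,C,D)=II(A,C)II(B,D)-II(A,D)II(B,C)$. For a smooth function $F$ on $M-\Sigma$, $F\cong0$ means that $F$ extends smoothly to $M$. For $A,B,C,D\in\mathfrak{X}_\Sigma$, "$\langle R(A,B)C,D\rangle$ is well-defined" means: for all extensions $\mathcal A,\mathcal B,\mathcal C,\mathcal D\in\mathfrak{X}(M)$,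 $\langle R(\mathcal A^o,\mathcal B^o)\mathcal C^o,\mathcal D^o\rangle\cong0$, and the restriction to $\Sigma$ of its smooth extension depends only on $A,B,C,D$. *)

theory Defs
  imports "HOL-Analysis.Analysis"
begin

section \<open>Smooth manifolds\<close>

primrec Ck_on :: "nat \<Rightarrow> 'e::real_normed_vector set \<Rightarrow> ('e \<Rightarrow> 'f::real_normed_vector) \<Rightarrow> bool" where
  "Ck_on 0 S f \<longleftrightarrow> continuous_on S f"
| "Ck_on (Suc k) S f \<longleftrightarrow>
     (\<forall>x\<in>S. f differentiable (at x)) \<and> (\<forall>v. Ck_on k S (\<lambda>x. frechet_derivative f (at x) v))"

definition smooth_on :: "'e::real_normed_vector set \<Rightarrow> ('e \<Rightarrow> 'f::real_normed_vector) \<Rightarrow> bool" where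
  "smooth_on S f \<longleftrightarrow> (\<forall>k. Ck_on k S f)"

text \<open>The manifold is the whole type \<^typ>\<open>'a\<close>; its smooth structure is given by an atlas of charts
  (domain, coordinate map) with values in \<^typ>\<open>real^'n\<close>.\<close>

type_synonym ('a, 'n) chart = "'a set \<times> ('a \<Rightarrow> real^'n)"
type_synonym ('a, 'n) atlas = "('a, 'n) chart set"

definition is_chart :: "('a::topological_space, 'n::finite) chart \<Rightarrow> bool" where
  "is_chart c \<longleftrightarrow> (case c of (D, \<phi>) \<Rightarrow>
     open D \<and> open (\<phi> ` D) \<and> homeomorphism D (\<phi> ` D) \<phi> (inv_into D \<phi>))"

definition smooth_transition :: "('a, 'n::finite) chart \<Rightarrow> ('a, 'n) chart \<Rightarrow> bool" where
  "smooth_transition c c' \<longleftrightarrow> (case (c, c') of ((D, \<phi>), (E, \<psi>)) \<Rightarrow>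
     smooth_on (\<phi> ` (D \<inter> E)) (\<psi> \<circ> inv_into D \<phi>))"

text \<open>Local coordinate systems: the charts of the maximal atlas generated by \<open>At\<close>.\<close>

definition coordinate_system :: "('a::topological_space, 'n::finite) atlas \<Rightarrow> ('a, 'n) chart \<Rightarrow> bool" where
  "coordinate_system At c \<longleftrightarrow>
     is_chart c \<and> (\<forall>c'\<in>At. smooth_transition c c' \<and> smooth_transition c' c)"

definition smooth_atlas :: "('a::topological_space, 'n::finite) atlas \<Rightarrow> bool" where
  "smooth_atlas At \<longleftrightarrow> (\<forall>c\<in>At. coordinate_system At c) \<and> (\<Union>c\<in>At. fst c) = UNIV"

definition smooth_fun :: "('a, 'n::finite) atlas \<Rightarrow> 'a set \<Rightarrow> ('a \<Rightarrow> real) \<Rightarrow> bool" where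
  "smooth_fun At U f \<longleftrightarrow> (\<forall>(D, \<phi>)\<in>At. smooth_on (\<phi> ` (D \<inter> U)) (f \<circ> inv_into D \<phi>))"

definition smooth_near :: "('a::topological_space, 'n::finite) atlas \<Rightarrow> 'a \<Rightarrow> ('a \<Rightarrow> real) \<Rightarrow> bool" where
  "smooth_near At p f \<longleftrightarrow> (\<exists>U. open U \<and> p \<in> U \<and> smooth_fun At U f)"

section \<open>Tangent vectors, vector fields and tensor fields\<close>

text \<open>A tangent vector at \<open>p\<close> is a derivation on the functions that are smooth near \<open>p\<close>, with value
  \<open>0\<close> (by convention, so that equality of tangent vectors is equality) on all other functions.
  It only depends on germs: if \<open>d = 0\<close> near \<open>p\<close>, then \<open>\<chi> d = 0\<close> everywhere for the indicator
  function \<open>\<chi>\<close> of a small neighbourhood of \<open>p\<close>, and the Leibniz rule gives \<open>v d = v (\<chi> d) = 0\<close>.\<close>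

type_synonym 'a tvec = "('a \<Rightarrow> real) \<Rightarrow> real"
type_synonym 'a vfield = "'a \<Rightarrow> 'a tvec"
type_synonym 'a tensor2 = "'a \<Rightarrow> 'a tvec \<Rightarrow> 'a tvec \<Rightarrow> real"
type_synonym 'a tensor4 = "'a \<Rightarrow> 'a tvec \<Rightarrow> 'a tvec \<Rightarrow> 'a tvec \<Rightarrow> 'a tvec \<Rightarrow> real"

definition tangent :: "('a::topological_space, 'n::finite) atlas \<Rightarrow> 'a \<Rightarrow> 'a tvec set" where
  "tangent At p = {v.
     (\<forall>f. \<not> smooth_near At p f \<longrightarrow> v f = 0) \<and>
     (\<forall>f h a b. smooth_near At p f \<and> smooth_near At p h \<longrightarrow>
        v (\<lambda>q. a * f q + b * h q) = a * v f + b * v h) \<and>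
     (\<forall>f h. smooth_near At p f \<and> smooth_near At p h \<longrightarrow>
        v (\<lambda>q. f q * h q) = f p * v h + h p * v f)}"

abbreviation tzero :: "'a tvec" where
  "tzero \<equiv> \<lambda>f. 0"

definition coord_vec :: "('a::topological_space, 'n::finite) atlas \<Rightarrow> ('a, 'n) chart \<Rightarrow> 'n \<Rightarrow> 'a vfield" where
  "coord_vec At c i p f = (case c of (D, \<phi>) \<Rightarrow>
     if smooth_near At p f
     then frechet_derivative (f \<circ> inv_into D \<phi>) (at (\<phi> p)) (axis i 1) else 0)"

definition smooth_vf :: "('a::topological_space, 'n::finite) atlas \<Rightarrow> 'a set \<Rightarrow> 'a vfield \<Rightarrow> bool" where
  "smooth_vf At U V \<longleftrightarrow>
     (\<forall>p\<in>U. V p \<in> tangent At p) \<and>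
     (\<forall>W f. open W \<and> W \<subseteq> U \<and> smooth_fun At W f \<longrightarrow> smooth_fun At W (\<lambda>p. V p f))"

definition lie_bracket ::
  "('a::topological_space, 'n::finite) atlas \<Rightarrow> 'a vfield \<Rightarrow> 'a vfield \<Rightarrow> 'a vfield" where
  "lie_bracket At V X p f =
     (if smooth_near At p f then V p (\<lambda>q. X q f) - X p (\<lambda>q. V q f) else 0)"

definition linear_form :: "('a::topological_space, 'n::finite) atlas \<Rightarrow> 'a \<Rightarrow> ('a tvec \<Rightarrow> real) \<Rightarrow> bool" where
  "linear_form At p l \<longleftrightarrow> (\<forall>v\<in>tangent At p. \<forall>w\<in>tangent At p. \<forall>a b.
     l (\<lambda>f. a * v f + b * w f) = a * l v + b * l w)"

definition smooth_symmetric_tensor2 ::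
  "('a::topological_space, 'n::finite) atlas \<Rightarrow> 'a tensor2 \<Rightarrow> bool" where
  "smooth_symmetric_tensor2 At g \<longleftrightarrow>
     (\<forall>p. \<forall>v\<in>tangent At p. linear_form At p (g p v)) \<and>
     (\<forall>p. \<forall>v\<in>tangent At p. \<forall>w\<in>tangent At p. g p v w = g p w v) \<and>
     (\<forall>U V W. open U \<and> smooth_vf At U V \<and> smooth_vf At U W \<longrightarrow>
        smooth_fun At U (\<lambda>p. g p (V p) (W p)))"

definition smooth_tensor4 ::
  "('a::topological_space, 'n::finite) atlas \<Rightarrow> 'a set \<Rightarrow> 'a tensor4 \<Rightarrow> bool" where
  "smooth_tensor4 At W T \<longleftrightarrow>
     (\<forall>p\<in>W. \<forall>u\<in>tangent At p. \<forall>v\<in>tangent At p. \<forall>w\<in>tangent At p.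
        linear_form At p (\<lambda>x. T p x u v w) \<and> linear_form At p (\<lambda>x. T p u x v w) \<and>
        linear_form At p (\<lambda>x. T p u v x w) \<and> linear_form At p (\<lambda>x. T p u v w x)) \<and>
     (\<forall>U A B C D. open U \<and> U \<subseteq> W \<and>
        smooth_vf At U A \<and> smooth_vf At U B \<and> smooth_vf At U C \<and> smooth_vf At U D \<longrightarrow>
        smooth_fun At U (\<lambda>p. T p (A p) (B p) (C p) (D p)))"

section \<open>Singular spaces\<close>

definition Rad :: "('a::topological_space, 'n::finite) atlas \<Rightarrow> 'a tensor2 \<Rightarrow> 'a \<Rightarrow> 'a tvec set" where
  "Rad At g p = {v \<in> tangent At p. \<forall>w\<in>tangent At p. g p v w = 0}"

definition Sing :: "('a::topological_space, 'n::finite) atlas \<Rightarrow> 'a tensor2 \<Rightarrow> 'a set" where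
  "Sing At g = {p. Rad At g p \<noteq> {tzero}}"

definition gram_det ::
  "('a::topological_space, 'n::finite) atlas \<Rightarrow> 'a tensor2 \<Rightarrow> ('a, 'n) chart \<Rightarrow> 'a \<Rightarrow> real" where
  "gram_det At g c p =
     det ((\<chi> a b. g p (coord_vec At c a p) (coord_vec At c b p)) :: real^'n^'n)"

definition transverse_singular_space ::
  "('a::topological_space, 'n::finite) atlas \<Rightarrow> 'a tensor2 \<Rightarrow> bool" where
  "transverse_singular_space At g \<longleftrightarrow>
     smooth_symmetric_tensor2 At g \<and> Sing At g \<noteq> {} \<and>
     (\<forall>D \<phi>. coordinate_system At (D, \<phi>) \<longrightarrow> (\<forall>p\<in>Sing At g \<inter> D.
        frechet_derivative (gram_det At g (D, \<phi>) \<circ> inv_into D \<phi>) (at (\<phi> p)) \<noteq> (\<lambda>v. 0)))"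

text \<open>The tangent space of the hypersurface \<open>\<Sigma>\<close>, as a subspace of that of the manifold: the tangent
  vectors that annihilate all smooth functions vanishing on \<open>\<Sigma>\<close>.\<close>

definition tangent_Sing ::
  "('a::topological_space, 'n::finite) atlas \<Rightarrow> 'a tensor2 \<Rightarrow> 'a \<Rightarrow> 'a tvec set" where
  "tangent_Sing At g p = {v \<in> tangent At p.
     \<forall>U f. open U \<and> p \<in> U \<and> smooth_fun At U f \<and> (\<forall>q\<in>Sing At g \<inter> U. f q = 0) \<longrightarrow> v f = 0}"

definition tangent_radical :: "('a::topological_space, 'n::finite) atlas \<Rightarrow> 'a tensor2 \<Rightarrow> bool" where
  "tangent_radical At g \<longleftrightarrow> (\<forall>p\<in>Sing At g. Rad At g p \<subseteq> tangent_Sing At g p)"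

text \<open>\<open>g p\<close> is nondegenerate with exactly \<open>k\<close> minus signs in its signature; note that \<open>e\<close> has
  \<^term>\<open>CARD('n)\<close> members, hence is an orthonormal basis.\<close>

definition nondegenerate_of_index ::
  "('a::topological_space, 'n::finite) atlas \<Rightarrow> 'a tensor2 \<Rightarrow> 'a \<Rightarrow> nat \<Rightarrow> bool" where
  "nondegenerate_of_index At g p k \<longleftrightarrow> (\<exists>e :: 'n \<Rightarrow> 'a tvec.
     (\<forall>i. e i \<in> tangent At p) \<and> (\<forall>i j. i \<noteq> j \<longrightarrow> g p (e i) (e j) = 0) \<and>
     (\<forall>i. g p (e i) (e i) \<in> {1, -1}) \<and> card {i. g p (e i) (e i) = -1} = k)"

definition riemann_lorentz :: "('a::topological_space, 'n::finite) atlas \<Rightarrow> 'a tensor2 \<Rightarrow> bool" where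
  "riemann_lorentz At g \<longleftrightarrow>
     (\<forall>q. q \<notin> Sing At g \<longrightarrow>
        nondegenerate_of_index At g q 0 \<or> nondegenerate_of_index At g q 1) \<and>
     (\<forall>p\<in>Sing At g. \<forall>U. open U \<and> p \<in> U \<longrightarrow>
        (\<exists>q\<in>U. nondegenerate_of_index At g q 0) \<and> (\<exists>q\<in>U. nondegenerate_of_index At g q 1))"

section \<open>Vector fields along (parts of) the singular hypersurface\<close>

definition vf_extends ::
  "('a::topological_space, 'n::finite) atlas \<Rightarrow> 'a set \<Rightarrow> 'a vfield \<Rightarrow> 'a set \<Rightarrow> 'a vfield \<Rightarrow> bool" where
  "vf_extends At S A U AA \<longleftrightarrow> smooth_vf At U AA \<and> (\<forall>q\<in>S \<inter> U. AA q = A q)"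

definition vf_along :: "('a::topological_space, 'n::finite) atlas \<Rightarrow> 'a set \<Rightarrow> 'a vfield \<Rightarrow> bool" where
  "vf_along At S A \<longleftrightarrow> (\<forall>p\<in>S. \<exists>U AA. open U \<and> p \<in> U \<and> vf_extends At S A U AA)"

definition tangent_vf_along ::
  "('a::topological_space, 'n::finite) atlas \<Rightarrow> 'a tensor2 \<Rightarrow> 'a set \<Rightarrow> 'a vfield \<Rightarrow> bool" where
  "tangent_vf_along At g S X \<longleftrightarrow> vf_along At S X \<and> (\<forall>p\<in>S. X p \<in> tangent_Sing At g p)"

definition radical_vf_along ::
  "('a::topological_space, 'n::finite) atlas \<Rightarrow> 'a tensor2 \<Rightarrow> 'a set \<Rightarrow> 'a vfield \<Rightarrow> bool" where
  "radical_vf_along At g S X \<longleftrightarrow> vf_along At S X \<and> (\<forall>p\<in>S. X p \<in> Rad At g p)"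

definition local_ext ::
  "('a::topological_space, 'n::finite) atlas \<Rightarrow> 'a set \<Rightarrow> 'a vfield \<Rightarrow> 'a \<Rightarrow> 'a vfield" where
  "local_ext At S A p = (SOME AA. \<exists>U. open U \<and> p \<in> U \<and> vf_extends At S A U AA)"

text \<open>The dual connection: \<open>dual_conn At g A B C\<close> is \<open>\<box>\<^sub>A B (C)\<close>.\<close>

definition dual_conn ::
  "('a::topological_space, 'n::finite) atlas \<Rightarrow> 'a tensor2 \<Rightarrow>
   'a vfield \<Rightarrow> 'a vfield \<Rightarrow> 'a vfield \<Rightarrow> 'a \<Rightarrow> real" where
  "dual_conn At g A B C p =
     (A p (\<lambda>q. g q (B q) (C q)) + B p (\<lambda>q. g q (C q) (A q)) - C p (\<lambda>q. g q (A q) (B q))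
      + g p (lie_bracket At A B p) (C p) - g p (lie_bracket At B C p) (A p)
      + g p (lie_bracket At C A p) (B p)) / 2"

text \<open>\<open>\<box>\<^sub>A B (C)\<close> for fields along \<open>S\<close>, computed with arbitrary local extensions. It is only used where
  the result does not depend on them: when \<open>C\<close> is radical, or when \<open>A\<close> and \<open>B\<close> are tangent to \<open>\<Sigma>\<close>.
  Below, \<open>S\<close> is always a relatively open part of \<open>\<Sigma>\<close>.\<close>

definition dual_conn_along ::
  "('a::topological_space, 'n::finite) atlas \<Rightarrow> 'a tensor2 \<Rightarrow> 'a set \<Rightarrow>
   'a vfield \<Rightarrow> 'a vfield \<Rightarrow> 'a vfield \<Rightarrow> 'a \<Rightarrow> real" where
  "dual_conn_along At g S A B C p =
     dual_conn At g (local_ext At S A p) (local_ext At S B p) (local_ext At S C p) p"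

definition second_II ::
  "('a::topological_space, 'n::finite) atlas \<Rightarrow> 'a tensor2 \<Rightarrow> 'a set \<Rightarrow> 'a vfield \<Rightarrow>
   'a vfield \<Rightarrow> 'a vfield \<Rightarrow> 'a \<Rightarrow> real" where
  "second_II At g S R' A B p = dual_conn_along At g S A B R' p"

definition second_fundamental_form ::
  "('a::topological_space, 'n::finite) atlas \<Rightarrow> 'a tensor2 \<Rightarrow> 'a set \<Rightarrow> 'a vfield \<Rightarrow>
   'a vfield \<Rightarrow> 'a vfield \<Rightarrow> 'a \<Rightarrow> real" where
  "second_fundamental_form At g S N X Y p = dual_conn_along At g S X Y N p"

definition main_normal ::
  "('a::topological_space, 'n::finite) atlas \<Rightarrow> 'a tensor2 \<Rightarrow> 'a set \<Rightarrow> 'a vfield \<Rightarrow> bool" where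
  "main_normal At g S N \<longleftrightarrow> vf_along At S N \<and>
     (\<forall>p\<in>S. \<forall>v\<in>tangent_Sing At g p. g p (N p) v = 0) \<and>
     (\<forall>R'. radical_vf_along At g S R' \<longrightarrow> (\<forall>p\<in>S. second_II At g S R' N N p = 0)) \<and>
     (\<forall>p\<in>S. g p (N p) (N p) = 1)"

definition main_radical ::
  "('a::topological_space, 'n::finite) atlas \<Rightarrow> 'a tensor2 \<Rightarrow> 'a set \<Rightarrow> 'a vfield \<Rightarrow> 'a vfield \<Rightarrow> bool" where
  "main_radical At g S N R \<longleftrightarrow> tangent_vf_along At g S R \<and> radical_vf_along At g S R \<and>
     (\<forall>p\<in>S. second_fundamental_form At g S N R R p = -1)"

definition screen_section ::
  "('a::topological_space, 'n::finite) atlas \<Rightarrow> 'a tensor2 \<Rightarrow> 'a set \<Rightarrow> 'a vfield \<Rightarrow> 'a vfield \<Rightarrow>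
   'a vfield \<Rightarrow> bool" where
  "screen_section At g S N R V \<longleftrightarrow> tangent_vf_along At g S V \<and>
     (\<forall>p\<in>S. second_fundamental_form At g S N V R p = 0)"

text \<open>The sections \<open>V\<close>, \<open>W\<close> of the screen distribution may be defined on an open part of \<open>S\<close> only;
  since \<open>II\<close> is tensorial, this amounts to the same as sections on all of \<open>S\<close>.\<close>

definition II_flat ::
  "('a::topological_space, 'n::finite) atlas \<Rightarrow> 'a tensor2 \<Rightarrow> 'a set \<Rightarrow> 'a vfield \<Rightarrow> 'a vfield \<Rightarrow> bool" where
  "II_flat At g S N R \<longleftrightarrow>
     (\<forall>U V W. open U \<and>
        screen_section At g (S \<inter> U) N R V \<and> screen_section At g (S \<inter> U) N R W \<longrightarrow>
        (\<forall>p\<in>S \<inter> U. second_II At g (S \<inter> U) R V W p = 0))"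

definition nu :: "'a tensor2 \<Rightarrow> 'a vfield \<Rightarrow> 'a vfield \<Rightarrow> 'a \<Rightarrow> real" where
  "nu g N A p = g p (A p) (N p)"

definition rho ::
  "('a::topological_space, 'n::finite) atlas \<Rightarrow> 'a tensor2 \<Rightarrow> 'a set \<Rightarrow> 'a vfield \<Rightarrow> 'a vfield \<Rightarrow>
   'a vfield \<Rightarrow> 'a \<Rightarrow> real" where
  "rho At g S N R A p =
     - second_fundamental_form At g S N (\<lambda>q f. A q f - nu g N A q * N q f) R p"

section \<open>Curvature away from the singular hypersurface\<close>

definition levi_civita ::
  "('a::topological_space, 'n::finite) atlas \<Rightarrow> 'a tensor2 \<Rightarrow> 'a set \<Rightarrow>
   ('a vfield \<Rightarrow> 'a vfield \<Rightarrow> 'a vfield) \<Rightarrow> bool" where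
  "levi_civita At g M nabla \<longleftrightarrow>
     (\<forall>U V X Y. open U \<and> U \<subseteq> M \<and> smooth_vf At U V \<and> smooth_vf At U X \<and> smooth_vf At U Y \<longrightarrow>
        smooth_vf At U (nabla V X) \<and>
        (\<forall>h k. smooth_fun At U h \<and> smooth_fun At U k \<longrightarrow> (\<forall>p\<in>U.
           nabla (\<lambda>q f. h q * V q f + k q * X q f) Y p =
             (\<lambda>f. h p * nabla V Y p f + k p * nabla X Y p f))) \<and>
        (\<forall>p\<in>U. nabla V (\<lambda>q f. X q f + Y q f) p = (\<lambda>f. nabla V X p f + nabla V Y p f)) \<and>
        (\<forall>h. smooth_fun At U h \<longrightarrow> (\<forall>p\<in>U.
           nabla V (\<lambda>q f. h q * X q f) p = (\<lambda>f. V p h * X p f + h p * nabla V X p f))) \<and>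
        (\<forall>p\<in>U. (\<lambda>f. nabla V X p f - nabla X V p f) = lie_bracket At V X p) \<and>
        (\<forall>p\<in>U. V p (\<lambda>q. g q (X q) (Y q)) = g p (nabla V X p) (Y p) + g p (X p) (nabla V Y p)))"

definition curvature ::
  "('a::topological_space, 'n::finite) atlas \<Rightarrow> ('a vfield \<Rightarrow> 'a vfield \<Rightarrow> 'a vfield) \<Rightarrow>
   'a vfield \<Rightarrow> 'a vfield \<Rightarrow> 'a vfield \<Rightarrow> 'a vfield" where
  "curvature At nabla A B C p =
     (\<lambda>f. nabla A (nabla B C) p f - nabla B (nabla A C) p f - nabla (lie_bracket At A B) C p f)"

text \<open>The main normal and main radical fields \<open>N\<close>, \<open>R\<close> along \<open>\<Sigma> \<inter> W\<close>, their canonical extensions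
  \<open>NN\<close>, \<open>RR\<close> to the open set \<open>W\<close>, and the tensor field \<open>\<Upsilon>\<close> on \<open>W\<close> they determine. Such data exist near
  every point of \<open>\<Sigma>\<close>, but in general not on a neighbourhood of all of \<open>\<Sigma>\<close>: \<open>R\<close> exists globally only if
  the radical line bundle is orientable.\<close>

definition canonical_data ::
  "('a::topological_space, 'n::finite) atlas \<Rightarrow> 'a tensor2 \<Rightarrow> ('a vfield \<Rightarrow> 'a vfield \<Rightarrow> 'a vfield) \<Rightarrow>
   'a set \<Rightarrow> 'a vfield \<Rightarrow> 'a vfield \<Rightarrow> 'a vfield \<Rightarrow> 'a vfield \<Rightarrow> 'a tensor4 \<Rightarrow> bool" where
  "canonical_data At g nabla W N R NN RR Ups \<longleftrightarrow>
     open W \<and> main_normal At g (Sing At g \<inter> W) N \<and> main_radical At g (Sing At g \<inter> W) N R \<and>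
     vf_extends At (Sing At g) N W NN \<and> (\<forall>p\<in>W - Sing At g. nabla NN NN p = tzero) \<and>
     vf_extends At (Sing At g) R W RR \<and> (\<forall>p\<in>W. lie_bracket At NN RR p = tzero) \<and>
     smooth_tensor4 At W Ups \<and>
     (\<forall>U A B C D. open U \<and> U \<subseteq> W - Sing At g \<and>
        smooth_vf At U A \<and> smooth_vf At U B \<and> smooth_vf At U C \<and> smooth_vf At U D \<longrightarrow>
        (\<forall>p\<in>U. Ups p (A p) (B p) (C p) (D p) =
           g p (RR p) (RR p) * g p (curvature At nabla A B C p) (D p)))"

text \<open>\<open>F0\<close> is the restriction to \<open>\<Sigma>\<close> of the smooth extension of \<open>\<langle>R(A,B)C,D\<rangle>\<close>; it must be common to
  all extensions of the four fields. Extensions may be defined on any open set.\<close>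

definition curvature_well_defined ::
  "('a::topological_space, 'n::finite) atlas \<Rightarrow> 'a tensor2 \<Rightarrow> ('a vfield \<Rightarrow> 'a vfield \<Rightarrow> 'a vfield) \<Rightarrow>
   'a vfield \<Rightarrow> 'a vfield \<Rightarrow> 'a vfield \<Rightarrow> 'a vfield \<Rightarrow> bool" where
  "curvature_well_defined At g nabla A B C D \<longleftrightarrow>
     (\<exists>F0. \<forall>U AA BB CC DD. open U \<and>
        vf_extends At (Sing At g) A U AA \<and> vf_extends At (Sing At g) B U BB \<and>
        vf_extends At (Sing At g) C U CC \<and> vf_extends At (Sing At g) D U DD \<longrightarrow>
        (\<exists>F. smooth_fun At U F \<and>
           (\<forall>p\<in>U - Sing At g. F p = g p (curvature At nabla AA BB CC p) (DD p)) \<and>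
           (\<forall>p\<in>U \<inter> Sing At g. F p = F0 p)))"

definition all_slots_vanish ::
  "('a::topological_space, 'n::finite) atlas \<Rightarrow> 'a tensor4 \<Rightarrow>
   'a vfield \<Rightarrow> 'a vfield \<Rightarrow> 'a vfield \<Rightarrow> 'a vfield \<Rightarrow> 'a \<Rightarrow> bool" where
  "all_slots_vanish At Ups A B C D p \<longleftrightarrow> (\<forall>x\<in>tangent At p.
     Ups p x (B p) (C p) (D p) = 0 \<and> Ups p (A p) x (C p) (D p) = 0 \<and>
     Ups p (A p) (B p) x (D p) = 0 \<and> Ups p (A p) (B p) (C p) x = 0)"

definition nu_rho_matrix ::
  "('a::topological_space, 'n::finite) atlas \<Rightarrow> 'a tensor2 \<Rightarrow> 'a set \<Rightarrow> 'a vfield \<Rightarrow> 'a vfield \<Rightarrow>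
   'a vfield \<Rightarrow> 'a vfield \<Rightarrow> 'a \<Rightarrow> real^2^2" where
  "nu_rho_matrix At g S N R A B p =
     vector [vector [nu g N A p, nu g N B p],
             vector [rho At g S N R A p, rho At g S N R B p]]"

end

theory Submission
  imports Defs
begin

text \<open>Near a point of \<open>\<Sigma>\<close> a function vanishing on \<open>\<Sigma>\<close> is divisible by the Gram determinant, hence by
  \<open>\<tau>\<close>, since \<open>\<H>(R,R) = -1\<close> gives \<open>\<N>\<tau> = 2\<close> on \<open>\<Sigma>\<close>. Therefore \<open>\<langle>R(A,B)C,D\<rangle> = \<Upsilon>(A,B,C,D)/\<tau>\<close>
  extends smoothly as soon as \<open>\<Upsilon>(A,B,C,D)\<close> vanishes on \<open>\<Sigma>\<close>; the boundary value is
  \<open>\<N>(\<Upsilon>(A,B,C,D))/2\<close>, and changing an extension by a field vanishing on \<open>\<Sigma>\<close> alters it by a multiple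
  of \<open>\<Upsilon>\<close> with one slot replaced. Conversely, replacing the extension \<open>A\<close> by \<open>A + \<tau>X\<close> changes
  \<open>\<langle>R(A,B)C,D\<rangle>\<close> by exactly \<open>\<Upsilon>(X,B,C,D)\<close>.

  For the second part, the singular part of \<open>\<langle>R(A,B)C,D\<rangle>\<close> is
  \<open>\<langle>\<nabla>\<^sub>AC,\<nabla>\<^sub>BD\<rangle> - \<langle>\<nabla>\<^sub>BC,\<nabla>\<^sub>AD\<rangle>\<close>, and \<open>\<tau>\<close> times the inverse metric tends to \<open>R \<otimes> R\<close>, so that
  \<open>\<Upsilon>(A,B,C,D) = II(A,C)II(B,D) - II(B,C)II(A,D)\<close> on \<open>\<Sigma>\<close>. If \<open>\<Sigma>\<close> is \<open>II\<close>-flat, then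
  \<open>II(A,B) = \<nu>(A)\<rho>(B) + \<rho>(A)\<nu>(B)\<close> and \<open>\<Upsilon>(A,B,C,D) = - det P det Q\<close>.\<close>

section \<open>Smooth functions on Euclidean spaces\<close>

text \<open>Tangent vectors are derivations and T\<Sigma> is the annihilator of the functions
  vanishing on \<Sigma>; no submanifold structure of \<Sigma> is set up. Two consequences of
  transversality replace it. The regular points are dense, so an identity between smooth functions
  need only be checked off \<Sigma>, where \<open>nabla\<close> exists. And a function vanishing on
  \<Sigma> is locally a multiple of \<tau>, so T\<Sigma> is the kernel of d\<tau>.

  The dual connection is tensorial in its first and third slots but not in the second. The second
  slot becomes insensitive to the extension when the third is radical, or when the first is tangent
  to \<Sigma>; these are the two situations in which II and H are evaluated.

  N, R and \<Upsilon> exist only patchwise, whereas the boundary value of the curvature must be one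
  function on \<Sigma>. It is therefore described without reference to a patch
  (\<open>curvature_limit\<close>), and any patch around a point proves its uniqueness
  there.\<close>

abbreviation "D_at f x \<equiv> frechet_derivative f (at x)"

lemma Ck_on_cong:
  assumes "open S" "\<And>x. x \<in> S \<Longrightarrow> f x = h x"
  shows "Ck_on k S f \<longleftrightarrow> Ck_on k S h"
  using assms
proof (induction k arbitrary: f h)
  case 0
  then show ?case by (auto intro: continuous_on_cong)
next
  case (Suc k)
  have d: "(f has_derivative D) (at x) \<longleftrightarrow> (h has_derivative D) (at x)" if "x \<in> S" for x D
    using has_derivative_transform_within_open[of _ _ x UNIV S] that Suc.prems
    by (metis (no_types, lifting))
  have "f differentiable (at x) \<longleftrightarrow> h differentiable (at x)" if "x \<in> S" for x
    using d[OF that] by (auto simp: differentiable_def)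
  moreover have "Ck_on k S (\<lambda>x. D_at f x v) \<longleftrightarrow> Ck_on k S (\<lambda>x. D_at h x v)" for v
    by (rule Suc.IH) (use d Suc.prems in \<open>auto simp: frechet_derivative_def\<close>)
  ultimately show ?case by auto
qed

lemma Ck_SucI:
  assumes "open S" and d: "\<And>x. x \<in> S \<Longrightarrow> (f has_derivative D x) (at x)"
    and "\<And>v. Ck_on k S (\<lambda>x. D x v)"
  shows "Ck_on (Suc k) S f"
proof -
  have "Ck_on k S (\<lambda>x. D_at f x v)" for v
    using assms(3)[of v] Ck_on_cong[OF assms(1), of "\<lambda>x. D x v" "\<lambda>x. D_at f x v" k]
      frechet_derivative_at[OF d] by auto
  then show ?thesis using d by (auto simp: differentiable_def)
qed

lemma Ck_SucD:
  assumes "Ck_on (Suc k) S f"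
  shows "x \<in> S \<Longrightarrow> (f has_derivative D_at f x) (at x)"
    and "Ck_on k S (\<lambda>x. D_at f x v)"
  using assms by (auto simp: frechet_derivative_works)

lemma Ck_Suc_imp:
  assumes "Ck_on (Suc k) S f" shows "Ck_on k S f"
  using assms
proof (induction k arbitrary: f)
  case 0
  then show ?case
    by (auto intro!: differentiable_imp_continuous_on simp: differentiable_on_def differentiable_at_withinI)
next
  case (Suc k)
  then show ?case by (metis Ck_on.simps(2))
qed

lemma Ck_const: "Ck_on k S (\<lambda>x. c)"
  by (induction k arbitrary: c) auto

lemma Ck_bounded_linear:
  assumes "bounded_linear L" "open S" shows "Ck_on k S L"
proof (cases k)
  case 0
  then show ?thesis using assms by (simp add: linear_continuous_on)
next
  case (Suc n)
  show ?thesis unfolding Suc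
    by (rule Ck_SucI[where D = "\<lambda>x. L"])
       (use assms in \<open>auto intro: bounded_linear_imp_has_derivative Ck_const\<close>)
qed

lemma Ck_bounded_linear_compose:
  assumes "bounded_linear L" "open S" "Ck_on k S f" shows "Ck_on k S (\<lambda>x. L (f x))"
  using assms(3)
proof (induction k arbitrary: f)
  case 0
  then show ?case using bounded_linear.continuous_on[OF assms(1)] by auto
next
  case (Suc k)
  show ?case
    by (rule Ck_SucI[where D = "\<lambda>x v. L (D_at f x v)"])
       (use assms Suc Ck_SucD[OF Suc.prems] in \<open>auto intro: bounded_linear.has_derivative\<close>)
qed

lemma Ck_add:
  assumes "open S" "Ck_on k S f" "Ck_on k S h" shows "Ck_on k S (\<lambda>x. f x + h x)"
  using assms(2,3)
proof (induction k arbitrary: f h)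
  case 0
  then show ?case by (auto intro: continuous_on_add)
next
  case (Suc k)
  show ?case
    by (rule Ck_SucI[where D = "\<lambda>x v. D_at f x v + D_at h x v"])
       (use assms(1) Suc.IH Ck_SucD[OF Suc.prems(1)] Ck_SucD[OF Suc.prems(2)] in \<open>auto intro: has_derivative_add\<close>)
qed

lemma Ck_sum:
  assumes "open S" "\<And>i. i \<in> I \<Longrightarrow> Ck_on k S (f i)" shows "Ck_on k S (\<lambda>x. \<Sum>i\<in>I. f i x)"
  using assms(2) by (induction I rule: infinite_finite_induct) (auto intro: Ck_const Ck_add assms(1))

lemma Ck_bilinear:
  assumes "bounded_bilinear B" "open S" "Ck_on k S f" "Ck_on k S h"
  shows "Ck_on k S (\<lambda>x. B (f x) (h x))"
  using assms(3,4)
proof (induction k arbitrary: f h)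
  case 0
  then show ?case using bounded_bilinear.continuous_on[OF assms(1)] by auto
next
  case (Suc k)
  show ?case
  proof (rule Ck_SucI[where D = "\<lambda>x v. B (f x) (D_at h x v) + B (D_at f x v) (h x)"])
    show "open S" by fact
    show "((\<lambda>x. B (f x) (h x)) has_derivative
       (\<lambda>v. B (f x) (D_at h x v) + B (D_at f x v) (h x))) (at x)" if "x \<in> S" for x
      by (rule bounded_bilinear.FDERIV[OF assms(1) Ck_SucD(1)[OF Suc.prems(1) that] Ck_SucD(1)[OF Suc.prems(2) that]])
    show "Ck_on k S (\<lambda>x. B (f x) (D_at h x v) + B (D_at f x v) (h x))" for v
      by (intro Ck_add assms(2) Suc.IH Ck_SucD(2)[OF Suc.prems(1)] Ck_SucD(2)[OF Suc.prems(2)]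
          Ck_Suc_imp[OF Suc.prems(1)] Ck_Suc_imp[OF Suc.prems(2)])
  qed
qed

lemmas Ck_mult = Ck_bilinear[OF bounded_bilinear_mult]
lemmas Ck_scaleR = Ck_bilinear[OF bounded_bilinear_scaleR]

lemma Ck_inverse:
  fixes f :: "'e::real_normed_vector \<Rightarrow> real"
  assumes "open S" "\<And>x. x \<in> S \<Longrightarrow> f x \<noteq> 0" "Ck_on k S f"
  shows "Ck_on k S (\<lambda>x. inverse (f x))"
  using assms(3)
proof (induction k)
  case 0
  then show ?case using assms(2) by (auto intro: continuous_on_inverse)
next
  case (Suc k)
  show ?case
  proof (rule Ck_SucI[where D = "\<lambda>x v. - 1 * (inverse (f x) * D_at f x v * inverse (f x))"])
    show "open S" by fact
    show "((\<lambda>x. inverse (f x)) has_derivative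
       (\<lambda>v. - 1 * (inverse (f x) * D_at f x v * inverse (f x)))) (at x)" if "x \<in> S" for x
      using Deriv.has_derivative_inverse[OF assms(2)[OF that] Ck_SucD(1)[OF Suc.prems that]] by simp
    show "Ck_on k S (\<lambda>x. - 1 * (inverse (f x) * D_at f x v * inverse (f x)))" for v
      by (intro Ck_mult Ck_const assms(1) Suc.IH Ck_SucD(2)[OF Suc.prems(1)] Ck_Suc_imp[OF Suc.prems(1)])
  qed
qed

text \<open>The chain rule is expanded over \<open>Basis\<close>: the derivative becomes a finite
  sum of coefficients of the derivative of \<open>g\<close> times partial derivatives of
  \<open>f\<close> composed with the same \<open>g\<close>. The induction hypothesis, which leaves
  \<open>f\<close> arbitrary, applies to the latter.\<close>

lemma Ck_compose:
  fixes g :: "'e::real_normed_vector \<Rightarrow> 'f::euclidean_space" and f :: "'f \<Rightarrow> 'g::real_normed_vector"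
  assumes "open S" "open T" "g ` S \<subseteq> T" "Ck_on k T f" "Ck_on k S g"
  shows "Ck_on k S (\<lambda>x. f (g x))"
  using assms(4,5)
proof (induction k arbitrary: f)
  case 0
  then show ?case using assms(3) by (auto intro: continuous_on_compose2)
next
  case (Suc k)
  show ?case
  proof (rule Ck_SucI[where D = "\<lambda>x v. \<Sum>b\<in>Basis. (D_at g x v \<bullet> b) *\<^sub>R D_at f (g x) b"])
    show "open S" by fact
    show "((\<lambda>x. f (g x)) has_derivative
       (\<lambda>v. \<Sum>b\<in>Basis. (D_at g x v \<bullet> b) *\<^sub>R D_at f (g x) b)) (at x)"
      if "x \<in> S" for x
    proof -
      have fd: "(f has_derivative D_at f (g x)) (at (g x))"
        using Ck_SucD(1)[OF Suc.prems(1)] that assms(3) by auto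
      then have lin: "linear (D_at f (g x))"
        by (rule has_derivative_linear)
      have eq: "D_at f (g x) w = (\<Sum>b\<in>Basis. (w \<bullet> b) *\<^sub>R D_at f (g x) b)" for w
        using linear_sum[OF lin, of "\<lambda>b. (w \<bullet> b) *\<^sub>R b" Basis] linear_cmul[OF lin]
        by (simp add: euclidean_representation)
      show ?thesis
        by (rule has_derivative_compose[OF Ck_SucD(1)[OF Suc.prems(2) that] fd, THEN has_derivative_eq_rhs]) (rule ext, rule eq)
    qed
    show "Ck_on k S (\<lambda>x. \<Sum>b\<in>Basis. (D_at g x v \<bullet> b) *\<^sub>R D_at f (g x) b)" for v
      by (intro Ck_sum Ck_scaleR assms(1) Suc.IH Ck_Suc_imp[OF Suc.prems(2)] Ck_SucD(2)[OF Suc.prems(1)]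
          Ck_bounded_linear_compose[OF bounded_linear_inner_left] Ck_SucD(2)[OF Suc.prems(2)])
  qed
qed

lemma Ck_on_UN:
  assumes "\<And>x. x \<in> S \<Longrightarrow> \<exists>T. open T \<and> x \<in> T \<and> Ck_on k T f"
  shows "Ck_on k S f"
  using assms
proof (induction k arbitrary: f)
  case 0
  show ?case
  proof (clarsimp simp: continuous_on_eq_continuous_within)
    fix x assume "x \<in> S"
    with 0 obtain T where "open T" "x \<in> T" "continuous_on T f" by auto
    then show "continuous (at x within S) f"
      by (simp add: continuous_on_eq_continuous_at continuous_at_imp_continuous_at_within)
  qed
next
  case (Suc k)
  have "f differentiable (at x)" if "x \<in> S" for x using Suc.prems[OF that] by auto
  moreover have "Ck_on k S (\<lambda>x. D_at f x v)" for v
    by (rule Suc.IH) (use Suc.prems in fastforce)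
  ultimately show ?case by simp
qed

lemma Ck_on_subset: "Ck_on k S f \<Longrightarrow> T \<subseteq> S \<Longrightarrow> Ck_on k T f"
  by (induction k arbitrary: f) (auto intro: continuous_on_subset)

section \<open>Integrals along segments that depend on a parameter\<close>

lemma continuous_on_Pair_slice:
  assumes "continuous_on (B \<times> T) h" "y \<in> B" shows "continuous_on T (\<lambda>s. h (y, s))"
  by (rule continuous_on_compose2[OF assms(1)]) (use assms(2) in \<open>auto intro!: continuous_intros\<close>)

text \<open>Differentiation under the integral sign. The weight \<open>c\<close> makes the claim
  stable under induction: differentiating the point of the segment produces factors
  \<open>1 - s\<close> and \<open>s\<close>, which are absorbed into new weights.\<close>

lemma Ck_param_integral:
  fixes \<alpha> \<beta> :: "'e::euclidean_space \<Rightarrow> 'f::euclidean_space" and \<psi> :: "'f \<Rightarrow> real"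
  assumes "open U" "open V" "smooth_on V \<psi>" "smooth_on U \<alpha>" "smooth_on U \<beta>"
    and seg: "\<And>x s. x \<in> U \<Longrightarrow> 0 \<le> s \<Longrightarrow> s \<le> 1 \<Longrightarrow> (1 - s) *\<^sub>R \<alpha> x + s *\<^sub>R \<beta> x \<in> V"
    and "continuous_on {0..1} c"
  shows "Ck_on k U (\<lambda>x. integral {0..1::real} (\<lambda>s. c s * \<psi> ((1 - s) *\<^sub>R \<alpha> x + s *\<^sub>R \<beta> x)))"
proof -
  define \<sigma> where "\<sigma> x s = (1 - s) *\<^sub>R \<alpha> x + s *\<^sub>R \<beta> x" for x s
  have C\<alpha>: "Ck_on k U \<alpha>" and C\<beta>: "Ck_on k U \<beta>" for k using assms(4,5) by (auto simp: smooth_on_def)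
  have c\<alpha>: "continuous_on U \<alpha>" and c\<beta>: "continuous_on U \<beta>" using C\<alpha>[of 0] C\<beta>[of 0] by auto
  have c\<sigma>: "continuous_on (B \<times> {0..1}) (\<lambda>z. h (\<sigma> (fst z) (snd z)))" if "continuous_on V h" "B \<subseteq> U"
    for h :: "'f \<Rightarrow> real" and B
  proof (rule continuous_on_compose2[OF that(1)])
    have "continuous_on (B \<times> {0..1}) (\<lambda>z. \<alpha> (fst z))" "continuous_on (B \<times> {0..1}) (\<lambda>z. \<beta> (fst z))"
      by (rule continuous_on_compose2[OF c\<alpha>] continuous_on_compose2[OF c\<beta>]; use that(2) in \<open>auto intro!: continuous_intros\<close>)+
    then show "continuous_on (B \<times> {0..1}) (\<lambda>z. \<sigma> (fst z) (snd z))"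
      unfolding \<sigma>_def by (intro continuous_intros)
    show "(\<lambda>z. \<sigma> (fst z) (snd z)) ` (B \<times> {0..1}) \<subseteq> V" using seg that(2) by (auto simp: \<sigma>_def)
  qed
  have cc: "continuous_on (B \<times> {0..1}) (\<lambda>z. c (snd z))" if "continuous_on {0..1} c" for B :: "'e set" and c :: "real \<Rightarrow> real"
    by (rule continuous_on_compose2[OF that]) (auto intro!: continuous_intros)
  have int: "(\<lambda>s. c s * h (\<sigma> x s)) integrable_on {0..1}"
    if "x \<in> U" "continuous_on {0..1} c" "continuous_on V h" for c and h :: "'f \<Rightarrow> real" and x
  proof -
    have "continuous_on (U \<times> {0..1}) (\<lambda>z. c (snd z) * h (\<sigma> (fst z) (snd z)))"
      by (intro continuous_on_mult c\<sigma> cc that(2,3) order_refl)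
    from continuous_on_Pair_slice[OF this that(1)]
    show ?thesis by (intro integrable_continuous_interval) simp
  qed
  show ?thesis
    using assms(3,7)
  proof (induction k arbitrary: \<psi> c)
    case 0
    have "continuous_on V \<psi>" using 0(1) by (auto simp: smooth_on_def dest: spec[of _ 0])
    then have "continuous_on (U \<times> cbox 0 1) (\<lambda>(x,s). c s * \<psi> (\<sigma> x s))"
      unfolding split_beta using c\<sigma>[of \<psi> U] cc[OF 0(2)] by (auto intro!: continuous_intros)
    from integral_continuous_on_param[OF this] show ?case by (simp add: \<sigma>_def)
  next
    case (Suc k \<psi> c)
    let ?D\<psi> = "\<lambda>y. D_at \<psi> y"
    let ?D\<sigma> = "\<lambda>x s v. (1 - s) *\<^sub>R D_at \<alpha> x v + s *\<^sub>R D_at \<beta> x v"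
    let ?D = "\<lambda>x v. integral {0..1} (\<lambda>s. c s * ?D\<psi> (\<sigma> x s) (?D\<sigma> x s v))"
    have C\<psi>: "Ck_on k V \<psi>" for k using Suc.prems(1) by (auto simp: smooth_on_def)
    have s\<psi>: "smooth_on V (\<lambda>y. ?D\<psi> y b)" for b
      unfolding smooth_on_def using Ck_SucD(2)[OF C\<psi>] by blast
    have d\<psi>: "(\<psi> has_derivative ?D\<psi> y) (at y)" if "y \<in> V" for y using Ck_SucD(1)[OF C\<psi> that] .
    have d\<alpha>: "(\<alpha> has_derivative D_at \<alpha> y) (at y)"
      and d\<beta>: "(\<beta> has_derivative D_at \<beta> y) (at y)" if "y \<in> U" for y
      using Ck_SucD(1)[OF C\<alpha> that] Ck_SucD(1)[OF C\<beta> that] by auto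
    have exp: "?D\<psi> (\<sigma> x s) w = (\<Sum>b\<in>Basis. (w \<bullet> b) * ?D\<psi> (\<sigma> x s) b)" if "x \<in> U" "s \<in> {0..1}" for x s w
    proof -
      have "linear (?D\<psi> (\<sigma> x s))" using d\<psi> seg that by (auto simp: \<sigma>_def intro!: has_derivative_linear)
      from linear_sum[OF this, of "\<lambda>b. (w \<bullet> b) *\<^sub>R b" Basis] linear_cmul[OF this]
      show ?thesis by (simp add: euclidean_representation)
    qed
    have cD: "continuous_on (B \<times> {0..1}) (\<lambda>z. c (snd z) * ?D\<psi> (\<sigma> (fst z) (snd z)) (?D\<sigma> (fst z) (snd z) v))"
      if "B \<subseteq> U" for B v
    proof -
      have "continuous_on U (\<lambda>x. D_at \<alpha> x v)" "continuous_on U (\<lambda>x. D_at \<beta> x v)"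
        using Ck_SucD(2)[OF C\<alpha>, of 0] Ck_SucD(2)[OF C\<beta>, of 0] by auto
      then have "continuous_on (B \<times> {0..1}) (\<lambda>z::'e \<times> real. D_at \<alpha> (fst z) v)"
        "continuous_on (B \<times> {0..1}) (\<lambda>z::'e \<times> real. D_at \<beta> (fst z) v)"
        using that by (auto intro!: continuous_on_compose2[where f = fst and s = "B \<times> {0..1}"] continuous_intros)
      moreover have "continuous_on V (\<lambda>y. ?D\<psi> y b)" for b using Ck_SucD(2)[OF C\<psi>, of 0] by auto
      ultimately have "continuous_on (B \<times> {0..1}) (\<lambda>z. c (snd z) * (\<Sum>b\<in>Basis. (?D\<sigma> (fst z) (snd z) v \<bullet> b) * ?D\<psi> (\<sigma> (fst z) (snd z)) b))"
        using that by (intro continuous_intros cc[OF Suc.prems(2)] c\<sigma>[where h = "\<lambda>y. ?D\<psi> y _"]) auto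
      then show ?thesis
      proof (rule continuous_on_eq)
        fix z :: "'e \<times> real" assume "z \<in> B \<times> {0..1}"
        then have "fst z \<in> U" "snd z \<in> {0..1}" using that by auto
        from exp[OF this, of "?D\<sigma> (fst z) (snd z) v"]
        show "c (snd z) * (\<Sum>b\<in>Basis. (?D\<sigma> (fst z) (snd z) v \<bullet> b) * ?D\<psi> (\<sigma> (fst z) (snd z)) b) =
          c (snd z) * ?D\<psi> (\<sigma> (fst z) (snd z)) (?D\<sigma> (fst z) (snd z) v)" by simp
      qed
    qed
    show ?case
    proof (rule Ck_SucI[where D = ?D])
      show "open U" by fact
      fix x assume "x \<in> U"
      \<comment> \<open>The Leibniz rule for parameter integrals asks for a convex parameter domain
        and for a derivative that is jointly continuous as a bounded linear map; hence the ball, and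
        \<open>Blinfun\<close> below.\<close>
      then obtain e where e: "e > 0" "ball x e \<subseteq> U" using \<open>open U\<close> openE by blast
      define L where "L y s = (\<lambda>v. c s * ?D\<psi> (\<sigma> y s) (?D\<sigma> y s v))" for y s
      have dL: "((\<lambda>y. c s * \<psi> (\<sigma> y s)) has_derivative L y s) (at y)" if "y \<in> U" "s \<in> {0..1}" for y s
      proof -
        have "((\<lambda>y. \<sigma> y s) has_derivative ?D\<sigma> y s) (at y)"
          unfolding \<sigma>_def by (intro has_derivative_add has_derivative_scaleR_right d\<alpha> d\<beta> that)
        moreover have "\<sigma> y s \<in> V" using seg that by (auto simp: \<sigma>_def)
        ultimately show ?thesis
          unfolding L_def by (intro has_derivative_mult_right has_derivative_compose[OF _ d\<psi>])
      qed
      have bl: "blinfun_apply (Blinfun (L y s)) = L y s" if "y \<in> U" "s \<in> {0..1}" for y s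
        by (rule bounded_linear_Blinfun_apply) (use dL[OF that] in \<open>rule has_derivative_bounded_linear\<close>)
      have contB: "continuous_on (ball x e \<times> cbox 0 1) (\<lambda>(y, s). Blinfun (L y s))"
      proof (rule continuous_on_blinfun_componentwise)
        fix i :: 'e
        show "continuous_on (ball x e \<times> cbox 0 1) (\<lambda>z. blinfun_apply (case z of (y, s) \<Rightarrow> Blinfun (L y s)) i)"
        proof (rule continuous_on_eq)
          show "continuous_on (ball x e \<times> cbox 0 1) (\<lambda>z. L (fst z) (snd z) i)"
            unfolding L_def box_real by (rule cD[OF e(2)])
          fix z :: "'e \<times> real" assume "z \<in> ball x e \<times> cbox 0 1"
          then have "fst z \<in> U" "snd z \<in> {0..1}" using e(2) by auto
          from bl[OF this] show "L (fst z) (snd z) i = blinfun_apply (case z of (y, s) \<Rightarrow> Blinfun (L y s)) i"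
            unfolding split_beta by (rule fun_cong[OF sym])
        qed
      qed
      have intg: "(\<lambda>s. c s * \<psi> (\<sigma> y s)) integrable_on cbox 0 1" if "y \<in> ball x e" for y
        using int[OF _ Suc.prems(2)] C\<psi>[of 0] e(2) that by auto
      have "((\<lambda>y. integral (cbox 0 1) (\<lambda>s. c s * \<psi> (\<sigma> y s))) has_derivative
          blinfun_apply (integral (cbox 0 1) (\<lambda>s. Blinfun (L x s)))) (at x within ball x e)"
      proof (rule leibniz_rule[where f = "\<lambda>y s. c s * \<psi> (\<sigma> y s)" and fx = "\<lambda>y s. Blinfun (L y s)"])
        fix y and s :: real assume "y \<in> ball x e" "s \<in> cbox 0 1"
        then have "y \<in> U" "s \<in> {0..1}" using e(2) by auto
        then show "((\<lambda>x. c s * \<psi> (\<sigma> x s)) has_derivative blinfun_apply (Blinfun (L y s))) (at y within ball x e)"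
          unfolding bl[OF \<open>y \<in> U\<close> \<open>s \<in> {0..1}\<close>] by (rule has_derivative_at_withinI[OF dL])
      qed (use e(1) intg contB in simp_all)
      note dI = this
      have Dv: "blinfun_apply (integral (cbox 0 1) (\<lambda>s. Blinfun (L x s))) v = ?D x v" for v
      proof -
        have "continuous_on (cbox 0 1) (\<lambda>s. Blinfun (L x s))"
          using continuous_on_Pair_slice[OF contB, of x] e(1) by simp
        then have "(\<lambda>s. Blinfun (L x s)) integrable_on cbox 0 1"
          by (rule integrable_continuous)
        then have "blinfun_apply (integral (cbox 0 1) (\<lambda>s. Blinfun (L x s))) v = integral (cbox 0 1) (\<lambda>s. blinfun_apply (Blinfun (L x s)) v)"
          by (rule blinfun_apply_integral)
        also have "\<dots> = integral (cbox 0 1) (\<lambda>s. L x s v)"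
          by (rule integral_cong) (use bl[OF \<open>x \<in> U\<close>] in simp)
        finally show ?thesis by (simp add: L_def)
      qed
      have "blinfun_apply (integral (cbox 0 1) (\<lambda>s. Blinfun (L x s))) = ?D x" by (rule ext) (rule Dv)
      with dI have "((\<lambda>y. integral (cbox 0 1) (\<lambda>s. c s * \<psi> (\<sigma> y s))) has_derivative ?D x) (at x within ball x e)"
        by (simp only:)
      then show "((\<lambda>x. integral {0..1} (\<lambda>s. c s * \<psi> ((1 - s) *\<^sub>R \<alpha> x + s *\<^sub>R \<beta> x))) has_derivative ?D x) (at x)"
        using e(1) by (simp only: \<sigma>_def at_within_open[OF _ open_ball] centre_in_ball box_real)
    next
      fix v
      let ?I = "\<lambda>c b x. integral {0..1} (\<lambda>s. c s * ?D\<psi> (\<sigma> x s) b)"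
      have cD\<psi>: "continuous_on V (\<lambda>y. ?D\<psi> y b)" for b using Ck_SucD(2)[OF C\<psi>, of 0] by auto
      have c1: "continuous_on {0..1} (\<lambda>s. c s * (1 - s))" "continuous_on {0..1} (\<lambda>s. c s * s)"
        using Suc.prems(2) by (intro continuous_intros; simp)+
      \<comment> \<open>The derivative is split into partial derivatives of \<psi> with the weights
        \<open>c s * (1 - s)\<close> and \<open>c s * s\<close>; the coefficients not depending on
        \<open>s\<close> leave the integral.\<close>
      have "?D x v = (\<Sum>b\<in>Basis. (D_at \<alpha> x v \<bullet> b) * ?I (\<lambda>s. c s * (1 - s)) b x
          + (D_at \<beta> x v \<bullet> b) * ?I (\<lambda>s. c s * s) b x)" if "x \<in> U" for x
      proof -
        have "?D x v = integral {0..1} (\<lambda>s. \<Sum>b\<in>Basis. (D_at \<alpha> x v \<bullet> b) * ((c s * (1 - s)) * ?D\<psi> (\<sigma> x s) b)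
          + (D_at \<beta> x v \<bullet> b) * ((c s * s) * ?D\<psi> (\<sigma> x s) b))"
        proof (rule integral_cong)
          fix s :: real assume "s \<in> {0..1}"
          note e = exp[OF that this, of "?D\<sigma> x s v"]
          show "c s * ?D\<psi> (\<sigma> x s) (?D\<sigma> x s v) = (\<Sum>b\<in>Basis. (D_at \<alpha> x v \<bullet> b) * ((c s * (1 - s)) * ?D\<psi> (\<sigma> x s) b)
          + (D_at \<beta> x v \<bullet> b) * ((c s * s) * ?D\<psi> (\<sigma> x s) b))"
            unfolding e by (simp add: sum_distrib_left inner_add_left algebra_simps)
        qed
        also have "\<dots> = (\<Sum>b\<in>Basis. (D_at \<alpha> x v \<bullet> b) * ?I (\<lambda>s. c s * (1 - s)) b x
          + (D_at \<beta> x v \<bullet> b) * ?I (\<lambda>s. c s * s) b x)"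
                    by (simp only: integral_sum[OF finite_Basis] integral_add integral_mult_right
              integrable_add integrable_on_mult_right int[OF that c1(1) cD\<psi>] int[OF that c1(2) cD\<psi>])
        finally show ?thesis .
      qed
      note eq = this
      have "Ck_on k U (\<lambda>x. \<Sum>b\<in>Basis. (D_at \<alpha> x v \<bullet> b) * ?I (\<lambda>s. c s * (1 - s)) b x
          + (D_at \<beta> x v \<bullet> b) * ?I (\<lambda>s. c s * s) b x)"
        using Suc.IH[OF s\<psi> c1(1)] Suc.IH[OF s\<psi> c1(2)]
        by (intro Ck_sum Ck_add Ck_mult Ck_bounded_linear_compose[OF bounded_linear_inner_left]
            Ck_SucD(2)[OF C\<alpha>] Ck_SucD(2)[OF C\<beta>] \<open>open U\<close>) (auto simp: \<sigma>_def)
      then show "Ck_on k U (\<lambda>x. ?D x v)"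
        by (subst Ck_on_cong[OF \<open>open U\<close> eq])
    qed
  qed
qed

section \<open>Hadamard's lemma and division by a function with nonzero differential\<close>

lemma segment_integral:
  fixes \<psi> :: "'e::real_normed_vector \<Rightarrow> real"
  assumes "smooth_on V \<psi>" and seg: "\<And>s. 0 \<le> s \<Longrightarrow> s \<le> 1 \<Longrightarrow> (1 - s) *\<^sub>R a + s *\<^sub>R b \<in> V"
  shows "integral {0..1} (\<lambda>s. D_at \<psi> ((1 - s) *\<^sub>R a + s *\<^sub>R b) (b - a)) = \<psi> b - \<psi> a"
proof -
  have C: "Ck_on (Suc 0) V \<psi>" using assms(1) by (auto simp: smooth_on_def)
  have "((\<lambda>s. D_at \<psi> ((1 - s) *\<^sub>R a + s *\<^sub>R b) (b - a)) has_integral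
     (\<psi> ((1 - 1) *\<^sub>R a + 1 *\<^sub>R b) - \<psi> ((1 - 0) *\<^sub>R a + 0 *\<^sub>R b))) {0..1}"
  proof (rule fundamental_theorem_of_calculus)
    fix s :: real assume "s \<in> {0..1}"
    then have d: "(\<psi> has_derivative D_at \<psi> ((1 - s) *\<^sub>R a + s *\<^sub>R b)) (at ((1 - s) *\<^sub>R a + s *\<^sub>R b))"
      using Ck_SucD(1)[OF C] seg by auto
    have "((\<lambda>s. (1 - s) *\<^sub>R a + s *\<^sub>R b) has_derivative (\<lambda>t. t *\<^sub>R (b - a))) (at s within {0..1})"
      by (auto intro!: derivative_eq_intros simp: algebra_simps)
    from has_derivative_compose[OF this d]
    show "((\<lambda>s. \<psi> ((1 - s) *\<^sub>R a + s *\<^sub>R b)) has_vector_derivative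
       D_at \<psi> ((1 - s) *\<^sub>R a + s *\<^sub>R b) (b - a)) (at s within {0..1})"
      by (simp add: has_vector_derivative_def linear_cmul[OF has_derivative_linear[OF d]])
  qed simp
  then show ?thesis by (simp add: integral_unique)
qed

text \<open>Integrate the derivative of \<open>f\<close> along the segment from \<open>p\<close> to
  \<open>x\<close> and expand \<open>x - p\<close> over the basis: the coefficients \<open>h\<close>
  are integrals of partial derivatives, hence smooth. This is what later reduces derivations to
  coordinate vectors.\<close>

lemma smooth_expansion:
  fixes f :: "'e::euclidean_space \<Rightarrow> real"
  assumes "smooth_on (ball p r) f" "r > 0"
  shows "\<exists>h. (\<forall>b\<in>Basis. smooth_on (ball p r) (h b)) \<and>
    (\<forall>x\<in>ball p r. f x = f p + (\<Sum>b\<in>Basis. ((x - p) \<bullet> b) * h b x))"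
proof -
  define h where "h b x = integral {0..1::real} (\<lambda>s. 1 * D_at f ((1 - s) *\<^sub>R p + s *\<^sub>R x) b)" for b x
  have C: "Ck_on k (ball p r) f" for k using assms(1) by (auto simp: smooth_on_def)
  have sd: "smooth_on (ball p r) (\<lambda>x. D_at f x b)" for b
    unfolding smooth_on_def using Ck_SucD(2)[OF C] by blast
  have seg: "(1 - s) *\<^sub>R p + s *\<^sub>R x \<in> ball p r" if "x \<in> ball p r" "0 \<le> s" "s \<le> 1" for x s
    using convexD_alt[OF convex_ball, of p p r x s] that \<open>r > 0\<close> by auto
  have sh: "Ck_on k (ball p r) (h b)" for b k
    unfolding h_def
    by (rule Ck_param_integral[OF open_ball open_ball sd _ _ seg])
       (auto simp: smooth_on_def intro: Ck_const Ck_bounded_linear bounded_linear_ident)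
  moreover have "f x = f p + (\<Sum>b\<in>Basis. ((x - p) \<bullet> b) * h b x)" if "x \<in> ball p r" for x
  proof -
    have cont: "continuous_on {0..1} (\<lambda>s. D_at f ((1 - s) *\<^sub>R p + s *\<^sub>R x) b)" for b
    proof (rule continuous_on_compose2[of "ball p r" "\<lambda>y. D_at f y b"])
      show "continuous_on (ball p r) (\<lambda>y. D_at f y b)" using Ck_SucD(2)[OF C, of 0] by auto
    qed (use seg that in \<open>auto intro!: continuous_intros\<close>)
    have lin: "D_at f y w = (\<Sum>b\<in>Basis. (w \<bullet> b) * D_at f y b)" if "y \<in> ball p r" for y w
    proof -
      have "linear (D_at f y)" using Ck_SucD(1)[OF C that] by (rule has_derivative_linear)
      from linear_sum[OF this, of "\<lambda>b. (w \<bullet> b) *\<^sub>R b" Basis] linear_cmul[OF this]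
      show ?thesis by (simp add: euclidean_representation)
    qed
    have "f x - f p = integral {0..1} (\<lambda>s. D_at f ((1 - s) *\<^sub>R p + s *\<^sub>R x) (x - p))"
      using segment_integral[OF assms(1) seg[OF that]] by simp
    also have "\<dots> = integral {0..1} (\<lambda>s. \<Sum>b\<in>Basis. ((x - p) \<bullet> b) * D_at f ((1 - s) *\<^sub>R p + s *\<^sub>R x) b)"
      by (rule integral_cong) (rule lin, use seg that in auto)
    also have "\<dots> = (\<Sum>b\<in>Basis. ((x - p) \<bullet> b) * h b x)"
      unfolding h_def using integrable_continuous_interval[OF cont]
      by (subst integral_sum) (auto intro!: integrable_on_mult_right)
    finally show ?thesis by simp
  qed
  ultimately show ?thesis unfolding smooth_on_def by blast
qed

text \<open>The map replacing the coordinate \<open>x \<bullet> b\<close> by \<open>\<delta>\<close> straightens the zero set to a hyperplane;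
  its local inverse is smooth, since its derivative is an explicit rational expression in the first
  derivatives of \<open>\<delta>\<close>. The quotient is then given by the fundamental theorem of calculus along the
  segments orthogonal to the hyperplane.\<close>

lemma smooth_division:
  fixes \<delta> :: "'e::euclidean_space \<Rightarrow> real"
  assumes "open V" "p \<in> V" "smooth_on V \<delta>" "\<delta> p = 0" "D_at \<delta> p \<noteq> (\<lambda>v. 0)"
  obtains V' where "open V'" "p \<in> V'" "V' \<subseteq> V"
    "\<And>f. smooth_on V' f \<Longrightarrow> (\<And>x. x \<in> V' \<Longrightarrow> \<delta> x = 0 \<Longrightarrow> f x = 0) \<Longrightarrow>
       \<exists>h. smooth_on V' h \<and> (\<forall>x\<in>V'. f x = \<delta> x * h x)"
proof -
  define D where "D x = D_at \<delta> x" for x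
  have C: "Ck_on k V \<delta>" for k using assms(3) by (auto simp: smooth_on_def)
  have CD: "Ck_on k V (\<lambda>x. D x v)" for k v unfolding D_def by (rule Ck_SucD(2)[OF C])
  have dd: "(\<delta> has_derivative D x) (at x)" if "x \<in> V" for x
    unfolding D_def using Ck_SucD(1)[OF C that] .
  have linD: "linear (D x)" if "x \<in> V" for x using dd[OF that] by (rule has_derivative_linear)
  obtain b where b: "b \<in> Basis" "D p b \<noteq> 0"
  proof (rule ccontr)
    assume "\<not> thesis"
    then have "\<And>b. b \<in> Basis \<Longrightarrow> D p b = 0" using that by blast
    then have "D p = (\<lambda>v. 0)"
      using linear_eq_stdbasis[OF linD[OF assms(2)], of "\<lambda>v. 0"] by (auto simp: linear_iff)
    then show False using assms(5) by (simp add: D_def)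
  qed
  have bb: "b \<bullet> b = 1" using b(1) by simp
  define V0 where "V0 = V \<inter> (\<lambda>x. D x b) -` (- {0})"
  have cDb: "continuous_on V (\<lambda>x. D x b)" using CD[of 0 b] by simp
  have V0: "open V0" "V0 \<subseteq> V" "p \<in> V0"
    unfolding V0_def using continuous_open_preimage[OF cDb \<open>open V\<close>, of "- {0}"] assms(2) b(2) by auto
  have nz: "D x b \<noteq> 0" if "x \<in> V0" for x using that by (auto simp: V0_def)
  define \<Psi> where "\<Psi> x = x + (\<delta> x - x \<bullet> b) *\<^sub>R b" for x
  define E where "E x v = v + (D x v - v \<bullet> b) *\<^sub>R b" for x v
  \<comment> \<open>Solving \<open>E x v = u\<close>: the \<open>b\<close>-coordinate of
    \<open>u\<close> is \<open>D x v\<close>, and \<open>v\<close> differs from \<open>u\<close> by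
    a multiple of \<open>b\<close>; applying \<open>D x\<close> and dividing by \<open>D x b\<close>
    determines the factor.\<close>
  define E' where "E' x u = u + ((u \<bullet> b - D x u) * inverse (D x b)) *\<^sub>R b" for x u
  have \<Psi>b: "\<Psi> x \<bullet> b = \<delta> x" for x by (simp add: \<Psi>_def inner_add_left bb)
  have d\<Psi>: "(\<Psi> has_derivative E x) (at x)" if "x \<in> V" for x
    unfolding \<Psi>_def[abs_def] E_def[abs_def] by (auto intro!: derivative_eq_intros dd[OF that])
  have bl: "blinfun_apply (Blinfun (E x)) = E x" if "x \<in> V" for x
    by (rule bounded_linear_Blinfun_apply) (rule has_derivative_bounded_linear[OF d\<Psi>[OF that]])
  have EE': "E x (E' x u) = u" "E' x (E x v) = v" if "x \<in> V0" for x u v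
  proof -
    have "x \<in> V" using that V0 by auto
    note l = linear_add[OF linD[OF this]] linear_diff[OF linD[OF this]] linear_cmul[OF linD[OF this]]
    show "E x (E' x u) = u" "E' x (E x v) = v"
      using nz[OF that] by (simp_all add: E_def E'_def l inner_add_left inner_diff_left bb field_simps scaleR_left_distrib[symmetric])
  qed
  have blE': "bounded_linear (E' x)" if "x \<in> V0" for x
  proof -
    have "bounded_linear (D x)" using dd V0 that by (auto intro: has_derivative_bounded_linear)
    then show ?thesis unfolding E'_def[abs_def]
      by (intro bounded_linear_add bounded_linear_ident bounded_linear_scaleR_left[THEN bounded_linear_compose]
          bounded_linear_mult_left[THEN bounded_linear_compose] bounded_linear_sub bounded_linear_inner_left)
  qed
  obtain U1 V1 g g' where U1: "open U1" "U1 \<subseteq> V0" "p \<in> U1" "open V1" "\<Psi> p \<in> V1" "homeomorphism U1 V1 \<Psi> g"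
    and dg: "\<And>y. y \<in> V1 \<Longrightarrow> (g has_derivative (g' y)) (at y)"
    and g': "\<And>y. y \<in> V1 \<Longrightarrow> g' y = inv (blinfun_apply (Blinfun (E (g y))))"
  proof (rule inverse_function_theorem[of V0 \<Psi> "\<lambda>x. Blinfun (E x)" p "Blinfun (E' p)"])
    show "(\<Psi> has_derivative blinfun_apply (Blinfun (E x))) (at x)" if "x \<in> V0" for x
      using d\<Psi> bl that V0 by auto
    show "continuous_on V0 (\<lambda>x. Blinfun (E x))"
    proof (rule continuous_on_blinfun_componentwise)
      fix i :: 'e
      have "continuous_on V0 (\<lambda>x. E x i)"
        unfolding E_def using CD[of 0 i] V0(2) by (auto intro!: continuous_intros intro: continuous_on_subset)
      then show "continuous_on V0 (\<lambda>x. blinfun_apply (Blinfun (E x)) i)"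
        by (rule continuous_on_eq) (use bl V0 in auto)
    qed
    show "Blinfun (E' p) o\<^sub>L Blinfun (E p) = id_blinfun"
      by (rule blinfun_eqI) (use bl[OF assms(2)] bounded_linear_Blinfun_apply[OF blE'[OF V0(3)]] EE'(2)[OF V0(3)] in simp)
  qed (use V0 in auto)
  have g1: "g y \<in> U1" "\<Psi> (g y) = y" if "y \<in> V1" for y
    using U1(6) that by (auto simp: homeomorphism_def)
  have g2: "\<Psi> x \<in> V1" "g (\<Psi> x) = x" if "x \<in> U1" for x
    using U1(6) that by (auto simp: homeomorphism_def)
  have dg': "(g has_derivative E' (g y)) (at y)" if "y \<in> V1" for y
  proof -
    have "g y \<in> V0" using g1 that U1 by auto
    then have "inv (E (g y)) = E' (g y)"
      using EE' by (intro inv_unique_comp) (auto simp: o_def id_def)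
    then show ?thesis using dg[OF that] g'[OF that] bl[of "g y"] \<open>g y \<in> V0\<close> V0 by auto
  qed
  have gV: "g ` V1 \<subseteq> V" using g1 U1 V0 by auto
  \<comment> \<open>Bootstrapping: the derivative of \<open>g\<close> at \<open>y\<close> is
    \<open>E' (g y)\<close>, a rational expression in \<open>D (g y)\<close>, so if \<open>g\<close>
    is of class \<open>k\<close> then so is its derivative.\<close>
  have Cg: "Ck_on k V1 g" for k
  proof (induction k)
    case 0
    show ?case using dg' by (auto intro!: continuous_at_imp_continuous_on has_derivative_continuous)
  next
    case (Suc k)
    have c: "Ck_on k V1 (\<lambda>y. D (g y) v)" for v
      by (rule Ck_compose[OF \<open>open V1\<close> \<open>open V\<close> gV CD Suc])
    show ?case
    proof (rule Ck_SucI[OF \<open>open V1\<close> dg'])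
      fix v
      have "Ck_on k V1 (\<lambda>y. v + (((v \<bullet> b) + (- 1) * D (g y) v) * inverse (D (g y) b)) *\<^sub>R b)"
        using nz g1 U1(2) by (intro Ck_add Ck_scaleR Ck_mult Ck_inverse Ck_const c U1(4)) auto
      then show "Ck_on k V1 (\<lambda>y. E' (g y) v)" by (simp add: E'_def)
    qed
  qed
  have C\<Psi>: "Ck_on k V \<Psi>" for k
  proof -
    have "Ck_on k V (\<lambda>x. x + (\<delta> x + (- 1) * (x \<bullet> b)) *\<^sub>R b)"
      by (intro Ck_add Ck_scaleR Ck_mult Ck_const C Ck_bounded_linear bounded_linear_ident bounded_linear_inner_left \<open>open V\<close>)
    then show ?thesis by (simp add: \<Psi>_def[abs_def])
  qed
  obtain r where r: "r > 0" "ball (\<Psi> p) r \<subseteq> V1" using U1(4,5) openE by blast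
  define B where "B = ball (\<Psi> p) r"
  define V' where "V' = U1 \<inter> \<Psi> -` B"
  have "continuous_on U1 \<Psi>" using U1(6) by (auto simp: homeomorphism_def)
  then have V': "open V'" "p \<in> V'" "V' \<subseteq> V"
    unfolding V'_def B_def using continuous_open_preimage[OF _ U1(1) open_ball] U1 V0 r(1) by auto
  have gB: "g ` B \<subseteq> V'" using g1 r(2) by (auto simp: V'_def B_def)
  have "\<exists>h. smooth_on V' h \<and> (\<forall>x\<in>V'. f x = \<delta> x * h x)"
    if f: "smooth_on V' f" and f0: "\<And>x. x \<in> V' \<Longrightarrow> \<delta> x = 0 \<Longrightarrow> f x = 0" for f
  proof -
    define F where "F y = f (g y)" for y
    have CF: "Ck_on k B F" for k
      unfolding F_def
      by (rule Ck_compose[OF _ V'(1) gB]) (use f r(2) Cg in \<open>auto simp: B_def smooth_on_def intro: Ck_on_subset\<close>)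
    \<comment> \<open>The orthogonal projection onto the hyperplane to which \<Psi> maps the zeros
      of \<delta>. As \<open>\<Psi> p\<close> lies in it, the projection does not increase the
      distance to \<open>\<Psi> p\<close>, and the segments from \<open>\<alpha> y\<close> to
      \<open>y\<close> stay in \<open>B\<close>.\<close>
    define \<alpha> where "\<alpha> y = y - (y \<bullet> b) *\<^sub>R b" for y
    define H where "H y = integral {0..1::real} (\<lambda>s. 1 * D_at F ((1 - s) *\<^sub>R \<alpha> y + s *\<^sub>R y) b)" for y
    have \<alpha>B: "\<alpha> y \<in> B" if "y \<in> B" for y
    proof -
      have "\<Psi> p \<bullet> b = 0" using \<Psi>b assms(4) by simp
      then have e: "\<alpha> y - \<Psi> p = (y - \<Psi> p) - ((y - \<Psi> p) \<bullet> b) *\<^sub>R b"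
        by (simp add: \<alpha>_def algebra_simps)
      have "(norm (\<alpha> y - \<Psi> p))\<^sup>2 \<le> (norm (y - \<Psi> p))\<^sup>2"
        unfolding e power2_norm_eq_inner by (simp add: inner_diff_left inner_diff_right bb inner_commute)
      then have "norm (\<alpha> y - \<Psi> p) \<le> norm (y - \<Psi> p)" by (rule power2_le_imp_le) simp
      then show ?thesis using that by (simp add: B_def dist_norm norm_minus_commute)
    qed
    have seg: "(1 - s) *\<^sub>R \<alpha> y + s *\<^sub>R y \<in> B" if "y \<in> B" "0 \<le> s" "s \<le> 1" for y s
      using convexD_alt[OF convex_ball, of "\<alpha> y" "\<Psi> p" r y s] that \<alpha>B[OF that(1)] by (auto simp: B_def)
    have oB: "open B" by (simp add: B_def)
    have sB: "smooth_on B (\<lambda>y. D_at F y b)"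
      unfolding smooth_on_def using Ck_SucD(2)[OF CF] by blast
    have "smooth_on B \<alpha>"
    proof -
      have "Ck_on k B (\<lambda>y. y + ((- 1) * (y \<bullet> b)) *\<^sub>R b)" for k
        by (intro Ck_add Ck_scaleR Ck_mult Ck_const Ck_bounded_linear bounded_linear_ident bounded_linear_inner_left oB)
      then show ?thesis by (simp add: \<alpha>_def[abs_def] smooth_on_def)
    qed
    then have CH: "Ck_on k B H" for k
      unfolding H_def
      by (rule Ck_param_integral[OF oB oB sB _ _ seg])
         (auto simp: smooth_on_def oB intro: Ck_const Ck_bounded_linear bounded_linear_ident)
    \<comment> \<open>\<open>F\<close> vanishes at \<open>\<alpha> y\<close> because \<delta> does
      at \<open>g (\<alpha> y)\<close>; the segment from there to \<open>y\<close> has direction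
      \<open>(y \<bullet> b) *\<^sub>R b\<close>, so the factor \<open>y \<bullet> b\<close> comes
      out of the integral.\<close>
    have "F y = (y \<bullet> b) * H y" if "y \<in> B" for y
    proof -
      have "\<delta> (g (\<alpha> y)) = 0"
        using \<Psi>b[of "g (\<alpha> y)"] g1(2)[of "\<alpha> y"] \<alpha>B[OF that] r(2) by (auto simp: \<alpha>_def B_def inner_diff_left bb)
      then have "F (\<alpha> y) = 0" using f0 gB \<alpha>B[OF that] by (auto simp: F_def)
      moreover have "integral {0..1} (\<lambda>s. D_at F ((1 - s) *\<^sub>R \<alpha> y + s *\<^sub>R y) (y - \<alpha> y)) = F y - F (\<alpha> y)"
        by (rule segment_integral[of B]) (use CF seg[OF that] in \<open>auto simp: smooth_on_def\<close>)
      moreover have "integral {0..1} (\<lambda>s. D_at F ((1 - s) *\<^sub>R \<alpha> y + s *\<^sub>R y) (y - \<alpha> y))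
        = integral {0..1} (\<lambda>s. (y \<bullet> b) * D_at F ((1 - s) *\<^sub>R \<alpha> y + s *\<^sub>R y) b)"
      proof (rule integral_cong)
        fix s :: real assume "s \<in> {0..1}"
        then have "linear (D_at F ((1 - s) *\<^sub>R \<alpha> y + s *\<^sub>R y))"
          using Ck_SucD(1)[OF CF] seg[OF that] by (auto intro: has_derivative_linear)
        from linear_cmul[OF this, of "y \<bullet> b" b]
        show "D_at F ((1 - s) *\<^sub>R \<alpha> y + s *\<^sub>R y) (y - \<alpha> y) =
          (y \<bullet> b) * D_at F ((1 - s) *\<^sub>R \<alpha> y + s *\<^sub>R y) b"
          by (simp add: \<alpha>_def)
      qed
      ultimately show ?thesis by (simp add: H_def)
    qed
    then have "F (\<Psi> x) = (\<Psi> x \<bullet> b) * H (\<Psi> x)" if "x \<in> V'" for x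
      using that by (auto simp: V'_def)
    from this[unfolded F_def \<Psi>b] have "f x = \<delta> x * H (\<Psi> x)" if "x \<in> V'" for x
      using that g2(2)[of x] by (metis IntD1 V'_def)
    moreover have "Ck_on k V' (\<lambda>x. H (\<Psi> x))" for k
      by (rule Ck_compose[OF V'(1) oB _ CH]) (use C\<Psi> V' in \<open>auto simp: V'_def intro: Ck_on_subset\<close>)
    ultimately show ?thesis unfolding smooth_on_def by blast
  qed
  with V' that show ?thesis by blast
qed

section \<open>Manifolds\<close>

locale manifold =
  fixes At :: "('a::t2_space, 'n::finite) atlas"
  assumes atlas: "smooth_atlas At"
begin

abbreviation "smooth \<equiv> smooth_fun At"
abbreviation "vf \<equiv> smooth_vf At"
abbreviation "bracket \<equiv> lie_bracket At"
abbreviation "smooth_at \<equiv> smooth_near At"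
abbreviation "TM \<equiv> tangent At"
abbreviation "along \<equiv> vf_along At"
abbreviation "extends \<equiv> vf_extends At"

section \<open>Charts and smooth functions\<close>

lemma ex_chart: obtains D \<phi> where "(D, \<phi>) \<in> At" "p \<in> D"
  using atlas unfolding smooth_atlas_def by (metis UNIV_I UN_iff prod.collapse)

lemma chart:
  assumes "(D, \<phi>) \<in> At"
  shows "coordinate_system At (D, \<phi>)" "open D" "open (\<phi> ` D)" "continuous_on D \<phi>"
    "continuous_on (\<phi> ` D) (inv_into D \<phi>)" "inj_on \<phi> D"
  using assms atlas inj_on_inverseI[of D "inv_into D \<phi>" \<phi>]
  unfolding smooth_atlas_def coordinate_system_def is_chart_def homeomorphism_def by force+

lemma chart_open_image:
  assumes "(D, \<phi>) \<in> At" "open U" shows "open (\<phi> ` (D \<inter> U))"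
proof -
  have "\<phi> ` (D \<inter> U) = \<phi> ` D \<inter> inv_into D \<phi> -` U"
    using inv_into_f_f[OF chart(6)[OF assms(1)]] by auto
  then show ?thesis
    using continuous_open_preimage[OF chart(5,3)[OF assms(1)] assms(2)] by simp
qed

lemma chart_open_preimage:
  assumes "(D, \<phi>) \<in> At" "open V" "V \<subseteq> \<phi> ` D"
  shows "open (inv_into D \<phi> ` V)" "inv_into D \<phi> ` V \<subseteq> D" "\<phi> ` inv_into D \<phi> ` V = V"
proof -
  have "inv_into D \<phi> ` V = D \<inter> \<phi> -` V"
  proof (intro equalityI subsetI)
    fix q assume "q \<in> D \<inter> \<phi> -` V"
    then show "q \<in> inv_into D \<phi> ` V"
      by (intro image_eqI[of _ _ "\<phi> q"]) (simp_all add: inv_into_f_f[OF chart(6)[OF assms(1)]])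
  qed (use assms(3) in \<open>auto simp: f_inv_into_f inv_into_into subset_iff\<close>)
  then show "open (inv_into D \<phi> ` V)" "inv_into D \<phi> ` V \<subseteq> D"
    using continuous_open_preimage[OF chart(4,2)[OF assms(1)] assms(2)] by auto
  show "\<phi> ` inv_into D \<phi> ` V = V" using assms(3) by (simp add: image_inv_into_cancel)
qed

lemma transition_smooth:
  assumes "(D, \<phi>) \<in> At" "(E, \<eta>) \<in> At"
  shows "smooth_on (\<eta> ` (E \<inter> D)) (\<phi> \<circ> inv_into E \<eta>)"
proof -
  have "smooth_transition (E, \<eta>) (D, \<phi>)"
    using chart(1)[OF assms(2)] assms(1) by (simp add: coordinate_system_def)
  then show ?thesis by (simp add: smooth_transition_def)
qed

text \<open>In any other chart \<open>f\<close> is its expression in the given chart composed with a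
  smooth transition map.\<close>

lemma smooth_chartI:
  assumes "(D, \<phi>) \<in> At" "open U" "U \<subseteq> D" "smooth_on (\<phi> ` U) (f \<circ> inv_into D \<phi>)"
  shows "smooth U f"
  unfolding smooth_fun_def smooth_on_def
proof (clarify)
  fix E \<eta> k assume E: "(E, \<eta>) \<in> At"
  have "Ck_on k (\<eta> ` (E \<inter> U)) (\<lambda>y. (f \<circ> inv_into D \<phi>) ((\<phi> \<circ> inv_into E \<eta>) y))"
  proof (rule Ck_compose[of _ "\<phi> ` U"])
    show "open (\<eta> ` (E \<inter> U))" by (rule chart_open_image[OF E assms(2)])
    show "open (\<phi> ` U)" using chart_open_image[OF assms(1,2)] assms(3) by (simp add: inf.absorb2)
    show "(\<phi> \<circ> inv_into E \<eta>) ` \<eta> ` (E \<inter> U) \<subseteq> \<phi> ` U"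
      using inv_into_f_f[OF chart(6)[OF E]] by auto
    show "Ck_on k (\<phi> ` U) (f \<circ> inv_into D \<phi>)" using assms(4) by (simp add: smooth_on_def)
    show "Ck_on k (\<eta> ` (E \<inter> U)) (\<phi> \<circ> inv_into E \<eta>)"
      by (rule Ck_on_subset[of k "\<eta> ` (E \<inter> D)"])
         (use transition_smooth[OF assms(1) E] assms(3) in \<open>auto simp: smooth_on_def\<close>)
  qed
  then show "Ck_on k (\<eta> ` (E \<inter> U)) (f \<circ> inv_into E \<eta>)"
  proof (rule Ck_on_cong[OF chart_open_image[OF E assms(2)], THEN iffD1, rotated])
    fix y assume "y \<in> \<eta> ` (E \<inter> U)"
    then show "(f \<circ> inv_into D \<phi>) ((\<phi> \<circ> inv_into E \<eta>) y) = (f \<circ> inv_into E \<eta>) y"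
      using inv_into_f_f[OF chart(6)[OF E]] inv_into_f_f[OF chart(6)[OF assms(1)]] assms(3) by auto
  qed
qed

lemma smooth_chartD:
  assumes "(D, \<phi>) \<in> At" "smooth U f" "V \<subseteq> D" "V \<subseteq> U"
  shows "smooth_on (\<phi> ` V) (f \<circ> inv_into D \<phi>)"
proof -
  have "smooth_on (\<phi> ` (D \<inter> U)) (f \<circ> inv_into D \<phi>)"
    using assms(1,2) unfolding smooth_fun_def by blast
  then show ?thesis using assms(3,4) unfolding smooth_on_def
    by (meson Ck_on_subset image_mono le_inf_iff)
qed

lemma smooth_subset:
  assumes "smooth U f" "V \<subseteq> U" shows "smooth V f"
  unfolding smooth_fun_def
proof clarify
  fix D \<phi> assume "(D, \<phi>) \<in> At"
  from smooth_chartD[OF this assms(1)] assms(2)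
  show "smooth_on (\<phi> ` (D \<inter> V)) (f \<circ> inv_into D \<phi>)" by blast
qed

lemma smooth_cong:
  assumes "open U" "\<And>q. q \<in> U \<Longrightarrow> f q = h q" "smooth U f"
  shows "smooth U h"
  unfolding smooth_fun_def smooth_on_def
proof clarify
  fix D \<phi> k assume D: "(D, \<phi>) \<in> At"
  have "Ck_on k (\<phi> ` (D \<inter> U)) (f \<circ> inv_into D \<phi>)"
    using assms(3) D unfolding smooth_fun_def smooth_on_def by blast
  then show "Ck_on k (\<phi> ` (D \<inter> U)) (h \<circ> inv_into D \<phi>)"
    by (rule Ck_on_cong[OF chart_open_image[OF D assms(1)], THEN iffD1, rotated])
       (use assms(2) inv_into_f_f[OF chart(6)[OF D]] in auto)
qed

lemma smooth_near_fun: "open U \<Longrightarrow> p \<in> U \<Longrightarrow> smooth U f \<Longrightarrow> smooth_at p f"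
  unfolding smooth_near_def by blast

lemma smooth_local:
  assumes "\<And>p. p \<in> U \<Longrightarrow> smooth_at p f"
  shows "smooth U f"
  unfolding smooth_fun_def smooth_on_def
proof clarify
  fix D \<phi> k assume D: "(D, \<phi>) \<in> At"
  show "Ck_on k (\<phi> ` (D \<inter> U)) (f \<circ> inv_into D \<phi>)"
  proof (rule Ck_on_UN)
    fix y assume "y \<in> \<phi> ` (D \<inter> U)"
    then obtain p where p: "p \<in> D" "p \<in> U" "y = \<phi> p" by auto
    then obtain V where V: "open V" "p \<in> V" "smooth V f"
      using assms unfolding smooth_near_def by blast
    then have "Ck_on k (\<phi> ` (D \<inter> V)) (f \<circ> inv_into D \<phi>)"
      using D unfolding smooth_fun_def smooth_on_def by blast
    then show "\<exists>T. open T \<and> y \<in> T \<and> Ck_on k T (f \<circ> inv_into D \<phi>)"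
      using chart_open_image[OF D V(1)] p V(2) by blast
  qed
qed

lemma smooth_const: "smooth U (\<lambda>q. c)"
  by (auto simp: smooth_fun_def smooth_on_def o_def Ck_const)

lemma smooth_add:
  assumes "open U" "smooth U f" "smooth U h" shows "smooth U (\<lambda>q. f q + h q)"
  unfolding smooth_fun_def smooth_on_def o_def
proof clarify
  fix D \<phi> k assume D: "(D, \<phi>) \<in> At"
  show "Ck_on k (\<phi> ` (D \<inter> U)) (\<lambda>x. f (inv_into D \<phi> x) + h (inv_into D \<phi> x))"
    using assms(2,3) D
    by (intro Ck_add chart_open_image[OF D assms(1)]) (auto simp: smooth_fun_def smooth_on_def o_def)
qed

lemma smooth_mult:
  assumes "open U" "smooth U f" "smooth U h" shows "smooth U (\<lambda>q. f q * h q)"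
  unfolding smooth_fun_def smooth_on_def o_def
proof clarify
  fix D \<phi> k assume D: "(D, \<phi>) \<in> At"
  show "Ck_on k (\<phi> ` (D \<inter> U)) (\<lambda>x. f (inv_into D \<phi> x) * h (inv_into D \<phi> x))"
    using assms(2,3) D
    by (intro Ck_mult chart_open_image[OF D assms(1)]) (auto simp: smooth_fun_def smooth_on_def o_def)
qed

lemma smooth_inverse:
  assumes "open U" "smooth U f" "\<And>q. q \<in> U \<Longrightarrow> f q \<noteq> 0"
  shows "smooth U (\<lambda>q. inverse (f q))"
  unfolding smooth_fun_def smooth_on_def o_def
proof clarify
  fix D \<phi> k assume D: "(D, \<phi>) \<in> At"
  show "Ck_on k (\<phi> ` (D \<inter> U)) (\<lambda>x. inverse (f (inv_into D \<phi> x)))"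
    using assms(2,3) D inv_into_f_f[OF chart(6)[OF D]]
    by (intro Ck_inverse chart_open_image[OF D assms(1)]) (auto simp: smooth_fun_def smooth_on_def o_def)
qed

lemma smooth_minus:
  assumes "open U" "smooth U f" shows "smooth U (\<lambda>q. - f q)"
  using smooth_mult[OF assms(1) smooth_const[of U "-1"] assms(2)] by simp

lemma smooth_diff:
  assumes "open U" "smooth U f" "smooth U h" shows "smooth U (\<lambda>q. f q - h q)"
  using smooth_add[OF assms(1,2) smooth_minus[OF assms(1,3)]] by simp

lemma smooth_sum:
  assumes "open U" "\<And>i. i \<in> I \<Longrightarrow> smooth U (f i)" shows "smooth U (\<lambda>q. \<Sum>i\<in>I. f i q)"
  using assms(2) by (induction I rule: infinite_finite_induct) (auto intro: smooth_const smooth_add assms(1))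

lemma smooth_prod:
  assumes "open U" "\<And>i. i \<in> I \<Longrightarrow> smooth U (f i)" shows "smooth U (\<lambda>q. \<Prod>i\<in>I. f i q)"
  using assms(2) by (induction I rule: infinite_finite_induct) (auto intro: smooth_const smooth_mult assms(1))

lemma smooth_det:
  fixes M :: "'a \<Rightarrow> real^'m^'m"
  assumes "open U" "\<And>i j. smooth U (\<lambda>q. M q $ i $ j)" shows "smooth U (\<lambda>q. det (M q))"
  unfolding det_def
  by (intro smooth_sum smooth_mult smooth_const smooth_prod assms)

lemma smooth_continuous:
  assumes "open U" "smooth U f" shows "continuous_on U f"
unfolding continuous_on_eq_continuous_at[OF assms(1)]
proof
  fix p assume "p \<in> U"
  obtain D \<phi> where D: "(D, \<phi>) \<in> At" "p \<in> D" by (rule ex_chart)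
  have "smooth_on (\<phi> ` (D \<inter> U)) (f \<circ> inv_into D \<phi>)"
    by (rule smooth_chartD[OF D(1) assms(2)]) auto
  then have "continuous_on (\<phi> ` (D \<inter> U)) (f \<circ> inv_into D \<phi>)"
    by (auto simp: smooth_on_def dest: spec[of _ 0])
  moreover have "continuous_on (D \<inter> U) \<phi>" using chart(4)[OF D(1)] by (rule continuous_on_subset) auto
  ultimately have "continuous_on (D \<inter> U) (\<lambda>q. (f \<circ> inv_into D \<phi>) (\<phi> q))"
    by (rule continuous_on_compose2) auto
  then have "continuous_on (D \<inter> U) f"
    by (rule continuous_on_eq) (use inv_into_f_f[OF chart(6)[OF D(1)]] in auto)
  then show "isCont f p"
    using continuous_on_eq_continuous_at[OF open_Int[OF chart(2)[OF D(1)] assms(1)]] D(2) \<open>p \<in> U\<close> by blast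
qed

lemma smooth_near_add: "smooth_at p f \<Longrightarrow> smooth_at p h \<Longrightarrow> smooth_at p (\<lambda>q. f q + h q)"
  and smooth_near_mult: "smooth_at p f \<Longrightarrow> smooth_at p h \<Longrightarrow> smooth_at p (\<lambda>q. f q * h q)"
proof -
  assume "smooth_at p f" "smooth_at p h"
  then obtain U V where "open U" "p \<in> U" "smooth U f" "open V" "p \<in> V" "smooth V h"
    unfolding smooth_near_def by blast
  then have *: "open (U \<inter> V)" "p \<in> U \<inter> V" "smooth (U \<inter> V) f" "smooth (U \<inter> V) h"
    by (auto intro: smooth_subset)
  from smooth_add[OF *(1,3,4)] smooth_mult[OF *(1,3,4)] *(1,2)
  show "smooth_at p (\<lambda>q. f q + h q)" "smooth_at p (\<lambda>q. f q * h q)"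
    by (auto intro: smooth_near_fun)
qed

lemma smooth_near_const: "smooth_at p (\<lambda>q. c)"
  using smooth_near_fun[OF open_UNIV _ smooth_const] by blast

lemma smooth_near_cong:
  assumes "open V" "p \<in> V" "\<And>q. q \<in> V \<Longrightarrow> f q = h q" "smooth_at p f" shows "smooth_at p h"
proof -
  obtain U where U: "open U" "p \<in> U" "smooth U f" using assms(4) unfolding smooth_near_def by blast
  have "smooth (U \<inter> V) h"
    by (rule smooth_cong[of _ f]) (use U assms in \<open>auto intro: smooth_subset\<close>)
  then show ?thesis using U assms by (auto intro!: smooth_near_fun[of "U \<inter> V"])
qed

subsection \<open>Tangent vectors\<close>

lemma tangent_not_smooth: "v \<in> TM p \<Longrightarrow> \<not> smooth_at p f \<Longrightarrow> v f = 0"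
  by (simp add: tangent_def)

lemma tangent_linear: "v \<in> TM p \<Longrightarrow> smooth_at p f \<Longrightarrow> smooth_at p h \<Longrightarrow>
   v (\<lambda>q. a * f q + b * h q) = a * v f + b * v h"
  by (simp add: tangent_def)

lemma tangent_mult: "v \<in> TM p \<Longrightarrow> smooth_at p f \<Longrightarrow> smooth_at p h \<Longrightarrow>
   v (\<lambda>q. f q * h q) = f p * v h + h p * v f"
  by (simp add: tangent_def)

lemma tangent_add: "v \<in> TM p \<Longrightarrow> smooth_at p f \<Longrightarrow> smooth_at p h \<Longrightarrow>
   v (\<lambda>q. f q + h q) = v f + v h"
  using tangent_linear[of v p f h 1 1] by simp

lemma tangent_diff: "v \<in> TM p \<Longrightarrow> smooth_at p f \<Longrightarrow> smooth_at p h \<Longrightarrow>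
   v (\<lambda>q. f q - h q) = v f - v h"
  using tangent_linear[of v p f h 1 "-1"] by simp

lemma tangent_const: assumes "v \<in> TM p" shows "v (\<lambda>q. c) = 0"
proof -
  have "v (\<lambda>q. 1) = 0"
    using tangent_mult[OF assms smooth_near_const smooth_near_const, of 1 1] by simp
  then show ?thesis
    using tangent_linear[OF assms smooth_near_const smooth_near_const, of c 1 0 1] by simp
qed

lemma smooth_near_sum: "(\<And>i. i \<in> I \<Longrightarrow> smooth_at p (f i)) \<Longrightarrow> smooth_at p (\<lambda>q. \<Sum>i\<in>I. f i q)"
  by (induction I rule: infinite_finite_induct) (auto intro: smooth_near_const smooth_near_add)

lemma tangent_sum_fun:
  assumes "v \<in> TM p" "\<And>i. i \<in> I \<Longrightarrow> smooth_at p (f i)"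
  shows "v (\<lambda>q. \<Sum>i\<in>I. f i q) = (\<Sum>i\<in>I. v (f i))"
  using assms(2)
proof (induction I rule: infinite_finite_induct)
  case (insert i I)
  then show ?case by (simp add: tangent_add[OF assms(1)] smooth_near_sum)
qed (auto simp: tangent_const[OF assms(1)])

text \<open>A tangent vector only sees germs; no bump functions are needed, because the indicator function of a
  neighbourhood of \<open>p\<close> is smooth near \<open>p\<close>.\<close>

lemma tangent_cong:
  assumes "v \<in> TM p" "open V" "p \<in> V" "\<And>q. q \<in> V \<Longrightarrow> f q = h q"
  shows "v f = v h"
proof (cases "smooth_at p f")
  case True
  then have h: "smooth_at p h" using assms(2-4) smooth_near_cong by blast
  define \<eta> :: "'a \<Rightarrow> real" where "\<eta> q = (if q \<in> V then 1 else 0)" for q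
  have \<eta>: "smooth_at p \<eta>"
    by (rule smooth_near_cong[OF assms(2,3) _ smooth_near_const[of p 1]]) (simp add: \<eta>_def)
  have *: "v (\<lambda>q. k q * \<eta> q) = k p * v \<eta> + v k" if "smooth_at p k" for k
    using tangent_mult[OF assms(1) that \<eta>] assms(3) by (simp add: \<eta>_def)
  have "(\<lambda>q. f q * \<eta> q) = (\<lambda>q. h q * \<eta> q)" using assms(4) by (auto simp: \<eta>_def)
  with *[OF True] *[OF h] show ?thesis using assms(3,4) by simp
next
  case False
  \<comment> \<open>On functions that are not smooth near \<open>p\<close> a tangent vector has the
    default value 0.\<close>
  then have "\<not> smooth_at p h"
    using smooth_near_cong[OF assms(2,3), of h f] assms(4) by metis
  with False show ?thesis using tangent_not_smooth[OF assms(1)] by simp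
qed

lemma tangent_zero [simp]: "tzero \<in> TM p"
  by (simp add: tangent_def)

lemma tangent_comb:
  assumes "v \<in> TM p" "w \<in> TM p"
  shows "(\<lambda>f. a * v f + b * w f) \<in> TM p"
  unfolding tangent_def
proof (intro CollectI conjI allI impI; (elim conjE)?)
  fix f h and c d :: real
  assume "\<not> smooth_at p f"
  then show "a * v f + b * w f = 0" by (simp add: tangent_not_smooth[OF assms(1)] tangent_not_smooth[OF assms(2)])
next
  fix f h and c d :: real
  assume *: "smooth_at p f" "smooth_at p h"
  show "a * v (\<lambda>q. c * f q + d * h q) + b * w (\<lambda>q. c * f q + d * h q) = c * (a * v f + b * w f) + d * (a * v h + b * w h)"
    unfolding tangent_linear[OF assms(1) *] tangent_linear[OF assms(2) *] by (simp add: algebra_simps)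
  show "a * v (\<lambda>q. f q * h q) + b * w (\<lambda>q. f q * h q) = f p * (a * v h + b * w h) + h p * (a * v f + b * w f)"
    unfolding tangent_mult[OF assms(1) *] tangent_mult[OF assms(2) *] by (simp add: algebra_simps)
qed

lemma tangent_sum:
  assumes "\<And>i. i \<in> I \<Longrightarrow> v i \<in> TM p"
  shows "(\<lambda>f. \<Sum>i\<in>I. c i * v i f) \<in> TM p"
  using assms
proof (induction I rule: infinite_finite_induct)
  case (insert i I)
  then show ?case using tangent_comb[of "v i" p "\<lambda>f. \<Sum>i\<in>I. c i * v i f" "c i" 1] by simp
qed auto

lemma linear_form_sum:
  assumes "linear_form At p l" "\<And>i. i \<in> I \<Longrightarrow> v i \<in> TM p"
  shows "l (\<lambda>f. \<Sum>i\<in>I. c i * v i f) = (\<Sum>i\<in>I. c i * l (v i))"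
  using assms(2)
proof (induction I rule: infinite_finite_induct)
  have 0: "l tzero = 0"
    using assms(1)[unfolded linear_form_def, rule_format, OF tangent_zero tangent_zero, of 0 0] by simp
  {
    case (infinite I)
    then show ?case using 0 by simp
  next
    case empty
    then show ?case using 0 by simp
  next
    case (insert i I)
    have "l (\<lambda>f. c i * v i f + 1 * (\<Sum>i\<in>I. c i * v i f)) = c i * l (v i) + 1 * l (\<lambda>f. \<Sum>i\<in>I. c i * v i f)"
      by (rule assms(1)[unfolded linear_form_def, rule_format]) (use insert.prems in \<open>auto intro!: tangent_sum\<close>)
    then show ?case using insert by simp
  }
qed

lemma coord_smooth:
  assumes "(D, \<phi>) \<in> At" shows "smooth D (\<lambda>q. \<phi> q $ i)"
proof (rule smooth_chartI[OF assms chart(2)[OF assms]])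
  show "smooth_on (\<phi> ` D) ((\<lambda>q. \<phi> q $ i) \<circ> inv_into D \<phi>)"
    unfolding smooth_on_def
  proof
    fix k
    have "Ck_on k (\<phi> ` D) (\<lambda>y. y $ i)"
      by (intro Ck_bounded_linear bounded_linear_vec_nth chart(3)[OF assms])
    then show "Ck_on k (\<phi> ` D) ((\<lambda>q. \<phi> q $ i) \<circ> inv_into D \<phi>)"
      by (rule Ck_on_cong[OF chart(3)[OF assms], THEN iffD1, rotated]) (simp add: f_inv_into_f)
  qed
qed simp

lemma chart_derivative:
  assumes "(D, \<phi>) \<in> At" "p \<in> D" "smooth_at p f"
  shows "((f \<circ> inv_into D \<phi>) has_derivative D_at (f \<circ> inv_into D \<phi>) (\<phi> p)) (at (\<phi> p))"
proof -
  obtain U where U: "open U" "p \<in> U" "smooth U f" using assms(3) unfolding smooth_near_def by blast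
  have "Ck_on (Suc 0) (\<phi> ` (D \<inter> U)) (f \<circ> inv_into D \<phi>)"
    using smooth_chartD[OF assms(1) U(3), of "D \<inter> U"] unfolding smooth_on_def by blast
  from Ck_SucD(1)[OF this] show ?thesis using assms(2) U(2) by blast
qed

lemma coord_vec_tangent:
  assumes "(D, \<phi>) \<in> At" "p \<in> D" shows "coord_vec At (D, \<phi>) i p \<in> TM p"
  unfolding tangent_def
proof (intro CollectI conjI allI impI; (elim conjE)?)
  fix f h and a b :: real
  assume *: "smooth_at p f" "smooth_at p h"
  let ?c = "coord_vec At (D, \<phi>) i p" and ?\<psi> = "inv_into D \<phi>"
  note d = chart_derivative[OF assms *(1)] chart_derivative[OF assms *(2)]
  have n: "smooth_at p (\<lambda>q. a * f q + b * h q)" "smooth_at p (\<lambda>q. f q * h q)"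
    by (intro smooth_near_add smooth_near_mult smooth_near_const *)+
  have "((\<lambda>y. a * (f \<circ> ?\<psi>) y + b * (h \<circ> ?\<psi>) y) has_derivative
     (\<lambda>v. a * D_at (f \<circ> ?\<psi>) (\<phi> p) v + b * D_at (h \<circ> ?\<psi>) (\<phi> p) v)) (at (\<phi> p))"
    by (intro has_derivative_add has_derivative_mult_right d)
  from frechet_derivative_at[OF this, symmetric]
  show "?c (\<lambda>q. a * f q + b * h q) = a * ?c f + b * ?c h"
    using n * by (simp add: coord_vec_def o_def)
  have "((\<lambda>y. (f \<circ> ?\<psi>) y * (h \<circ> ?\<psi>) y) has_derivative
     (\<lambda>v. (f \<circ> ?\<psi>) (\<phi> p) * D_at (h \<circ> ?\<psi>) (\<phi> p) v +
        D_at (f \<circ> ?\<psi>) (\<phi> p) v * (h \<circ> ?\<psi>) (\<phi> p))) (at (\<phi> p))"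
    by (intro has_derivative_mult d)
  from frechet_derivative_at[OF this, symmetric]
  show "?c (\<lambda>q. f q * h q) = f p * ?c h + h p * ?c f"
    using n * by (simp add: coord_vec_def o_def inv_into_f_f[OF chart(6)[OF assms(1)] assms(2)])
qed (simp add: coord_vec_def)

lemma coord_vec_coord:
  assumes "(D, \<phi>) \<in> At" "p \<in> D"
  shows "coord_vec At (D, \<phi>) i p (\<lambda>q. \<phi> q $ j) = (if i = j then 1 else 0)"
proof -
  have "((\<lambda>q. \<phi> q $ j) \<circ> inv_into D \<phi> has_derivative (\<lambda>v. v $ j)) (at (\<phi> p))"
    by (rule has_derivative_transform_within_open[of "\<lambda>y. y $ j" _ _ _ "\<phi> ` D"])
       (use assms chart(3)[OF assms(1)] in \<open>auto simp: f_inv_into_f intro!: bounded_linear_imp_has_derivative bounded_linear_vec_nth\<close>)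
  from frechet_derivative_at[OF this, symmetric] show ?thesis
    using smooth_near_fun[OF chart(2)[OF assms(1)] assms(2) coord_smooth[OF assms(1)]]
    by (simp add: coord_vec_def axis_def)
qed

lemma sum_Basis_vec: "(\<Sum>b\<in>Basis. F b) = (\<Sum>i\<in>UNIV. F (axis i (1::real) :: real^'n))"
  unfolding Basis_vec_def
  by (simp add: UNION_singleton_eq_range sum.reindex inj_on_def axis_eq_axis)

text \<open>Hadamard's lemma writes \<open>f\<close> near \<open>p\<close> as \<open>f p\<close>
  plus a sum of terms \<open>(x_i - x_i(p)) H_i\<close>. By the Leibniz rule a tangent vector sends
  this to the sum of its values on the coordinates times \<open>H_i(p)\<close>; applied to the
  coordinate vectors themselves, this identifies \<open>H_i(p)\<close>. On functions that are not
  smooth near \<open>p\<close> both sides are 0 by convention.\<close>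

lemma tangent_expansion:
  assumes "(D, \<phi>) \<in> At" "p \<in> D" "v \<in> TM p"
  shows "v f = (\<Sum>i\<in>UNIV. v (\<lambda>q. \<phi> q $ i) * coord_vec At (D, \<phi>) i p f)"
proof (cases "smooth_at p f")
  case True
  let ?\<psi> = "inv_into D \<phi>"
  obtain U where U: "open U" "p \<in> U" "smooth U f" using True unfolding smooth_near_def by blast
  have "open (\<phi> ` (D \<inter> U))" by (rule chart_open_image[OF assms(1) U(1)])
  then obtain r where r: "r > 0" "ball (\<phi> p) r \<subseteq> \<phi> ` (D \<inter> U)"
    using assms(2) U(2) openE by blast
  have "smooth_on (\<phi> ` (D \<inter> U)) (f \<circ> ?\<psi>)" by (rule smooth_chartD[OF assms(1) U(3)]) auto
  then have sf: "smooth_on (ball (\<phi> p) r) (f \<circ> ?\<psi>)"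
    using r(2) unfolding smooth_on_def by (blast intro: Ck_on_subset)
  from smooth_expansion[OF this r(1)] obtain h where
    h: "\<And>b. b \<in> Basis \<Longrightarrow> smooth_on (ball (\<phi> p) r) (h b)"
    and eq: "\<And>x. x \<in> ball (\<phi> p) r \<Longrightarrow> (f \<circ> ?\<psi>) x = (f \<circ> ?\<psi>) (\<phi> p) + (\<Sum>b\<in>Basis. ((x - \<phi> p) \<bullet> b) * h b x)"
    by blast
  define V where "V = ?\<psi> ` ball (\<phi> p) r"
  have rD: "ball (\<phi> p) r \<subseteq> \<phi> ` D" using r(2) by auto
  note V = chart_open_preimage[OF assms(1) open_ball rD, folded V_def]
  have \<psi>\<phi>: "?\<psi> (\<phi> q) = q" if "q \<in> D" for q using inv_into_f_f[OF chart(6)[OF assms(1)] that] .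
  have pV: "p \<in> V" unfolding V_def using r(1) \<psi>\<phi>[OF assms(2)] by (intro image_eqI[of _ _ "\<phi> p"]) auto
  define H where "H i q = h (axis i 1) (\<phi> q)" for i q
  have H: "smooth_at p (H i)" for i
  proof (rule smooth_near_fun[OF V(1) pV smooth_chartI[OF assms(1) V(1,2)]])
    have "Ck_on k (ball (\<phi> p) r) (H i \<circ> ?\<psi>)" for k
    proof (rule Ck_on_cong[OF open_ball, THEN iffD1])
      show "Ck_on k (ball (\<phi> p) r) (h (axis i 1))" using h[of "axis i 1"] by (auto simp: smooth_on_def)
    qed (use rD in \<open>auto simp: H_def f_inv_into_f subset_iff\<close>)
    then show "smooth_on (\<phi> ` V) (H i \<circ> ?\<psi>)" unfolding V(3) smooth_on_def by blast
  qed
  have x: "smooth_at p (\<lambda>q. \<phi> q $ i)" for i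
    by (rule smooth_near_fun[OF chart(2)[OF assms(1)] assms(2) coord_smooth[OF assms(1)]])
  have feq: "f q = f p + (\<Sum>i\<in>UNIV. (\<phi> q $ i - \<phi> p $ i) * H i q)" if "q \<in> V" for q
  proof -
    have "q \<in> D" "\<phi> q \<in> ball (\<phi> p) r" using that V by auto
    from eq[OF this(2)] show ?thesis
      using \<psi>\<phi>[OF \<open>q \<in> D\<close>] \<psi>\<phi>[OF assms(2)]
      by (simp add: sum_Basis_vec inner_axis H_def)
  qed
  have xc: "smooth_at p (\<lambda>q. \<phi> q $ i - \<phi> p $ i)" for i
    using smooth_near_add[OF x smooth_near_const[of p "- \<phi> p $ i"]] by simp
  have D: "w f = (\<Sum>i\<in>UNIV. w (\<lambda>q. \<phi> q $ i) * H i p)" if w: "w \<in> TM p" for w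
  proof -
    have "w f = w (\<lambda>q. f p + (\<Sum>i\<in>UNIV. (\<phi> q $ i - \<phi> p $ i) * H i q))"
      by (rule tangent_cong[OF w V(1) pV feq])
    also have "\<dots> = w (\<lambda>q. f p) + (\<Sum>i\<in>UNIV. w (\<lambda>q. (\<phi> q $ i - \<phi> p $ i) * H i q))"
      by (subst tangent_add[OF w]) (auto intro!: smooth_near_const smooth_near_sum smooth_near_mult xc H
          simp: tangent_sum_fun[OF w smooth_near_mult[OF xc H]])
    also have "\<dots> = (\<Sum>i\<in>UNIV. w (\<lambda>q. \<phi> q $ i) * H i p)"
      by (simp add: tangent_const[OF w] tangent_mult[OF w xc H] tangent_diff[OF w x smooth_near_const])
        (simp add: mult.commute)
    finally show ?thesis .
  qed
  have "coord_vec At (D, \<phi>) j p f = H j p" for j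
    by (simp add: D[OF coord_vec_tangent[OF assms(1,2)]] coord_vec_coord[OF assms(1,2)] if_distrib[of "\<lambda>x. x * _"] cong: if_cong)
  with D[OF assms(3)] show ?thesis by simp
next
  case False
  then show ?thesis using tangent_not_smooth[OF assms(3)] by (simp add: coord_vec_def)
qed

subsection \<open>Vector fields\<close>

lemma vf_tangent: "vf U X \<Longrightarrow> p \<in> U \<Longrightarrow> X p \<in> TM p"
  by (simp add: smooth_vf_def)

lemma vf_fun: "vf U X \<Longrightarrow> open U \<Longrightarrow> smooth U f \<Longrightarrow> smooth U (\<lambda>p. X p f)"
  unfolding smooth_vf_def by blast

lemma vf_subset:
  assumes "vf U X" "V \<subseteq> U" shows "vf V X"
  unfolding smooth_vf_def
proof (intro conjI ballI allI impI; (elim conjE)?)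
  show "X p \<in> TM p" if "p \<in> V" for p using vf_tangent[OF assms(1)] assms(2) that by blast
  fix W f assume "open W" "W \<subseteq> V" "smooth W f"
  then show "smooth W (\<lambda>p. X p f)"
    using assms unfolding smooth_vf_def by (meson order_trans)
qed

lemma vf_comb:
  assumes "open U" "vf U X" "vf U Y" "smooth U h" "smooth U k"
  shows "vf U (\<lambda>q f. h q * X q f + k q * Y q f)"
  unfolding smooth_vf_def
proof (intro conjI ballI allI impI; (elim conjE)?)
  show "(\<lambda>f. h p * X p f + k p * Y p f) \<in> TM p" if "p \<in> U" for p
    by (intro tangent_comb vf_tangent[OF assms(2) that] vf_tangent[OF assms(3) that])
  fix W f assume W: "open W" "W \<subseteq> U" "smooth W f"
  have "smooth W (\<lambda>p. X p f)" "smooth W (\<lambda>p. Y p f)"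
    using assms(2,3) W unfolding smooth_vf_def by blast+
  then show "smooth W (\<lambda>p. h p * X p f + k p * Y p f)"
    using smooth_subset[OF assms(4) W(2)] smooth_subset[OF assms(5) W(2)]
    by (intro smooth_add smooth_mult W(1))
qed

lemma vf_zero: "vf U (\<lambda>q. tzero)"
  by (simp add: smooth_vf_def smooth_const)

lemma vf_scale:
  assumes "open U" "vf U X" "smooth U h"
  shows "vf U (\<lambda>q f. h q * X q f)"
  using vf_comb[OF assms(1,2) vf_zero assms(3) smooth_const] by simp

lemma vf_add:
  assumes "open U" "vf U X" "vf U Y"
  shows "vf U (\<lambda>q f. X q f + Y q f)"
  using vf_comb[OF assms smooth_const[of U 1] smooth_const[of U 1]] by simp

lemma vf_diff:
  assumes "open U" "vf U X" "vf U Y"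
  shows "vf U (\<lambda>q f. X q f - Y q f)"
  using vf_comb[OF assms smooth_const[of U 1] smooth_const[of U "-1"]] by simp

lemma vf_sum:
  assumes "open U" "\<And>i. i \<in> I \<Longrightarrow> vf U (X i)" "\<And>i. i \<in> I \<Longrightarrow> smooth U (c i)"
  shows "vf U (\<lambda>q f. \<Sum>i\<in>I. c i q * X i q f)"
  using assms(2,3)
proof (induction I rule: infinite_finite_induct)
  case (insert i I)
  then show ?case
    by (simp add: vf_add[OF assms(1) vf_scale[OF assms(1)]])
qed (auto intro: vf_zero)

lemma coord_vec_vf:
  assumes "(D, \<phi>) \<in> At" shows "vf D (coord_vec At (D, \<phi>) i)"
  unfolding smooth_vf_def
proof (intro conjI ballI allI impI; (elim conjE)?)
  show "coord_vec At (D, \<phi>) i p \<in> TM p" if "p \<in> D" for p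
    by (rule coord_vec_tangent[OF assms that])
  fix W f assume W: "open W" "W \<subseteq> D" "smooth W f"
  have oW: "open (\<phi> ` W)" using chart_open_image[OF assms W(1)] W(2) by (simp add: inf.absorb2)
  show "smooth W (\<lambda>p. coord_vec At (D, \<phi>) i p f)"
  proof (rule smooth_chartI[OF assms W(1,2)])
    have C: "Ck_on k (\<phi> ` W) (f \<circ> inv_into D \<phi>)" for k
      using smooth_chartD[OF assms W(3) W(2)] unfolding smooth_on_def by blast
    have "Ck_on k (\<phi> ` W) ((\<lambda>p. coord_vec At (D, \<phi>) i p f) \<circ> inv_into D \<phi>)" for k
    proof (rule Ck_on_cong[OF oW, THEN iffD1, OF _ Ck_SucD(2)[OF C]])
      fix y assume "y \<in> \<phi> ` W"
      then obtain q where q: "q \<in> W" "y = \<phi> q" by auto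
      have "smooth_at q f" by (rule smooth_near_fun[OF W(1) q(1) W(3)])
      moreover have "inv_into D \<phi> y = q" using q W(2) inv_into_f_f[OF chart(6)[OF assms]] by auto
      ultimately show "D_at (f \<circ> inv_into D \<phi>) y (axis i 1) =
        ((\<lambda>p. coord_vec At (D, \<phi>) i p f) \<circ> inv_into D \<phi>) y"
        using q by (simp add: coord_vec_def)
    qed
    then show "smooth_on (\<phi> ` W) ((\<lambda>p. coord_vec At (D, \<phi>) i p f) \<circ> inv_into D \<phi>)"
      by (simp add: smooth_on_def)
  qed
qed

lemma vf_coord_smooth:
  assumes "(D, \<phi>) \<in> At" "open U" "U \<subseteq> D" "vf U X"
  shows "smooth U (\<lambda>q. X q (\<lambda>q. \<phi> q $ i))"
  by (rule vf_fun[OF assms(4,2)]) (rule smooth_subset[OF coord_smooth[OF assms(1)] assms(3)])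

lemma vf_near_fun:
  assumes "open U" "vf U X" "p \<in> U" "smooth_at p f"
  shows "smooth_at p (\<lambda>q. X q f)"
proof -
  obtain V where V: "open V" "p \<in> V" "smooth V f" using assms(4) unfolding smooth_near_def by blast
  have "smooth (U \<inter> V) (\<lambda>q. X q f)"
    by (rule vf_fun[OF vf_subset[OF assms(2)] _ smooth_subset[OF V(3)]]) (use assms V in auto)
  then show ?thesis using assms V by (intro smooth_near_fun[of "U \<inter> V"]) auto
qed

text \<open>The products of first derivatives in the second-order Leibniz rule are symmetric in the
  two fields and cancel in the commutator.\<close>

lemma bracket_tangent:
  assumes "open U" "vf U X" "vf U Y" "p \<in> U"
  shows "bracket X Y p \<in> TM p"
  unfolding tangent_def
proof (intro CollectI conjI allI impI; (elim conjE)?)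
  fix f h and a b :: real
  assume *: "smooth_at p f" "smooth_at p h"
  have n: "smooth_at p (\<lambda>q. a * f q + b * h q)" "smooth_at p (\<lambda>q. f q * h q)"
    by (intro smooth_near_add smooth_near_mult smooth_near_const *)+
  obtain V where V: "open V" "p \<in> V" "smooth V f" "smooth V h"
  proof -
    obtain V1 V2 where "open V1" "p \<in> V1" "smooth V1 f" "open V2" "p \<in> V2" "smooth V2 h"
      using * unfolding smooth_near_def by blast
    then show thesis by (intro that[of "V1 \<inter> V2"]) (auto intro: smooth_subset)
  qed
  note nf = vf_near_fun[OF assms(1) _ assms(4) *(1)] and nh = vf_near_fun[OF assms(1) _ assms(4) *(2)]
  have q: "smooth_at q f" "smooth_at q h" if "q \<in> U \<inter> V" for q
    using V that by (auto intro: smooth_near_fun)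
  have lin: "Z p (\<lambda>q. Z' q (\<lambda>q. a * f q + b * h q)) = a * Z p (\<lambda>q. Z' q f) + b * Z p (\<lambda>q. Z' q h)"
    if "vf U Z" "vf U Z'" for Z Z'
  proof -
    have "Z p (\<lambda>q. Z' q (\<lambda>q. a * f q + b * h q)) = Z p (\<lambda>q. a * Z' q f + b * Z' q h)"
      by (rule tangent_cong[OF vf_tangent[OF that(1) assms(4)], of "U \<inter> V"])
         (use V assms q that in \<open>auto intro!: tangent_linear vf_tangent[OF that(2)]\<close>)
    then show ?thesis using tangent_linear[OF vf_tangent[OF that(1) assms(4)] nf nh] that by simp
  qed
  have mul: "Z p (\<lambda>q. Z' q (\<lambda>q. f q * h q)) = f p * Z p (\<lambda>q. Z' q h) + Z' p h * Z p f + (h p * Z p (\<lambda>q. Z' q f) + Z' p f * Z p h)"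
    if "vf U Z" "vf U Z'" for Z Z'
  proof -
    note Zt = vf_tangent[OF that(1) assms(4)]
    have "Z p (\<lambda>q. Z' q (\<lambda>q. f q * h q)) = Z p (\<lambda>q. f q * Z' q h + h q * Z' q f)"
      by (rule tangent_cong[OF vf_tangent[OF that(1) assms(4)], of "U \<inter> V"])
         (use V assms q that in \<open>auto intro!: tangent_mult vf_tangent[OF that(2)]\<close>)
    then show ?thesis
      using tangent_add[OF Zt smooth_near_mult smooth_near_mult, OF *(1) nh *(2) nf] that
        tangent_mult[OF Zt *(1) nh] tangent_mult[OF Zt *(2) nf] by simp
  qed
  show "bracket X Y p (\<lambda>q. a * f q + b * h q) = a * bracket X Y p f + b * bracket X Y p h"
    using n * by (simp add: lie_bracket_def lin assms algebra_simps)
  show "bracket X Y p (\<lambda>q. f q * h q) = f p * bracket X Y p h + h p * bracket X Y p f"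
    using n * by (simp add: lie_bracket_def mul assms algebra_simps)
qed (simp add: lie_bracket_def)

lemma vf_bracket:
  assumes "open U" "vf U X" "vf U Y"
  shows "vf U (bracket X Y)"
  unfolding smooth_vf_def
proof (intro conjI ballI allI impI; (elim conjE)?)
  show "bracket X Y p \<in> TM p" if "p \<in> U" for p
    by (rule bracket_tangent[OF assms that])
  fix W f assume W: "open W" "W \<subseteq> U" "smooth W f"
  note XY = vf_subset[OF assms(2) W(2)] vf_subset[OF assms(3) W(2)]
  have "smooth W (\<lambda>p. X p (\<lambda>q. Y q f) - Y p (\<lambda>q. X q f))"
    by (intro smooth_diff W(1) vf_fun[OF XY(1)] vf_fun[OF XY(2)] W(3))
  then show "smooth W (\<lambda>p. bracket X Y p f)"
    by (rule smooth_cong[OF W(1), rotated]) (use W smooth_near_fun in \<open>auto simp: lie_bracket_def\<close>)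
qed

section \<open>Division in charts, and derivatives of forms evaluated on fields\<close>

lemma division_in_chart:
  assumes "(D, \<phi>) \<in> At" "open U" "p \<in> U" "U \<subseteq> D" "smooth U \<delta>" "\<delta> p = 0"
    and "D_at (\<delta> \<circ> inv_into D \<phi>) (\<phi> p) \<noteq> (\<lambda>v. 0)"
  obtains V where "open V" "p \<in> V" "V \<subseteq> U"
    "\<And>f. smooth V f \<Longrightarrow> (\<And>q. q \<in> V \<Longrightarrow> \<delta> q = 0 \<Longrightarrow> f q = 0) \<Longrightarrow>
       \<exists>h. smooth V h \<and> (\<forall>q\<in>V. f q = \<delta> q * h q)"
proof -
  let ?\<psi> = "inv_into D \<phi>"
  have \<psi>\<phi>: "?\<psi> (\<phi> q) = q" if "q \<in> D" for q using inv_into_f_f[OF chart(6)[OF assms(1)] that] .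
  have oU: "open (\<phi> ` U)" using chart_open_image[OF assms(1,2)] assms(4) by (simp add: inf.absorb2)
  \<comment> \<open>The neighbourhood is fixed before \<open>f\<close>, so that several quotients
    can later be taken on one set.\<close>
  obtain V' where V': "open V'" "\<phi> p \<in> V'" "V' \<subseteq> \<phi> ` U"
    and div: "\<And>f. smooth_on V' f \<Longrightarrow> (\<And>x. x \<in> V' \<Longrightarrow> (\<delta> \<circ> ?\<psi>) x = 0 \<Longrightarrow> f x = 0) \<Longrightarrow>
       \<exists>h. smooth_on V' h \<and> (\<forall>x\<in>V'. f x = (\<delta> \<circ> ?\<psi>) x * h x)"
  proof (rule smooth_division[OF oU, of "\<phi> p" "\<delta> \<circ> ?\<psi>"])
    show "smooth_on (\<phi> ` U) (\<delta> \<circ> ?\<psi>)" by (rule smooth_chartD[OF assms(1,5,4)]) simp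
    show "(\<delta> \<circ> ?\<psi>) (\<phi> p) = 0" using \<psi>\<phi> assms by auto
  qed (use assms in auto)
  have V'D: "V' \<subseteq> \<phi> ` D" using V'(3) assms(4) by auto
  define V where "V = ?\<psi> ` V'"
  note V = chart_open_preimage[OF assms(1) V'(1) V'D, folded V_def]
  have "p \<in> V" unfolding V_def using V'(2) \<psi>\<phi> assms by (intro image_eqI[of _ _ "\<phi> p"]) auto
  have "V \<subseteq> U"
  proof
    fix q assume "q \<in> V"
    then obtain u where "u \<in> U" "q = ?\<psi> (\<phi> u)" using V'(3) by (auto simp: V_def)
    then show "q \<in> U" using \<psi>\<phi> assms(4) by auto
  qed
  have "\<exists>h. smooth V h \<and> (\<forall>q\<in>V. f q = \<delta> q * h q)"
    if f: "smooth V f" and f0: "\<And>q. q \<in> V \<Longrightarrow> \<delta> q = 0 \<Longrightarrow> f q = 0" for f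
  proof -
    have "smooth_on V' (f \<circ> ?\<psi>)" using smooth_chartD[OF assms(1) f V(2)] V(3) by simp
    then obtain h where h: "smooth_on V' h" "\<And>x. x \<in> V' \<Longrightarrow> (f \<circ> ?\<psi>) x = (\<delta> \<circ> ?\<psi>) x * h x"
      using div[of "f \<circ> ?\<psi>"] f0 by (fastforce simp: V_def)
    have "smooth V (h \<circ> \<phi>)"
    proof (rule smooth_chartI[OF assms(1) V(1,2)])
      have "Ck_on k V' ((h \<circ> \<phi>) \<circ> ?\<psi>)" for k
      proof (rule Ck_on_cong[OF V'(1), THEN iffD1])
        show "Ck_on k V' h" using h(1) by (simp add: smooth_on_def)
      qed (use V'D in \<open>auto simp: f_inv_into_f subset_iff\<close>)
      then show "smooth_on (\<phi> ` V) ((h \<circ> \<phi>) \<circ> ?\<psi>)" unfolding V(3) smooth_on_def by blast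
    qed
    moreover have "f q = \<delta> q * (h \<circ> \<phi>) q" if "q \<in> V" for q
      using h(2)[of "\<phi> q"] \<psi>\<phi>[of q] V that by auto
    ultimately show ?thesis by blast
  qed
  with that V(1) \<open>p \<in> V\<close> \<open>V \<subseteq> U\<close> show ?thesis by blast
qed

text \<open>Smoothness of tensors is a statement about fields; this realises a given vector as the
  value of a field, with coefficients constant in the chart.\<close>

lemma constant_coefficient_field:
  assumes "(D, \<phi>) \<in> At" "p \<in> D" "v \<in> TM p"
  obtains X where "vf D X" "X p = v"
proof
  show "vf D (\<lambda>q f. \<Sum>k\<in>UNIV. v (\<lambda>q. \<phi> q $ k) * coord_vec At (D, \<phi>) k q f)"
    by (intro vf_sum chart(2)[OF assms(1)] coord_vec_vf[OF assms(1)] smooth_const)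
  show "(\<lambda>f. \<Sum>k\<in>UNIV. v (\<lambda>q. \<phi> q $ k) * coord_vec At (D, \<phi>) k p f) = v"
    by (rule ext) (rule tangent_expansion[OF assms, symmetric])
qed

text \<open>At a zero of \<open>E\<close> only the coefficients of \<open>E\<close> need to be
  differentiated, so the derivative of \<open>L q (E q)\<close> is the form at \<open>p\<close>
  applied to the derivative \<open>w\<close> of \<open>E\<close> along \<open>v\<close>. The
  vanishing of \<open>E\<close> at \<open>p\<close> is also what makes \<open>w\<close> a tangent
  vector.\<close>

lemma derivative_form:
  assumes "open U" "p \<in> U" "v \<in> TM p" "vf U E" "E p = tzero"
    and lin: "\<And>q. q \<in> U \<Longrightarrow> linear_form At q (L q)"
    and smooth: "\<And>V X. open V \<Longrightarrow> V \<subseteq> U \<Longrightarrow> vf V X \<Longrightarrow> smooth V (\<lambda>q. L q (X q))"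
  defines "w \<equiv> (\<lambda>f. if smooth_at p f then v (\<lambda>q. E q f) else 0)"
  shows "w \<in> TM p" "v (\<lambda>q. L q (E q)) = L p w"
proof -
  obtain D \<phi> where D: "(D, \<phi>) \<in> At" "p \<in> D" by (rule ex_chart)
  let ?d = "\<lambda>i. coord_vec At (D, \<phi>) i" and ?e = "\<lambda>i q. E q (\<lambda>q. \<phi> q $ i)"
  define V where "V = U \<inter> D"
  have V: "open V" "p \<in> V" "V \<subseteq> D" "V \<subseteq> U" using assms(1,2) D chart(2)[OF D(1)] by (auto simp: V_def)
  note sE = vf_subset[OF assms(4) V(4)] and sd = vf_subset[OF coord_vec_vf[OF D(1)] V(3)]
  have se: "smooth_at p (?e i)" for i
    by (rule smooth_near_fun[OF V(1,2) vf_coord_smooth[OF D(1) V(1,3) sE]])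
  have Eq: "E q = (\<lambda>f. \<Sum>i\<in>UNIV. ?e i q * ?d i q f)" if "q \<in> V" for q
    by (rule ext, rule tangent_expansion[OF D(1)]) (use that V vf_tangent[OF assms(4)] in auto)
  have D0: "v (\<lambda>q. \<Sum>i\<in>UNIV. ?e i q * h i q) = (\<Sum>i\<in>UNIV. v (?e i) * h i p)" if n: "\<And>i. smooth_at p (h i)" for h
    by (subst tangent_sum_fun[OF assms(3) smooth_near_mult[OF se n]])
       (simp add: tangent_mult[OF assms(3) se n] assms(5) mult.commute[of "v _"])
  have "w f = (\<Sum>i\<in>UNIV. v (?e i) * ?d i p f)" for f
  proof (cases "smooth_at p f")
    case True
    have "v (\<lambda>q. E q f) = v (\<lambda>q. \<Sum>i\<in>UNIV. ?e i q * ?d i q f)"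
      by (rule tangent_cong[OF assms(3) V(1,2)], rule fun_cong[OF Eq])
    then show ?thesis using True D0[OF vf_near_fun[OF V(1) sd V(2) True]] by (simp add: w_def)
  qed (simp add: w_def coord_vec_def)
  then have w: "w = (\<lambda>f. \<Sum>i\<in>UNIV. v (?e i) * ?d i p f)" by (rule ext)
  show "w \<in> TM p" unfolding w by (rule tangent_sum) (rule vf_tangent[OF sd V(2)])
  have "L q (E q) = (\<Sum>i\<in>UNIV. ?e i q * L q (?d i q))" if "q \<in> V" for q
  proof -
    have "L q (\<lambda>f. \<Sum>i\<in>UNIV. ?e i q * ?d i q f) = (\<Sum>i\<in>UNIV. ?e i q * L q (?d i q))"
      by (rule linear_form_sum[OF lin vf_tangent[OF sd that]]) (use that V in auto)
    then show ?thesis by (simp only: Eq[OF that, symmetric])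
  qed
  then have "v (\<lambda>q. L q (E q)) = v (\<lambda>q. \<Sum>i\<in>UNIV. ?e i q * L q (?d i q))"
    by (rule tangent_cong[OF assms(3) V(1,2)])
  also have "\<dots> = (\<Sum>i\<in>UNIV. v (?e i) * L p (?d i p))"
    by (rule D0[OF smooth_near_fun[OF V(1,2) smooth[OF V(1,4) sd]]])
  also have "\<dots> = L p w"
    unfolding w by (rule linear_form_sum[symmetric, OF lin[OF assms(2)] vf_tangent[OF sd V(2)]])
  finally show "v (\<lambda>q. L q (E q)) = L p w" .
qed

text \<open>Two fields with the same value at \<open>p\<close> differ by one that vanishes there,
  and for the difference the derivative is a value of \<open>L p\<close>, which is zero. This
  exchanges one extension for another in a single slot of \<Upsilon>.\<close>

lemma derivative_form_cong:
  assumes "open U" "p \<in> U" "v \<in> TM p" "vf U X" "vf U X'" "X p = X' p"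
    and lin: "\<And>q. q \<in> U \<Longrightarrow> linear_form At q (L q)"
    and smooth: "\<And>V X. open V \<Longrightarrow> V \<subseteq> U \<Longrightarrow> vf V X \<Longrightarrow> smooth V (\<lambda>q. L q (X q))"
    and zero: "\<And>x. x \<in> TM p \<Longrightarrow> L p x = 0"
  shows "v (\<lambda>q. L q (X q)) = v (\<lambda>q. L q (X' q))"
proof -
  let ?E = "\<lambda>q f. 1 * X q f + (- 1) * X' q f"
  have "v (\<lambda>q. L q (?E q)) = 0"
  proof -
    have E: "vf U ?E" by (rule vf_comb[OF assms(1,4,5) smooth_const smooth_const])
    have "?E p = tzero" by (simp add: assms(6))
    note d = derivative_form[OF assms(1-3) E this, of L, OF lin smooth]
    show ?thesis by (rule trans[OF d(2) zero[OF d(1)]])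
  qed
  moreover have "L q (?E q) = L q (X q) - L q (X' q)" if "q \<in> U" for q
    using lin[OF that, unfolded linear_form_def, rule_format, OF vf_tangent[OF assms(4) that] vf_tangent[OF assms(5) that], of 1 "-1"]
    by simp
  then have "v (\<lambda>q. L q (?E q)) = v (\<lambda>q. L q (X q) - L q (X' q))"
    by (rule tangent_cong[OF assms(3,1,2)])
  moreover have "v (\<lambda>q. L q (X q) - L q (X' q)) = v (\<lambda>q. L q (X q)) - v (\<lambda>q. L q (X' q))"
    by (rule tangent_diff[OF assms(3) smooth_near_fun[OF assms(1,2) smooth] smooth_near_fun[OF assms(1,2) smooth]])
       (use assms in auto)
  ultimately show ?thesis by simp
qed

text \<open>Each term in the permutation expansion of the determinant contains one factor from
  either row, so it vanishes to second order at \<open>p\<close>.\<close>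

lemma derivative_det_two_rows:
  fixes M :: "'a \<Rightarrow> real^'n^'n"
  assumes "v \<in> TM p" and n: "\<And>k l. smooth_at p (\<lambda>q. M q $ k $ l)" and "i \<noteq> j"
    and "\<And>l. M p $ i $ l = 0" "\<And>l. M p $ j $ l = 0"
  shows "v (\<lambda>q. det (M q)) = 0"
proof -
  let ?c = "\<lambda>\<sigma>. of_int (sign \<sigma>) :: real"
  let ?r = "\<lambda>\<sigma> q. \<Prod>k\<in>UNIV - {i} - {j}. M q $ k $ \<sigma> k"
  have nr: "smooth_at p (?r \<sigma>)" for \<sigma>
  proof -
    have "smooth_at p (\<lambda>q. \<Prod>k\<in>K. M q $ k $ \<sigma> k)" for K
      by (induction K rule: infinite_finite_induct) (auto intro: smooth_near_const smooth_near_mult n)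
    then show ?thesis .
  qed
  have d: "det (M q) = (\<Sum>\<sigma> | \<sigma> permutes UNIV. ?c \<sigma> * (M q $ i $ \<sigma> i * (M q $ j $ \<sigma> j * ?r \<sigma> q)))" for q
  proof -
    have "(\<Prod>k\<in>UNIV. M q $ k $ \<sigma> k) = M q $ i $ \<sigma> i * (M q $ j $ \<sigma> j * ?r \<sigma> q)" for \<sigma>
      using prod.remove[of UNIV i "\<lambda>k. M q $ k $ \<sigma> k"] prod.remove[of "UNIV - {i}" j "\<lambda>k. M q $ k $ \<sigma> k"] assms(3) by simp
    then show ?thesis by (simp add: det_def)
  qed
  have n2: "smooth_at p (\<lambda>q. M q $ j $ \<sigma> j * ?r \<sigma> q)" for \<sigma> by (intro smooth_near_mult n nr)
  have n3: "smooth_at p (\<lambda>q. M q $ i $ \<sigma> i * (M q $ j $ \<sigma> j * ?r \<sigma> q))" for \<sigma> by (intro smooth_near_mult n n2)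
  have "v (\<lambda>q. ?c \<sigma> * (M q $ i $ \<sigma> i * (M q $ j $ \<sigma> j * ?r \<sigma> q))) = 0" for \<sigma>
    unfolding tangent_mult[OF assms(1) smooth_near_const n3] tangent_mult[OF assms(1) n n2] tangent_const[OF assms(1)]
    by (simp add: assms(4,5))
  then show ?thesis
    unfolding d by (subst tangent_sum_fun[OF assms(1) smooth_near_mult[OF smooth_near_const n3]]) simp
qed

lemma vf_extends_subset: "extends T A U AA \<Longrightarrow> T' \<subseteq> T \<Longrightarrow> extends T' A U AA"
  by (auto simp: vf_extends_def)

lemma vf_along_subset:
  assumes "along T A" "T' \<subseteq> T" shows "along T' A"
  unfolding vf_along_def
proof
  fix p assume "p \<in> T'"
  then obtain U AA where "open U" "p \<in> U" "extends T A U AA"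
    using assms unfolding vf_along_def by (meson subsetD)
  with vf_extends_subset[OF this(3) assms(2)]
  show "\<exists>U AA. open U \<and> p \<in> U \<and> extends T' A U AA" by blast
qed

lemma vf_extends_restrict: "extends T X U XX \<Longrightarrow> V \<subseteq> U \<Longrightarrow> extends T X V XX"
  using vf_subset[of U XX V] unfolding vf_extends_def by auto

end

section \<open>The dual connection\<close>

locale metric_manifold = manifold At for At :: "('a::t2_space, 'n::finite) atlas" +
  fixes g :: "'a tensor2"
  assumes metric: "smooth_symmetric_tensor2 At g"
begin

abbreviation "DC \<equiv> dual_conn At g"
abbreviation "Sg \<equiv> Sing At g"
abbreviation "TSg \<equiv> tangent_Sing At g"

lemma g_sym: "v \<in> TM p \<Longrightarrow> w \<in> TM p \<Longrightarrow> g p v w = g p w v"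
  using metric unfolding smooth_symmetric_tensor2_def by simp

lemma g_linear_form: "v \<in> TM p \<Longrightarrow> linear_form At p (g p v)"
  using metric unfolding smooth_symmetric_tensor2_def by simp

lemma g_fun: "open U \<Longrightarrow> vf U X \<Longrightarrow> vf U Y \<Longrightarrow> smooth U (\<lambda>p. g p (X p) (Y p))"
  using metric unfolding smooth_symmetric_tensor2_def by simp

lemma g_comb_right:
  assumes "u \<in> TM p" "v \<in> TM p" "w \<in> TM p"
  shows "g p u (\<lambda>f. a * v f + b * w f) = a * g p u v + b * g p u w"
  using g_linear_form[OF assms(1)] assms(2,3) unfolding linear_form_def by simp

lemma g_comb_left:
  assumes "u \<in> TM p" "v \<in> TM p" "w \<in> TM p"
  shows "g p (\<lambda>f. a * v f + b * w f) u = a * g p v u + b * g p w u"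
  using g_comb_right[OF assms, of a b] g_sym[OF assms(1)] tangent_comb[OF assms(2,3)] assms by simp

lemma g_zero: "v \<in> TM p \<Longrightarrow> g p v tzero = 0" "v \<in> TM p \<Longrightarrow> g p tzero v = 0"
  using g_comb_right[of v p tzero tzero 0 0] g_comb_left[of v p tzero tzero 0 0] by auto

lemma g_diff:
  assumes "u \<in> TM p" "v \<in> TM p" "w \<in> TM p"
  shows "g p u (\<lambda>f. v f - w f) = g p u v - g p u w" "g p (\<lambda>f. v f - w f) u = g p v u - g p w u"
  using g_comb_right[OF assms, of 1 "-1"] g_comb_left[OF assms, of 1 "-1"] by auto

lemma g_minus:
  assumes "u \<in> TM p" "v \<in> TM p"
  shows "g p u (\<lambda>f. - v f) = - g p u v" "g p (\<lambda>f. - v f) u = - g p v u"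
  using g_comb_right[OF assms tangent_zero, of "-1" 0] g_comb_left[OF assms tangent_zero, of "-1" 0] by auto

lemma g_sum_right:
  assumes "u \<in> TM p" "\<And>i. i \<in> I \<Longrightarrow> v i \<in> TM p"
  shows "g p u (\<lambda>f. \<Sum>i\<in>I. c i * v i f) = (\<Sum>i\<in>I. c i * g p u (v i))"
  by (rule linear_form_sum[OF g_linear_form[OF assms(1)] assms(2)])

lemma g_sum_left:
  assumes "u \<in> TM p" "\<And>i. i \<in> I \<Longrightarrow> v i \<in> TM p"
  shows "g p (\<lambda>f. \<Sum>i\<in>I. c i * v i f) u = (\<Sum>i\<in>I. c i * g p (v i) u)"
proof -
  have "g p (\<lambda>f. \<Sum>i\<in>I. c i * v i f) u = g p u (\<lambda>f. \<Sum>i\<in>I. c i * v i f)"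
    by (rule g_sym[OF tangent_sum assms(1)]) (rule assms(2))
  also have "\<dots> = (\<Sum>i\<in>I. c i * g p u (v i))" by (rule g_sum_right[OF assms])
  also have "\<dots> = (\<Sum>i\<in>I. c i * g p (v i) u)"
    by (rule sum.cong) (use g_sym[OF assms(1) assms(2)] in auto)
  finally show ?thesis .
qed

lemma g_near:
  assumes "open U" "vf U X" "vf U Y" "p \<in> U"
  shows "smooth_at p (\<lambda>q. g q (X q) (Y q))"
  using smooth_near_fun[OF assms(1,4) g_fun[OF assms(1-3)]] .

lemma g_fun_sym:
  assumes "open U" "vf U X" "vf U Y" "p \<in> U" "v \<in> TM p"
  shows "v (\<lambda>q. g q (X q) (Y q)) = v (\<lambda>q. g q (Y q) (X q))"
  by (rule tangent_cong[OF assms(5,1,4)], rule g_sym[OF vf_tangent[OF assms(2)] vf_tangent[OF assms(3)]])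

lemma g_fun_comb_right:
  assumes "open U" "vf U X" "vf U Y" "vf U Z" "p \<in> U" "v \<in> TM p"
  shows "v (\<lambda>q. g q (X q) (\<lambda>f. a * Y q f + b * Z q f)) = a * v (\<lambda>q. g q (X q) (Y q)) + b * v (\<lambda>q. g q (X q) (Z q))"
proof -
  have "v (\<lambda>q. g q (X q) (\<lambda>f. a * Y q f + b * Z q f)) = v (\<lambda>q. a * g q (X q) (Y q) + b * g q (X q) (Z q))"
    by (rule tangent_cong[OF assms(6,1,5)], rule g_comb_right[OF vf_tangent[OF assms(2)] vf_tangent[OF assms(3)] vf_tangent[OF assms(4)]])
  also have "\<dots> = a * v (\<lambda>q. g q (X q) (Y q)) + b * v (\<lambda>q. g q (X q) (Z q))"
    by (rule tangent_linear[OF assms(6) g_near[OF assms(1,2,3,5)] g_near[OF assms(1,2,4,5)]])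
  finally show ?thesis .
qed

lemma g_fun_comb_left:
  assumes "open U" "vf U X" "vf U Y" "vf U Z" "p \<in> U" "v \<in> TM p"
  shows "v (\<lambda>q. g q (\<lambda>f. a * Y q f + b * Z q f) (X q)) = a * v (\<lambda>q. g q (Y q) (X q)) + b * v (\<lambda>q. g q (Z q) (X q))"
proof -
  have "v (\<lambda>q. g q (\<lambda>f. a * Y q f + b * Z q f) (X q)) = v (\<lambda>q. a * g q (Y q) (X q) + b * g q (Z q) (X q))"
    by (rule tangent_cong[OF assms(6,1,5)], rule g_comb_left[OF vf_tangent[OF assms(2)] vf_tangent[OF assms(3)] vf_tangent[OF assms(4)]])
  also have "\<dots> = a * v (\<lambda>q. g q (Y q) (X q)) + b * v (\<lambda>q. g q (Z q) (X q))"
    by (rule tangent_linear[OF assms(6) g_near[OF assms(1,3,2,5)] g_near[OF assms(1,4,2,5)]])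
  finally show ?thesis .
qed

lemma bracket_antisym: "bracket X Y p = (\<lambda>f. - bracket Y X p f)"
  by (auto simp: lie_bracket_def)

lemma bracket_comb_left:
  assumes "open U" "vf U X" "vf U X'" "vf U Y" "p \<in> U"
  shows "bracket (\<lambda>q f. a * X q f + b * X' q f) Y p = (\<lambda>f. a * bracket X Y p f + b * bracket X' Y p f)"
proof
  fix f
  show "bracket (\<lambda>q f. a * X q f + b * X' q f) Y p f = a * bracket X Y p f + b * bracket X' Y p f"
    using tangent_linear[OF vf_tangent[OF assms(4,5)] vf_near_fun[OF assms(1,2,5)] vf_near_fun[OF assms(1,3,5)]]
    by (simp add: lie_bracket_def algebra_simps)
qed

lemma bracket_comb_right:
  assumes "open U" "vf U X" "vf U X'" "vf U Y" "p \<in> U"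
  shows "bracket Y (\<lambda>q f. a * X q f + b * X' q f) p = (\<lambda>f. a * bracket Y X p f + b * bracket Y X' p f)"
  using bracket_comb_left[OF assms, of a b] by (subst (1 2 3) bracket_antisym) (auto simp: algebra_simps)

section \<open>The Koszul expression: linearity and dependence on its three fields\<close>

lemma dual_conn_smooth:
  assumes "open U" "vf U X" "vf U Y" "vf U Z"
  shows "smooth U (DC X Y Z)"
proof -
  note s = g_fun[OF assms(1)] vf_bracket[OF assms(1)] assms
  have "smooth U (\<lambda>p. (1/2) * (X p (\<lambda>q. g q (Y q) (Z q)) + Y p (\<lambda>q. g q (Z q) (X q)) - Z p (\<lambda>q. g q (X q) (Y q))
      + g p (bracket X Y p) (Z p) - g p (bracket Y Z p) (X p)
      + g p (bracket Z X p) (Y p)))"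
    by (intro smooth_mult smooth_const smooth_add smooth_diff assms(1)
        vf_fun[OF assms(2)] vf_fun[OF assms(3)] vf_fun[OF assms(4)] s)
  then show ?thesis by (simp add: dual_conn_def[abs_def])
qed

context
  fixes U :: "'a set" and p :: 'a assumes U: "open U" "p \<in> U"
begin

lemma g_bracket_antisym:
  assumes "vf U X" "vf U Y" "vf U Z"
  shows "g p (bracket Y X p) (Z p) = - g p (bracket X Y p) (Z p)"
  using g_minus(2)[OF vf_tangent[OF assms(3) U(2)] bracket_tangent[OF U(1) assms(1,2) U(2)]]
    bracket_antisym[of Y X p] by simp

lemma dual_conn_compat:
  assumes "vf U X" "vf U Y" "vf U Z"
  shows "DC X Y Z p + DC X Z Y p = X p (\<lambda>q. g q (Y q) (Z q))"
  using g_fun_sym[OF U(1) assms(2,3) U(2) vf_tangent[OF assms(1) U(2)]]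
    g_fun_sym[OF U(1) assms(1,3) U(2) vf_tangent[OF assms(2) U(2)]]
    g_fun_sym[OF U(1) assms(1,2) U(2) vf_tangent[OF assms(3) U(2)]]
    g_bracket_antisym[OF assms] g_bracket_antisym[OF assms(1,3,2)] g_bracket_antisym[OF assms(2,3,1)]
  by (simp add: dual_conn_def field_simps)

lemma dual_conn_torsion:
  assumes "vf U X" "vf U Y" "vf U Z"
  shows "DC X Y Z p = DC Y X Z p + g p (bracket X Y p) (Z p)"
  using g_fun_sym[OF U(1) assms(2,3) U(2) vf_tangent[OF assms(1) U(2)]]
    g_fun_sym[OF U(1) assms(1,3) U(2) vf_tangent[OF assms(2) U(2)]]
    g_fun_sym[OF U(1) assms(1,2) U(2) vf_tangent[OF assms(3) U(2)]]
    g_bracket_antisym[OF assms] g_bracket_antisym[OF assms(1,3,2)] g_bracket_antisym[OF assms(2,3,1)]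
  by (simp add: dual_conn_def field_simps)

text \<open>Constant coefficients are enough: a coefficient function is first frozen at its value at
  \<open>p\<close>, which the congruence lemmas below justify.\<close>

lemma dual_conn_comb1:
  assumes "vf U X" "vf U X'" "vf U Y" "vf U Z"
  shows "DC (\<lambda>q f. a * X q f + b * X' q f) Y Z p = a * DC X Y Z p + b * DC X' Y Z p"
proof -
  note t = vf_tangent[OF assms(1) U(2)] vf_tangent[OF assms(2) U(2)] vf_tangent[OF assms(3) U(2)] vf_tangent[OF assms(4) U(2)]
  note b = bracket_tangent[OF U(1) _ _ U(2)]
  have 1: "Y p (\<lambda>q. g q (Z q) (\<lambda>f. a * X q f + b * X' q f)) = a * Y p (\<lambda>q. g q (Z q) (X q)) + b * Y p (\<lambda>q. g q (Z q) (X' q))"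
    by (rule g_fun_comb_right[OF U(1) assms(4,1,2) U(2) t(3)])
  have 2: "Z p (\<lambda>q. g q (\<lambda>f. a * X q f + b * X' q f) (Y q)) = a * Z p (\<lambda>q. g q (X q) (Y q)) + b * Z p (\<lambda>q. g q (X' q) (Y q))"
    by (rule g_fun_comb_left[OF U(1) assms(3,1,2) U(2) t(4)])
  have 3: "g p (bracket (\<lambda>q f. a * X q f + b * X' q f) Y p) (Z p) =
     a * g p (bracket X Y p) (Z p) + b * g p (bracket X' Y p) (Z p)"
    unfolding bracket_comb_left[OF U(1) assms(1-3) U(2)]
    by (rule g_comb_left[OF t(4) b[OF assms(1,3)] b[OF assms(2,3)]])
  have 4: "g p (bracket Z (\<lambda>q f. a * X q f + b * X' q f) p) (Y p) =
     a * g p (bracket Z X p) (Y p) + b * g p (bracket Z X' p) (Y p)"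
    unfolding bracket_comb_right[OF U(1) assms(1,2,4) U(2)]
    by (rule g_comb_left[OF t(3) b[OF assms(4,1)] b[OF assms(4,2)]])
  have 5: "g p (bracket Y Z p) (\<lambda>f. a * X p f + b * X' p f) = a * g p (bracket Y Z p) (X p) + b * g p (bracket Y Z p) (X' p)"
    by (rule g_comb_right[OF b[OF assms(3,4)] t(1,2)])
  show ?thesis unfolding dual_conn_def 1 2 3 4 5 by (simp add: field_simps)
qed

text \<open>Linearity passes from the first slot to the second because the torsion vanishes, and in
  \<open>dual_conn_comb3\<close> from the second to the third by compatibility with the
  metric.\<close>

lemma dual_conn_comb2:
  assumes "vf U X" "vf U X'" "vf U Y" "vf U Z"
  shows "DC Y (\<lambda>q f. a * X q f + b * X' q f) Z p = a * DC Y X Z p + b * DC Y X' Z p"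
proof -
  have c: "vf U (\<lambda>q f. a * X q f + b * X' q f)"
    by (intro vf_comb U assms smooth_const)
  have "g p (bracket Y (\<lambda>q f. a * X q f + b * X' q f) p) (Z p) =
     a * g p (bracket Y X p) (Z p) + b * g p (bracket Y X' p) (Z p)"
    unfolding bracket_comb_right[OF U(1) assms(1-3) U(2)]
    by (rule g_comb_left[OF vf_tangent[OF assms(4) U(2)] bracket_tangent[OF U(1) assms(3,1) U(2)] bracket_tangent[OF U(1) assms(3,2) U(2)]])
  then show ?thesis
    unfolding dual_conn_torsion[OF assms(3) c assms(4)] dual_conn_torsion[OF assms(3,1,4)] dual_conn_torsion[OF assms(3,2,4)]
      dual_conn_comb1[OF assms] by (simp add: algebra_simps)
qed

lemma dual_conn_comb3:
  assumes "vf U X" "vf U X'" "vf U Y" "vf U Z"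
  shows "DC Y Z (\<lambda>q f. a * X q f + b * X' q f) p = a * DC Y Z X p + b * DC Y Z X' p"
proof -
  have c: "vf U (\<lambda>q f. a * X q f + b * X' q f)"
    by (intro vf_comb U assms smooth_const)
  have "Y p (\<lambda>q. g q (Z q) (\<lambda>f. a * X q f + b * X' q f)) = a * Y p (\<lambda>q. g q (Z q) (X q)) + b * Y p (\<lambda>q. g q (Z q) (X' q))"
    by (rule g_fun_comb_right[OF U(1) assms(4,1,2) U(2) vf_tangent[OF assms(3) U(2)]])
  moreover have eq: "DC Y Z W p = Y p (\<lambda>q. g q (Z q) (W q)) - DC Y W Z p" if "vf U W" for W
    using dual_conn_compat[OF assms(3,4) that] by simp
  ultimately show ?thesis
    unfolding eq[OF assms(1)] eq[OF assms(2)] eq[OF c] dual_conn_comb2[OF assms(1-4)] by (simp add: algebra_simps)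
qed

text \<open>At a zero of \<open>E\<close> the derivative of \<open>E\<close> along \<open>Y\<close>
  is the bracket of \<open>Y\<close> and \<open>E\<close>, since the other half of the commutator
  differentiates along \<open>E p\<close>, which is zero.\<close>

lemma derivative_vanishing_field:
  assumes "vf U E" "E p = tzero" "vf U Y" "vf U Z"
  shows "Y p (\<lambda>q. g q (E q) (Z q)) = g p (bracket Y E p) (Z p)"
proof -
  have "Y p (\<lambda>q. g q (E q) (Z q)) = g p (\<lambda>f. if smooth_at p f then Y p (\<lambda>q. E q f) else 0) (Z p)"
  proof (rule derivative_form(2)[OF U vf_tangent[OF assms(3) U(2)] assms(1,2)])
    show "linear_form At q (\<lambda>x. g q x (Z q))" if "q \<in> U" for q
      unfolding linear_form_def using g_comb_left[OF vf_tangent[OF assms(4) that]] by blast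
    show "smooth V (\<lambda>q. g q (X q) (Z q))" if "open V" "V \<subseteq> U" "vf V X" for V X
      by (rule g_fun[OF that(1,3) vf_subset[OF assms(4) that(2)]])
  qed
  also have "(\<lambda>f. if smooth_at p f then Y p (\<lambda>q. E q f) else 0) = bracket Y E p"
    using assms(2) by (auto simp: lie_bracket_def)
  finally show ?thesis .
qed

text \<open>The derivatives along \<open>Y\<close> and \<open>Z\<close> cancel against the two
  brackets containing \<open>E\<close>; the remaining terms contain the value \<open>E p\<close>. So
  the first slot is tensorial. In the second slot a derivative is left over
  (\<open>dual_conn_vanish2\<close>), and compatibility then shows that the third is tensorial
  again.\<close>

lemma dual_conn_vanish1:
  assumes "vf U E" "E p = tzero" "vf U Y" "vf U Z"
  shows "DC E Y Z p = 0"
proof -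
  note t = vf_tangent[OF assms(3) U(2)] vf_tangent[OF assms(4) U(2)]
  have "g p (bracket E Y p) (Z p) = - g p (bracket Y E p) (Z p)"
    using g_minus(2)[OF t(2) bracket_tangent[OF U(1) assms(3,1) U(2)]] bracket_antisym[of E Y p] by simp
  moreover have "Y p (\<lambda>q. g q (Z q) (E q)) = g p (bracket Y E p) (Z p)"
    using derivative_vanishing_field[OF assms] g_fun_sym[OF U(1) assms(4,1) U(2) t(1)] by simp
  ultimately show ?thesis
    using derivative_vanishing_field[OF assms(1,2,4,3)] assms(2) g_zero(1)[OF bracket_tangent[OF U(1) assms(3,4) U(2)]]
    by (simp add: dual_conn_def)
qed

lemma dual_conn_vanish2:
  assumes "vf U E" "E p = tzero" "vf U Y" "vf U Z"
  shows "DC Y E Z p = Y p (\<lambda>q. g q (E q) (Z q))"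
  using dual_conn_torsion[OF assms(3,1,4)] dual_conn_vanish1[OF assms] derivative_vanishing_field[OF assms] by simp

lemma dual_conn_vanish3:
  assumes "vf U E" "E p = tzero" "vf U Y" "vf U Z"
  shows "DC Y Z E p = 0"
  using dual_conn_compat[OF assms(3,1,4)] dual_conn_vanish2[OF assms] by simp

lemma dual_conn_cong1:
  assumes "vf U X" "vf U X'" "X p = X' p" "vf U Y" "vf U Z"
  shows "DC X Y Z p = DC X' Y Z p"
  using dual_conn_vanish1[OF vf_comb[OF U(1) assms(1,2) smooth_const[of U 1] smooth_const[of U "-1"]] _ assms(4,5)]
    dual_conn_comb1[OF assms(1,2,4,5), of 1 "-1"] assms(3) by simp

lemma dual_conn_cong3:
  assumes "vf U X" "vf U X'" "X p = X' p" "vf U Y" "vf U Z"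
  shows "DC Y Z X p = DC Y Z X' p"
  using dual_conn_vanish3[OF vf_comb[OF U(1) assms(1,2) smooth_const[of U 1] smooth_const[of U "-1"]] _ assms(4,5)]
    dual_conn_comb3[OF assms(1,2,4,5), of 1 "-1"] assms(3) by simp

lemma dual_conn_diff2:
  assumes "vf U X" "vf U X'" "X p = X' p" "vf U Y" "vf U Z"
  shows "DC Y X Z p - DC Y X' Z p = Y p (\<lambda>q. g q (\<lambda>f. X q f - X' q f) (Z q))"
  using dual_conn_vanish2[OF vf_comb[OF U(1) assms(1,2) smooth_const[of U 1] smooth_const[of U "-1"]] _ assms(4,5)]
    dual_conn_comb2[OF assms(1,2,4,5), of 1 "-1"] assms(3) by simp

text \<open>The derivative left over in the second slot is the product of a bracket with
  \<open>Z p\<close>, which is zero for radical \<open>Z p\<close>. This is why II is well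
  defined.\<close>

lemma dual_conn_cong2_radical:
  assumes "vf U X" "vf U X'" "X p = X' p" "vf U Y" "vf U Z" "Z p \<in> Rad At g p"
  shows "DC Y X Z p = DC Y X' Z p"
proof -
  note v = vf_diff[OF U(1) assms(1,2)]
  have "Y p (\<lambda>q. g q (\<lambda>f. X q f - X' q f) (Z q)) = g p (bracket Y (\<lambda>q f. X q f - X' q f) p) (Z p)"
    by (rule derivative_vanishing_field[OF v _ assms(4,5)]) (use assms(3) in simp)
  also have "\<dots> = 0"
    using assms(6) bracket_tangent[OF U(1) assms(4) v U(2)] g_sym by (auto simp: Rad_def)
  finally show ?thesis using dual_conn_diff2[OF assms(1-5)] by simp
qed

lemma dual_conn_sum3:
  assumes "finite I" "\<And>i. i \<in> I \<Longrightarrow> vf U (Z i)" "vf U X" "vf U Y"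
  shows "DC X Y (\<lambda>q f. \<Sum>i\<in>I. c i * Z i q f) p = (\<Sum>i\<in>I. c i * DC X Y (Z i) p)"
  using assms(1,2)
proof (induction I)
  case empty
  then show ?case using dual_conn_vanish3[OF vf_zero _ assms(3,4)] by simp
next
  case (insert i I)
  have "vf U (\<lambda>q f. \<Sum>i\<in>I. c i * Z i q f)"
    using insert.prems by (intro vf_sum U smooth_const) auto
  with insert dual_conn_comb3[of "Z i" "\<lambda>q f. \<Sum>i\<in>I. c i * Z i q f" X Y "c i" 1] assms(3,4)
  show ?case by simp
qed

end

end

section \<open>The singular hypersurface\<close>

lemma det_eq_0_iff_kernel:
  fixes A :: "real^'n^'n" shows "det A = 0 \<longleftrightarrow> (\<exists>x. x \<noteq> 0 \<and> A *v x = 0)"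
  using matrix_left_invertible_ker[of A] invertible_det_nz[of A] invertible_left_inverse[of A] by metis

locale singular_space = metric_manifold At g
  for At :: "('a::t2_space, 'n::finite) atlas" and g :: "'a tensor2" +
  assumes transverse: "transverse_singular_space At g"
begin

lemma gram_det_smooth:
  assumes "(D, \<phi>) \<in> At" shows "smooth D (gram_det At g (D, \<phi>))"
  unfolding gram_det_def[abs_def]
  by (intro smooth_det chart(2)[OF assms]) (simp add: g_fun[OF chart(2)[OF assms] coord_vec_vf[OF assms] coord_vec_vf[OF assms]])

lemma gram_vector:
  assumes "(D, \<phi>) \<in> At" "p \<in> D" "v \<in> TM p" "w \<in> TM p"
  shows "g p w v = (\<Sum>k\<in>UNIV. v (\<lambda>q. \<phi> q $ k) * g p w (coord_vec At (D, \<phi>) k p))"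
proof -
  have "v = (\<lambda>f. \<Sum>k\<in>UNIV. v (\<lambda>q. \<phi> q $ k) * coord_vec At (D, \<phi>) k p f)"
    by (rule ext) (rule tangent_expansion[OF assms(1-3)])
  then have "g p w v = g p w (\<lambda>f. \<Sum>k\<in>UNIV. v (\<lambda>q. \<phi> q $ k) * coord_vec At (D, \<phi>) k p f)" by simp
  also have "\<dots> = (\<Sum>k\<in>UNIV. v (\<lambda>q. \<phi> q $ k) * g p w (coord_vec At (D, \<phi>) k p))"
    by (rule g_sum_right[OF assms(4) coord_vec_tangent[OF assms(1,2)]])
  finally show ?thesis .
qed

lemma radical_iff:
  assumes "(D, \<phi>) \<in> At" "p \<in> D" "v \<in> TM p"
  shows "v \<in> Rad At g p \<longleftrightarrow> (\<forall>k. g p v (coord_vec At (D, \<phi>) k p) = 0)"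
proof
  assume "v \<in> Rad At g p"
  then show "\<forall>k. g p v (coord_vec At (D, \<phi>) k p) = 0"
    using coord_vec_tangent[OF assms(1,2)] by (simp add: Rad_def)
next
  assume *: "\<forall>k. g p v (coord_vec At (D, \<phi>) k p) = 0"
  have "g p v w = 0" if "w \<in> TM p" for w
    unfolding gram_vector[OF assms(1,2) that assms(3)] using * by simp
  then show "v \<in> Rad At g p" using assms(3) by (simp add: Rad_def)
qed

text \<open>The coordinates of a radical vector form a kernel vector of the Gram matrix, and
  conversely.\<close>

lemma sing_iff:
  assumes "(D, \<phi>) \<in> At" "p \<in> D"
  shows "p \<in> Sg \<longleftrightarrow> gram_det At g (D, \<phi>) p = 0"
proof -
  let ?d = "\<lambda>i. coord_vec At (D, \<phi>) i p"
  let ?G = "(\<chi> a b. g p (?d a) (?d b)) :: real^'n^'n"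
  note t = coord_vec_tangent[OF assms]
  show ?thesis
  proof
    assume "p \<in> Sg"
    then obtain v where v: "v \<in> Rad At g p" "v \<noteq> tzero"
      using tangent_zero g_zero(2) by (auto simp: Sing_def Rad_def)
    then have vt: "v \<in> TM p" by (simp add: Rad_def)
    define x :: "real^'n" where "x = (\<chi> i. v (\<lambda>q. \<phi> q $ i))"
    have "x \<noteq> 0"
    proof
      assume "x = 0"
      then have "v (\<lambda>q. \<phi> q $ i) = 0" for i by (simp add: x_def vec_eq_iff)
      then have "v f = 0" for f using tangent_expansion[OF assms vt, of f] by simp
      with v(2) show False by auto
    qed
    moreover have "?G *v x = 0"
    proof (rule vec_eq_iff[THEN iffD2], rule allI)
      fix j
      have "(?G *v x) $ j = g p (?d j) v"
        unfolding gram_vector[OF assms vt t] by (simp add: matrix_vector_mult_def x_def mult.commute)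
      also have "\<dots> = 0" using v t g_sym[OF t vt] by (simp add: Rad_def)
      finally show "(?G *v x) $ j = 0 $ j" by simp
    qed
    ultimately show "gram_det At g (D, \<phi>) p = 0" using det_eq_0_iff_kernel by (auto simp: gram_det_def)
  next
    assume "gram_det At g (D, \<phi>) p = 0"
    then obtain x where x: "x \<noteq> 0" "?G *v x = 0" using det_eq_0_iff_kernel by (auto simp: gram_det_def)
    define v where "v = (\<lambda>f. \<Sum>i\<in>UNIV. x $ i * ?d i f)"
    have vt: "v \<in> TM p" unfolding v_def by (rule tangent_sum) (rule t)
    have "v (\<lambda>q. \<phi> q $ j) = x $ j" for j
      by (simp add: v_def coord_vec_coord[OF assms] if_distrib[of "\<lambda>y. _ * y"] cong: if_cong)
    then have "v \<noteq> tzero" using x(1) by (auto simp: vec_eq_iff fun_eq_iff) metis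
    moreover have "g p (?d j) v = 0" for j
    proof -
      have "g p (?d j) v = (?G *v x) $ j"
        unfolding v_def g_sum_right[OF t t] by (simp add: matrix_vector_mult_def mult.commute)
      then show ?thesis using x(2) by simp
    qed
    then have "v \<in> Rad At g p" unfolding radical_iff[OF assms vt] using g_sym[OF vt t] by simp
    ultimately show "p \<in> Sg" by (auto simp: Sing_def)
  qed
qed

lemma open_regular: "open (- Sg)"
  unfolding open_subopen[of "- Sg"]
proof
  fix p assume p: "p \<in> - Sg"
  obtain D \<phi> where D: "(D, \<phi>) \<in> At" "p \<in> D" by (rule ex_chart)
  let ?W = "D \<inter> gram_det At g (D, \<phi>) -` (- {0})"
  have "open ?W"
    by (rule continuous_open_preimage[OF smooth_continuous chart(2)])
       (use D gram_det_smooth chart(2) in auto)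
  moreover have "p \<in> ?W" "?W \<subseteq> - Sg" using p sing_iff[OF D(1)] D(2) by auto
  ultimately show "\<exists>T. open T \<and> p \<in> T \<and> T \<subseteq> - Sg" by blast
qed

lemma gram_det_derivative:
  assumes "(D, \<phi>) \<in> At" "p \<in> D" "p \<in> Sg"
  shows "D_at (gram_det At g (D, \<phi>) \<circ> inv_into D \<phi>) (\<phi> p) \<noteq> (\<lambda>v. 0)"
  using transverse chart(1)[OF assms(1)] assms(2,3) unfolding transverse_singular_space_def by blast

text \<open>If \<Sigma> contained an open set, the Gram determinant would vanish on it and have zero
  differential, against transversality. Density is what lets identities proved off \<Sigma> pass to
  \<Sigma>.\<close>

lemma sing_dense:
  assumes "p \<in> Sg" "open U" "p \<in> U" shows "\<exists>q\<in>U. q \<notin> Sg"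
proof (rule ccontr)
  assume "\<not> ?thesis"
  then have *: "U \<subseteq> Sg" by blast
  obtain D \<phi> where D: "(D, \<phi>) \<in> At" "p \<in> D" by (rule ex_chart)
  have "((gram_det At g (D, \<phi>) \<circ> inv_into D \<phi>) has_derivative (\<lambda>v. 0)) (at (\<phi> p))"
  proof (rule has_derivative_transform_within_open[of "\<lambda>x. 0" _ _ _ "\<phi> ` (D \<inter> U)"])
    show "0 = (gram_det At g (D, \<phi>) \<circ> inv_into D \<phi>) x" if x: "x \<in> \<phi> ` (D \<inter> U)" for x
    proof -
      obtain q where q: "q \<in> D" "q \<in> U" "x = \<phi> q" using x by blast
      then show ?thesis using inv_into_f_f[OF chart(6)[OF D(1)] q(1)] sing_iff[OF D(1) q(1)] * by auto
    qed
  qed (use chart_open_image[OF D(1) assms(2)] D assms in auto)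
  from frechet_derivative_at[OF this] gram_det_derivative[OF D assms(1)] show False by metis
qed

lemma continuous_eq_sing:
  assumes "open U" "continuous_on U f" "continuous_on U h" "\<And>q. q \<in> U - Sg \<Longrightarrow> f q = h q" "p \<in> U"
  shows "f p = (h p :: real)"
proof (rule ccontr)
  assume n: "f p \<noteq> h p"
  let ?W = "U \<inter> (\<lambda>q. f q - h q) -` (- {0})"
  have "open ?W"
    by (rule continuous_open_preimage) (use assms in \<open>auto intro!: continuous_intros\<close>)
  moreover have "p \<in> ?W" using n assms(5) by auto
  moreover have "p \<in> Sg" using n assms(4,5) by auto
  ultimately obtain q where "q \<in> ?W" "q \<notin> Sg" using sing_dense by meson
  then show False using assms(4) by auto
qed

lemma smooth_eq_sing:
  assumes "open U" "smooth U f" "smooth U h" "\<And>q. q \<in> U - Sg \<Longrightarrow> f q = h q" "p \<in> U"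
  shows "f p = h p"
  using continuous_eq_sing[OF assms(1) smooth_continuous smooth_continuous] assms by blast

lemma sing_division:
  assumes "(D, \<phi>) \<in> At" "open U" "p \<in> U" "U \<subseteq> D" "p \<in> Sg"
  obtains V where "open V" "p \<in> V" "V \<subseteq> U"
    "\<And>f. smooth V f \<Longrightarrow> (\<And>q. q \<in> V \<Longrightarrow> q \<in> Sg \<Longrightarrow> f q = 0) \<Longrightarrow>
       \<exists>h. smooth V h \<and> (\<forall>q\<in>V. f q = gram_det At g (D, \<phi>) q * h q)"
proof -
  have pD: "p \<in> D" using assms by auto
  obtain V where "open V" "p \<in> V" "V \<subseteq> U" and V:
    "\<And>f. smooth V f \<Longrightarrow> (\<And>q. q \<in> V \<Longrightarrow> gram_det At g (D, \<phi>) q = 0 \<Longrightarrow> f q = 0) \<Longrightarrow>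
       \<exists>h. smooth V h \<and> (\<forall>q\<in>V. f q = gram_det At g (D, \<phi>) q * h q)"
    using division_in_chart[OF assms(1-4) smooth_subset[OF gram_det_smooth[OF assms(1)] assms(4)]
        sing_iff[OF assms(1) pD, THEN iffD1, OF assms(5)] gram_det_derivative[OF assms(1) pD assms(5)]] by metis
  moreover have "q \<in> Sg \<longleftrightarrow> gram_det At g (D, \<phi>) q = 0" if "q \<in> V" for q
    using sing_iff[OF assms(1)] that \<open>V \<subseteq> U\<close> assms(4) by blast
  ultimately show ?thesis using that by metis
qed

section \<open>Independence of the extensions used along the hypersurface\<close>

lemma local_ext:
  assumes "along S A" "p \<in> S"
  obtains U where "open U" "p \<in> U" "extends S A U (local_ext At S A p)"
proof -
  have "\<exists>AA U. open U \<and> p \<in> U \<and> extends S A U AA" using assms unfolding vf_along_def by blast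
  then have "\<exists>U. open U \<and> p \<in> U \<and> extends S A U (local_ext At S A p)"
    unfolding local_ext_def by (rule someI_ex)
  with that show ?thesis by blast
qed

lemma local_ext_common:
  assumes "along S X" "along S Y" "along S Z" "p \<in> S" "open U" "p \<in> U"
  obtains V where "open V" "p \<in> V" "V \<subseteq> U" "extends S X V (local_ext At S X p)"
    "extends S Y V (local_ext At S Y p)" "extends S Z V (local_ext At S Z p)"
proof -
  obtain U1 where 1: "open U1" "p \<in> U1" "extends S X U1 (local_ext At S X p)" by (rule local_ext[OF assms(1,4)])
  obtain U2 where 2: "open U2" "p \<in> U2" "extends S Y U2 (local_ext At S Y p)" by (rule local_ext[OF assms(2,4)])
  obtain U3 where 3: "open U3" "p \<in> U3" "extends S Z U3 (local_ext At S Z p)" by (rule local_ext[OF assms(3,4)])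
  have r: "U1 \<inter> U2 \<inter> U3 \<inter> U \<subseteq> U1" "U1 \<inter> U2 \<inter> U3 \<inter> U \<subseteq> U2" "U1 \<inter> U2 \<inter> U3 \<inter> U \<subseteq> U3" by auto
  show thesis
    by (rule that[OF _ _ _ vf_extends_restrict[OF 1(3) r(1)] vf_extends_restrict[OF 2(3) r(2)]
          vf_extends_restrict[OF 3(3) r(3)]]) (use 1(1,2) 2(1,2) 3(1,2) assms(5,6) in auto)
qed

text \<open>The extensions picked by \<open>SOME\<close> are exchanged slot by slot; the middle slot
  is where the radical value of \<open>Z\<close> enters.\<close>

lemma dual_conn_along_radical:
  assumes al: "along S X" "along S Y" "along S Z" "p \<in> S"
    and U: "open U" "p \<in> U" and s: "vf U XX" "vf U YY" "vf U ZZ"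
    and eq: "XX p = X p" "YY p = Y p" "ZZ p = Z p" "Z p \<in> Rad At g p"
  shows "dual_conn_along At g S X Y Z p = DC XX YY ZZ p"
proof -
  let ?X = "local_ext At S X p" and ?Y = "local_ext At S Y p" and ?Z = "local_ext At S Z p"
  obtain V where V: "open V" "p \<in> V" "V \<subseteq> U"
    and e: "extends S X V ?X" "extends S Y V ?Y" "extends S Z V ?Z"
    by (rule local_ext_common[OF al U])
  have t: "vf V ?X" "vf V ?Y" "vf V ?Z" "?X p = X p" "?Y p = Y p" "?Z p = Z p"
    using e al(4) V(2) by (auto simp: vf_extends_def)
  note s' = vf_subset[OF s(1) V(3)] vf_subset[OF s(2) V(3)] vf_subset[OF s(3) V(3)]
  have "DC ?X ?Y ?Z p = DC XX ?Y ?Z p"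
    by (rule dual_conn_cong1[OF V(1,2) t(1) s'(1) _ t(2,3)]) (simp add: t eq)
  also have "\<dots> = DC XX YY ?Z p"
    by (rule dual_conn_cong2_radical[OF V(1,2) t(2) s'(2) _ s'(1) t(3)]) (simp_all add: t eq)
  also have "\<dots> = DC XX YY ZZ p"
    by (rule dual_conn_cong3[OF V(1,2) t(3) s'(3) _ s'(1,2)]) (simp add: t eq)
  finally show ?thesis by (simp add: dual_conn_along_def)
qed

text \<open>Changing the middle extension leaves the derivative along \<open>X p\<close> of a
  function vanishing on \<Sigma>, which is zero by tangency. Hence \<open>YY\<close> has to match
  \<open>Y\<close> on \<open>S\<close> near \<open>p\<close>, not just at \<open>p\<close>, and
  \<open>G\<close> ensures that \<open>S\<close> contains all of \<Sigma> near
  \<open>p\<close>.\<close>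

lemma dual_conn_along_tangent:
  assumes al: "along S X" "along S Y" "along S Z" "p \<in> S"
    and U: "open U" "p \<in> U" and s: "vf U XX" "vf U YY" "vf U ZZ"
    and eq: "XX p = X p" "ZZ p = Z p" and X: "X p \<in> TSg p"
    and G: "open G" "p \<in> G" "Sg \<inter> G \<subseteq> S" and YY: "\<And>q. q \<in> S \<inter> U \<Longrightarrow> YY q = Y q"
  shows "dual_conn_along At g S X Y Z p = DC XX YY ZZ p"
proof -
  let ?X = "local_ext At S X p" and ?Y = "local_ext At S Y p" and ?Z = "local_ext At S Z p"
  obtain V where V: "open V" "p \<in> V" "V \<subseteq> U \<inter> G"
    and e: "extends S X V ?X" "extends S Y V ?Y" "extends S Z V ?Z"
    by (rule local_ext_common[OF al, of "U \<inter> G"]) (use U G in auto)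
  have VU: "V \<subseteq> U" using V(3) by auto
  have t: "vf V ?X" "vf V ?Y" "vf V ?Z" "?X p = X p" "?Z p = Z p"
    and Yq: "\<And>q. q \<in> S \<inter> V \<Longrightarrow> ?Y q = YY q"
    using e al(4) V(2) VU YY by (auto simp: vf_extends_def)
  note s' = vf_subset[OF s(1) VU] vf_subset[OF s(2) VU] vf_subset[OF s(3) VU]
  have "DC ?X ?Y ?Z p = DC XX ?Y ?Z p"
    by (rule dual_conn_cong1[OF V(1,2) t(1) s'(1) _ t(2,3)]) (simp add: t eq)
  also have "\<dots> = DC XX YY ?Z p"
  proof -
    have "g q (\<lambda>f. ?Y q f - YY q f) (?Z q) = 0" if "q \<in> Sg \<inter> V" for q
      using Yq[of q] g_zero(2)[OF vf_tangent[OF t(3)]] that G(3) V(3) by auto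
    then have "XX p (\<lambda>q. g q (\<lambda>f. ?Y q f - YY q f) (?Z q)) = 0"
      using eq(1) X V(1,2) g_fun[OF V(1) vf_diff[OF V(1) t(2) s'(2)] t(3)]
      unfolding tangent_Sing_def by auto
    moreover have "DC XX ?Y ?Z p - DC XX YY ?Z p = XX p (\<lambda>q. g q (\<lambda>f. ?Y q f - YY q f) (?Z q))"
      by (rule dual_conn_diff2[OF V(1,2) t(2) s'(2) _ s'(1) t(3)]) (use Yq al(4) V(2) in auto)
    ultimately show ?thesis by simp
  qed
  also have "\<dots> = DC XX YY ZZ p"
    by (rule dual_conn_cong3[OF V(1,2) t(3) s'(3) _ s'(1,2)]) (simp add: t eq)
  finally show ?thesis by (simp add: dual_conn_along_def)
qed

lemma vf_extends_along: "open U \<Longrightarrow> S \<subseteq> U \<Longrightarrow> extends S A U AA \<Longrightarrow> along S A"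
  unfolding vf_along_def by blast

end

section \<open>The Levi-Civita connection and its curvature off the hypersurface\<close>

locale singular_connection = singular_space At g
  for At :: "('a::t2_space, 'n::finite) atlas" and g :: "'a tensor2" +
  fixes nabla :: "'a vfield \<Rightarrow> 'a vfield \<Rightarrow> 'a vfield"
  assumes levi_civita: "levi_civita At g (- Sg) nabla"
begin

abbreviation "Riem \<equiv> curvature At nabla"

lemma nabla:
  assumes "open U" "U \<subseteq> - Sg" "vf U X" "vf U Y"
  shows "vf U (nabla X Y)"
    and "p \<in> U \<Longrightarrow> (\<lambda>f. nabla X Y p f - nabla Y X p f) = bracket X Y p"
    and "p \<in> U \<Longrightarrow> vf U Z \<Longrightarrow> X p (\<lambda>q. g q (Y q) (Z q)) = g p (nabla X Y p) (Z p) + g p (Y p) (nabla X Z p)"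
proof -
  note * = levi_civita[unfolded levi_civita_def, THEN spec[where x = U], THEN spec[where x = X], THEN spec[where x = Y]]
  have **: "vf U (nabla X Y) \<and> (\<forall>p\<in>U. (\<lambda>f. nabla X Y p f - nabla Y X p f) = bracket X Y p) \<and>
     (\<forall>p\<in>U. X p (\<lambda>q. g q (Y q) (Z q)) = g p (nabla X Y p) (Z p) + g p (Y p) (nabla X Z p))"
    if "vf U Z" for Z
    using *[THEN spec[where x = Z], THEN mp, OF conjI[OF assms(1) conjI[OF assms(2) conjI[OF assms(3) conjI[OF assms(4) that]]]]]
    by blast
  from **[OF assms(4)] show "vf U (nabla X Y)"
    "p \<in> U \<Longrightarrow> (\<lambda>f. nabla X Y p f - nabla Y X p f) = bracket X Y p" by blast+
  show "p \<in> U \<Longrightarrow> vf U Z \<Longrightarrow> X p (\<lambda>q. g q (Y q) (Z q)) = g p (nabla X Y p) (Z p) + g p (Y p) (nabla X Z p)"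
    using **[of Z] by blast
qed

text \<open>Compatibility and vanishing torsion are substituted into the Koszul expression. The left
  side is smooth across \<Sigma>, while \<open>nabla\<close> is given only off \<Sigma>.\<close>

lemma koszul:
  assumes "open U" "U \<subseteq> - Sg" "vf U X" "vf U Y" "vf U Z" "p \<in> U"
  shows "DC X Y Z p = g p (nabla X Y p) (Z p)"
proof -
  note n = nabla(1)[OF assms(1,2)] and c = nabla(3)[OF assms(1,2) _ _ assms(6)]
  note t = vf_tangent[OF assms(3,6)] vf_tangent[OF assms(4,6)] vf_tangent[OF assms(5,6)]
  note nt = vf_tangent[OF n assms(6)]
  have b: "g p (bracket X Y p) (Z p) = g p (nabla X Y p) (Z p) - g p (nabla Y X p) (Z p)"
    if "vf U X" "vf U Y" "vf U Z" for X Y Z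
    unfolding nabla(2)[OF assms(1,2) that(1,2) assms(6), symmetric]
    by (rule g_diff(2)[OF vf_tangent[OF that(3) assms(6)] nt[OF that(1,2)] nt[OF that(2,1)]])
  have s: "g p (Y p) (nabla X Z p) = g p (nabla X Z p) (Y p)"
    if "vf U X" "vf U Y" "vf U Z" for X Y Z
    by (rule g_sym[OF vf_tangent[OF that(2) assms(6)] nt[OF that(1,3)]])
  note v = assms(3,4,5)
  show ?thesis unfolding dual_conn_def
    using c[OF v(1,2,3)] c[OF v(2,3,1)] c[OF v(3,1,2)] b[OF v(1,2,3)] b[OF v(2,3,1)] b[OF v(3,1,2)]
      s[OF v(1,2,3)] s[OF v(2,3,1)] s[OF v(3,1,2)]
    by simp
qed

lemma curvature_vf:
  assumes "open U" "U \<subseteq> - Sg" "vf U A" "vf U B" "vf U C"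
  shows "vf U (Riem A B C)"
  unfolding curvature_def[abs_def]
  by (intro vf_diff nabla(1) vf_bracket assms)

text \<open>Compatibility gives \<open><nabla A (nabla B C), D> = A <nabla B C, D> - <nabla B C,
  nabla A D>\<close>. The terms written with the dual connection are smooth across \<Sigma>; the two
  products of covariant derivatives are the part that can blow up there.\<close>

lemma curvature_formula:
  assumes "open U" "vf U A" "vf U B" "vf U C" "vf U D" "p \<in> U - Sg"
  shows "g p (Riem A B C p) (D p) =
    A p (DC B C D) - B p (DC A C D) - DC (bracket A B) C D p
    + g p (nabla A C p) (nabla B D p) - g p (nabla B C p) (nabla A D p)"
proof -
  define V where "V = U - Sg"
  have V: "open V" "V \<subseteq> - Sg" "V \<subseteq> U" "p \<in> V"
    using open_Int[OF assms(1) open_regular] assms(6) by (auto simp: V_def Diff_eq)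
  note s = vf_subset[OF assms(2) V(3)] vf_subset[OF assms(3) V(3)] vf_subset[OF assms(4) V(3)] vf_subset[OF assms(5) V(3)]
  note n = nabla(1)[OF V(1,2)] and b = vf_bracket[OF V(1) s(1,2)]
  note t = vf_tangent[OF _ V(4)]
  have D: "X p (DC Y C D) = g p (nabla X (nabla Y C) p) (D p) + g p (nabla Y C p) (nabla X D p)"
    if "vf V X" "vf V Y" for X Y
  proof -
    have "X p (DC Y C D) = X p (\<lambda>q. g q (nabla Y C q) (D q))"
      by (rule tangent_cong[OF t[OF that(1)] V(1,4)]) (rule koszul[OF V(1,2) that(2) s(3,4)])
    then show ?thesis using nabla(3)[OF V(1,2) that(1) n[OF that(2) s(3)] V(4) s(4)] by simp
  qed
  note nn = n[OF s(1) n[OF s(2,3)]] n[OF s(2) n[OF s(1,3)]] n[OF b s(3)]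
  have "g p (Riem A B C p) (D p) =
     g p (nabla A (nabla B C) p) (D p) - g p (nabla B (nabla A C) p) (D p) - g p (nabla (bracket A B) C p) (D p)"
    unfolding curvature_def
    using g_diff(2)[OF t[OF s(4)] t[OF vf_diff[OF V(1) nn(1,2)]] t[OF nn(3)]] g_diff(2)[OF t[OF s(4)] t[OF nn(1)] t[OF nn(2)]]
    by simp
  then show ?thesis
    unfolding D[OF s(1,2)] D[OF s(2,1)] koszul[OF V(1,2) b s(3,4) V(4)] by simp
qed

lemma common_extension:
  assumes "along (Sg) A" "along (Sg) B" "along (Sg) C" "along (Sg) E"
    and "p \<in> Sg" "open U" "p \<in> U"
  obtains V AA BB CC EE where "open V" "p \<in> V" "V \<subseteq> U" "extends (Sg) A V AA"
    "extends (Sg) B V BB" "extends (Sg) C V CC" "extends (Sg) E V EE"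
proof -
  have ex: "\<exists>V AA. open V \<and> p \<in> V \<and> extends (Sg) A V AA" if "along (Sg) A" for A
    using that assms(5) unfolding vf_along_def by fast
  obtain V1 AA where 1: "open V1" "p \<in> V1" "extends (Sg) A V1 AA" using ex[OF assms(1)] by fast
  obtain V2 BB where 2: "open V2" "p \<in> V2" "extends (Sg) B V2 BB" using ex[OF assms(2)] by fast
  obtain V3 CC where 3: "open V3" "p \<in> V3" "extends (Sg) C V3 CC" using ex[OF assms(3)] by fast
  obtain V4 EE where 4: "open V4" "p \<in> V4" "extends (Sg) E V4 EE" using ex[OF assms(4)] by fast
  have r: "extends (Sg) X (V1 \<inter> V2 \<inter> V3 \<inter> V4 \<inter> U) XX"
    if "extends (Sg) X V' XX" "V1 \<inter> V2 \<inter> V3 \<inter> V4 \<inter> U \<subseteq> V'" for X XX V'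
    using that vf_subset[of V' XX] unfolding vf_extends_def by auto
  show thesis
    by (rule that[of "V1 \<inter> V2 \<inter> V3 \<inter> V4 \<inter> U" AA BB CC EE])
       (use 1 2 3 4 assms(6,7) in \<open>auto intro: r\<close>)
qed

text \<open>A relation free of canonical data: boundary values obtained in patches with different N
  and R become comparable, and uniqueness can be shown in any one patch.\<close>

definition curvature_limit :: "'a vfield \<Rightarrow> 'a vfield \<Rightarrow> 'a vfield \<Rightarrow> 'a vfield \<Rightarrow> 'a \<Rightarrow> real \<Rightarrow> bool" where
  "curvature_limit A B C E p y \<longleftrightarrow> (\<exists>V AA BB CC EE h. open V \<and> p \<in> V \<and>
     extends (Sg) A V AA \<and> extends (Sg) B V BB \<and>
     extends (Sg) C V CC \<and> extends (Sg) E V EE \<and> smooth V h \<and>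
     (\<forall>q\<in>V - Sg. h q = g q (Riem AA BB CC q) (EE q)) \<and> h p = y)"

end

section \<open>The main normal and the main radical field\<close>

locale canonical = singular_connection At g nabla
  for At :: "('a::t2_space, 'n::finite) atlas" and g :: "'a tensor2"
    and nabla :: "'a vfield \<Rightarrow> 'a vfield \<Rightarrow> 'a vfield" +
  fixes W :: "'a set" and N R NN RR :: "'a vfield" and Ups :: "'a tensor4"
  assumes canonical: "canonical_data At g nabla W N R NN RR Ups"
begin

abbreviation "S \<equiv> Sg \<inter> W"

definition tau :: "'a \<Rightarrow> real" where "tau q = g q (RR q) (RR q)"

lemma W: "open W" using canonical by (simp add: canonical_data_def)

lemma NN: "vf W NN" "q \<in> S \<Longrightarrow> NN q = N q"
  and RR: "vf W RR" "q \<in> S \<Longrightarrow> RR q = R q"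
  using canonical by (auto simp: canonical_data_def vf_extends_def)

lemma main_normal: "main_normal At g S N" and main_radical: "main_radical At g S N R"
  using canonical by (auto simp: canonical_data_def)

lemma N_along: "along S N" and R_along: "along S R"
  using main_normal main_radical by (auto simp: main_normal_def main_radical_def radical_vf_along_def)

lemma RR_radical: "q \<in> S \<Longrightarrow> RR q \<in> Rad At g q"
  using main_radical RR(2) by (simp add: main_radical_def radical_vf_along_def)

lemma RR_tangent: "q \<in> S \<Longrightarrow> RR q \<in> TSg q"
  using main_radical RR(2) by (simp add: main_radical_def tangent_vf_along_def)

lemma g_radical: "q \<in> S \<Longrightarrow> v \<in> TM q \<Longrightarrow> g q (RR q) v = 0" "q \<in> S \<Longrightarrow> v \<in> TM q \<Longrightarrow> g q v (RR q) = 0"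
  using RR_radical[of q] g_sym by (auto simp: Rad_def)

lemma tau_smooth: "smooth W tau"
  unfolding tau_def[abs_def] by (rule g_fun[OF W RR(1) RR(1)])

lemma tau_zero: "q \<in> S \<Longrightarrow> tau q = 0"
  unfolding tau_def using g_radical vf_tangent[OF RR(1)] by simp

lemma tangent_SingD:
  assumes "v \<in> TSg p" "open U" "p \<in> U" "smooth U f" "\<And>q. q \<in> Sg \<Longrightarrow> q \<in> U \<Longrightarrow> f q = 0"
  shows "v f = 0"
  using assms unfolding tangent_Sing_def by blast

lemma NN_NN: "q \<in> S \<Longrightarrow> g q (NN q) (NN q) = 1"
  and NN_normal: "q \<in> S \<Longrightarrow> v \<in> TSg q \<Longrightarrow> g q (NN q) v = 0"
  using main_normal NN(2) by (auto simp: main_normal_def)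

lemma H_RR:
  assumes "p \<in> S" shows "DC RR RR NN p = -1"
proof -
  have "second_fundamental_form At g S N R R p = DC RR RR NN p"
    unfolding second_fundamental_form_def
    by (rule dual_conn_along_tangent[OF R_along R_along N_along assms W _ RR(1) RR(1) NN(1)])
       (use assms RR NN W RR_tangent in \<open>auto simp: RR(2)[symmetric]\<close>)
  then show ?thesis using main_radical assms by (simp add: main_radical_def)
qed

context
  fixes p assumes p: "p \<in> S"
begin

lemma pW: "p \<in> W" and pS: "p \<in> Sg" using p by auto

lemma bracket_radical: "vf U X \<Longrightarrow> vf U Y \<Longrightarrow> open U \<Longrightarrow> p \<in> U \<Longrightarrow> g p (bracket X Y p) (RR p) = 0"
  using g_radical(2)[OF p bracket_tangent] .

text \<open>The function <R,N> vanishes on \<Sigma> and R is tangent to \<Sigma>, so compatibility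
  yields II(R,N) = -H(R,R). With the symmetry of II and II(N,R) = N(\<tau>)/2 this is the source of
  the constant in \<open>NN_tau\<close>.\<close>

lemma II_RN: "DC RR NN RR p = 1"
proof -
  have "RR p (\<lambda>q. g q (RR q) (NN q)) = 0"
    by (rule tangent_SingD[OF RR_tangent[OF p] W pW g_fun[OF W RR(1) NN(1)]])
       (use g_radical(1) vf_tangent[OF NN(1)] in auto)
  then show ?thesis using dual_conn_compat[OF W pW RR(1) RR(1) NN(1)] H_RR[OF p] by simp
qed

lemma II_NR: "DC NN RR RR p = 1"
  using dual_conn_torsion[OF W pW RR(1) NN(1) RR(1)] bracket_radical[OF RR(1) NN(1) W pW] II_RN by simp

lemma II_X_R:
  assumes "vf W X" shows "DC X RR RR p = X p tau / 2"
  using dual_conn_compat[OF W pW assms RR(1) RR(1)] by (simp add: tau_def[abs_def])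

lemma NN_tau: "NN p tau = 2" using II_X_R[OF NN(1)] II_NR by simp

lemma II_NN: "DC NN NN RR p = 0"
proof -
  have "second_II At g S R N N p = DC NN NN RR p"
    unfolding second_II_def
    by (rule dual_conn_along_radical[OF N_along N_along R_along p W pW NN(1) NN(1) RR(1)])
       (use p NN RR RR_radical[OF p] in auto)
  moreover have "radical_vf_along At g S R" using main_radical by (simp add: main_radical_def)
  ultimately show ?thesis using main_normal p by (simp add: main_normal_def)
qed

text \<open>Write \<tau> = \<delta>\<kappa> with \<delta> the Gram determinant. As \<delta> vanishes
  at \<open>p\<close>, the product rule gives N(\<tau>) = \<kappa>(p) N(\<delta>), and N(\<tau>) = 2
  forces \<kappa>(p) to be nonzero: near \<open>p\<close>, dividing by \<tau> is as good as dividing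
  by \<delta>.\<close>

lemma tau_division:
  assumes "(D, \<phi>) \<in> At" "p \<in> D" "open U" "p \<in> U"
  obtains V \<kappa> where "open V" "p \<in> V" "V \<subseteq> U" "V \<subseteq> W" "V \<subseteq> D" "smooth V \<kappa>"
    "\<And>q. q \<in> V \<Longrightarrow> tau q = gram_det At g (D, \<phi>) q * \<kappa> q" "\<And>q. q \<in> V \<Longrightarrow> \<kappa> q \<noteq> 0"
    "\<And>f. smooth V f \<Longrightarrow> (\<And>q. q \<in> V \<Longrightarrow> q \<in> Sg \<Longrightarrow> f q = 0) \<Longrightarrow>
       \<exists>h. smooth V h \<and> (\<forall>q\<in>V. f q = tau q * h q)"
proof -
  let ?\<delta> = "gram_det At g (D, \<phi>)"
  define U0 where "U0 = U \<inter> W \<inter> D"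
  have U0: "open U0" "p \<in> U0" "U0 \<subseteq> D" "U0 \<subseteq> W" "U0 \<subseteq> U"
    using assms W pW chart(2)[OF assms(1)] by (auto simp: U0_def)
  obtain V0 where V0: "open V0" "p \<in> V0" "V0 \<subseteq> U0" and div0:
    "\<And>f. smooth V0 f \<Longrightarrow> (\<And>q. q \<in> V0 \<Longrightarrow> q \<in> Sg \<Longrightarrow> f q = 0) \<Longrightarrow>
       \<exists>h. smooth V0 h \<and> (\<forall>q\<in>V0. f q = ?\<delta> q * h q)"
    by (rule sing_division[OF assms(1) U0(1-3) pS]) blast
  have V0W: "V0 \<subseteq> W" and V0D: "V0 \<subseteq> D" using V0(3) U0 by auto
  have s\<delta>: "smooth V0 ?\<delta>" using smooth_subset[OF gram_det_smooth[OF assms(1)] V0D] .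
  obtain \<kappa> where \<kappa>: "smooth V0 \<kappa>" "\<And>q. q \<in> V0 \<Longrightarrow> tau q = ?\<delta> q * \<kappa> q"
    using div0[OF smooth_subset[OF tau_smooth V0W]] tau_zero V0W by blast
  have Nt: "NN p \<in> TM p" by (rule vf_tangent[OF NN(1) pW])
  have "NN p tau = NN p (\<lambda>q. ?\<delta> q * \<kappa> q)" by (rule tangent_cong[OF Nt V0(1,2) \<kappa>(2)])
  also have "\<dots> = ?\<delta> p * NN p \<kappa> + \<kappa> p * NN p ?\<delta>"
    by (rule tangent_mult[OF Nt smooth_near_fun[OF V0(1,2) s\<delta>] smooth_near_fun[OF V0(1,2) \<kappa>(1)]])
  finally have "\<kappa> p \<noteq> 0" using NN_tau sing_iff[OF assms(1,2)] pS by auto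
  define V1 where "V1 = V0 \<inter> \<kappa> -` (- {0})"
  have V1: "open V1" "p \<in> V1" "V1 \<subseteq> D" "V1 \<subseteq> V0"
    using continuous_open_preimage[OF smooth_continuous[OF V0(1) \<kappa>(1)] V0(1), of "- {0}"] V0 V0D \<open>\<kappa> p \<noteq> 0\<close>
    by (auto simp: V1_def)
  \<comment> \<open>The division property does not pass to smaller sets, since it concerns functions
    defined only there; so it is obtained afresh inside the set where \<kappa> has no zeros.\<close>
  obtain V where V: "open V" "p \<in> V" "V \<subseteq> V1" and div:
    "\<And>f. smooth V f \<Longrightarrow> (\<And>q. q \<in> V \<Longrightarrow> q \<in> Sg \<Longrightarrow> f q = 0) \<Longrightarrow>
       \<exists>h. smooth V h \<and> (\<forall>q\<in>V. f q = ?\<delta> q * h q)"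
    by (rule sing_division[OF assms(1) V1(1-3) pS]) blast
  have \<kappa>0: "\<kappa> q \<noteq> 0" if "q \<in> V" for q using that V(3) by (auto simp: V1_def)
  have V0V: "V \<subseteq> V0" using V(3) V1(4) by blast
  have s\<kappa>: "smooth V \<kappa>" using smooth_subset[OF \<kappa>(1) V0V] .
  show thesis
  proof (rule that[OF V(1,2)])
    fix f assume "smooth V f" "\<And>q. q \<in> V \<Longrightarrow> q \<in> Sg \<Longrightarrow> f q = 0"
    then obtain h where h: "smooth V h" "\<And>q. q \<in> V \<Longrightarrow> f q = ?\<delta> q * h q" using div by blast
    have "smooth V (\<lambda>q. h q * inverse (\<kappa> q))"
      by (intro smooth_mult smooth_inverse V(1) h(1) s\<kappa> \<kappa>0)
    moreover have "f q = tau q * (h q * inverse (\<kappa> q))" if "q \<in> V" for q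
      using h(2)[OF that] \<kappa>(2)[of q] \<kappa>0[OF that] V0V that by (auto simp: field_simps)
    ultimately show "\<exists>h. smooth V h \<and> (\<forall>q\<in>V. f q = tau q * h q)" by blast
  qed (use V0V V0W V0D V0 U0 s\<kappa> \<kappa>(2) \<kappa>0 in auto)
qed

text \<open>A function vanishing on \<Sigma> is \<tau>h near \<open>p\<close>, and its derivative at
  \<open>p\<close> is \<open>h p\<close> times that of \<tau>.\<close>

lemma tangent_Sing_iff:
  assumes v: "v \<in> TM p" shows "v \<in> TSg p \<longleftrightarrow> v tau = 0"
proof
  assume "v \<in> TSg p"
  then show "v tau = 0" by (rule tangent_SingD[OF _ W pW tau_smooth]) (use tau_zero in auto)
next
  assume 0: "v tau = 0"
  have "v f = 0" if U: "open U" "p \<in> U" "smooth U f" and f: "\<forall>q\<in>Sg \<inter> U. f q = 0" for U f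
  proof -
    obtain D \<phi> where D: "(D, \<phi>) \<in> At" "p \<in> D" by (rule ex_chart)
    obtain V where V: "open V" "p \<in> V" "V \<subseteq> U" "V \<subseteq> W" and div:
      "\<And>f. smooth V f \<Longrightarrow> (\<And>q. q \<in> V \<Longrightarrow> q \<in> Sg \<Longrightarrow> f q = 0) \<Longrightarrow>
       \<exists>h. smooth V h \<and> (\<forall>q\<in>V. f q = tau q * h q)"
      by (rule tau_division[OF D U(1,2)]) blast
    obtain h where h: "smooth V h" "\<And>q. q \<in> V \<Longrightarrow> f q = tau q * h q"
      using div[OF smooth_subset[OF U(3) V(3)]] f V(3) by blast
    have "v f = v (\<lambda>q. tau q * h q)" by (rule tangent_cong[OF v V(1,2) h(2)])
    also have "\<dots> = tau p * v h + h p * v tau"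
      by (rule tangent_mult[OF v smooth_near_fun[OF W pW tau_smooth] smooth_near_fun[OF V(1,2) h(1)]])
    finally show ?thesis using 0 tau_zero[OF p] by simp
  qed
  then show "v \<in> TSg p" using v unfolding tangent_Sing_def by blast
qed

text \<open>Subtracting \<open>v tau / 2\<close> times N leaves a vector that kills \<tau>, because
  N(\<tau>) = 2; it is tangent to \<Sigma>, hence orthogonal to N.\<close>

lemma normal_component:
  assumes v: "v \<in> TM p" shows "g p v (NN p) = v tau / 2"
proof -
  define w where "w = (\<lambda>f. 1 * v f + (- v tau / 2) * NN p f)"
  have Nt: "NN p \<in> TM p" by (rule vf_tangent[OF NN(1) pW])
  have w: "w \<in> TM p" unfolding w_def by (rule tangent_comb[OF v Nt])
  have "w tau = 0" by (simp add: w_def NN_tau)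
  then have "w \<in> TSg p" by (simp add: tangent_Sing_iff[OF w])
  then have "g p (NN p) w = 0" by (rule NN_normal[OF p])
  then show ?thesis
    unfolding w_def g_comb_right[OF Nt v Nt] NN_NN[OF p] g_sym[OF v Nt] by simp
qed

text \<open>If R vanished at \<open>p\<close>, so would II(R,N), by tensoriality in the first slot;
  but it is 1.\<close>

lemma RR_nonzero: "RR p \<noteq> tzero"
  using dual_conn_vanish1[OF W pW RR(1) _ NN(1) RR(1)] II_RN by auto

text \<open>If the radical were larger, two rows of the Gram matrix could be replaced, at the cost of nonzero
  constant factors (Cramer's rule), by rows vanishing at \<open>p\<close>; its determinant would have zero
  derivative.\<close>

lemma radical_line:
  assumes "v \<in> Rad At g p" shows "\<exists>c. v = (\<lambda>f. c * RR p f)"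
proof -
  obtain D \<phi> where D: "(D, \<phi>) \<in> At" "p \<in> D" by (rule ex_chart)
  let ?d = "\<lambda>i. coord_vec At (D, \<phi>) i" and ?\<delta> = "gram_det At g (D, \<phi>)"
  obtain V \<kappa> where V: "open V" "p \<in> V" "V \<subseteq> W" "V \<subseteq> D" "smooth V \<kappa>"
    "\<And>q. q \<in> V \<Longrightarrow> tau q = ?\<delta> q * \<kappa> q"
    by (rule tau_division[OF D open_UNIV]) auto
  note td = coord_vec_tangent[OF D] and sd = vf_subset[OF coord_vec_vf[OF D(1)] V(4)]
  have vt: "v \<in> TM p" using assms by (simp add: Rad_def)
  have Rt: "RR p \<in> TM p" by (rule vf_tangent[OF RR(1) pW])
  define r where "r k = RR p (\<lambda>q. \<phi> q $ k)" for k
  have exp: "w = (\<lambda>f. \<Sum>k\<in>UNIV. w (\<lambda>q. \<phi> q $ k) * ?d k p f)" if "w \<in> TM p" for w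
    by (rule ext) (rule tangent_expansion[OF D that])
  obtain i where i: "r i \<noteq> 0"
  proof (rule ccontr)
    assume "\<not> thesis"
    then have "r k = 0" for k using that by blast
    then have "RR p = tzero" using exp[OF Rt] by (simp add: r_def)
    then show False using RR_nonzero by blast
  qed
  \<comment> \<open>Chosen so that the \<open>i\<close>-th coordinate of \<open>v - c R\<close> is
    zero; replacing row \<open>i\<close> by the combination for R then does not disturb the later
    combination for \<open>w\<close>.\<close>
  define c where "c = v (\<lambda>q. \<phi> q $ i) / r i"
  define w where "w = (\<lambda>f. 1 * v f + (- c) * RR p f)"
  have wt: "w \<in> TM p" unfolding w_def by (rule tangent_comb[OF vt Rt])
  have wg: "g p u w = 0" if "u \<in> TM p" for u
  proof -
    have "g p u v = 0" using assms g_sym[OF that vt] that by (simp add: Rad_def)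
    then show ?thesis unfolding w_def g_comb_right[OF that vt Rt] using g_radical(2)[OF p that] by simp
  qed
  define y where "y k = w (\<lambda>q. \<phi> q $ k)" for k
  have yi: "y i = 0" using i by (simp add: y_def w_def c_def r_def)
  have "y j = 0" for j
  proof (rule ccontr)
    assume yj: "y j \<noteq> 0"
    then have ij: "i \<noteq> j" using yi by auto
    let ?G = "\<lambda>q. (\<chi> a b. g q (?d a q) (?d b q)) :: real^'n^'n"
    let ?a = "\<lambda>q l. \<Sum>k\<in>UNIV. r k * g q (?d k q) (?d l q)" and ?b = "\<lambda>q l. \<Sum>k\<in>UNIV. y k * g q (?d k q) (?d l q)"
    \<comment> \<open>Row \<open>i\<close> of \<open>A\<close> holds the products of R with the
      coordinate fields, and \<open>M\<close> has in addition those of \<open>w\<close> in row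
      \<open>j\<close>, with the coordinates of R and \<open>w\<close> frozen at \<open>p\<close>.
      At \<open>p\<close> both rows are zero since R and \<open>w\<close> are radical, while
      \<open>det (M q)\<close> is the Gram determinant times the constant
      \<open>y j * r i\<close>.\<close>
    define A where "A q = ((\<chi> k l. if k = i then ?a q l else g q (?d k q) (?d l q)) :: real^'n^'n)" for q
    define M where "M q = ((\<chi> k l. if k = j then ?b q l else if k = i then ?a q l else g q (?d k q) (?d l q)) :: real^'n^'n)" for q
    have 1: "det (A q) = r i * ?\<delta> q" for q
    proof -
      have "A q = (\<chi> k. if k = i then \<Sum>k\<in>UNIV. ((\<chi> k. r k) :: real^'n) $ k *s row k (?G q) else row k (?G q))"
        by (vector A_def row_def sum_component)
      then show ?thesis using cramer_lemma_transpose[of i "(\<chi> k. r k) :: real^'n" "?G q"]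
        by (simp add: gram_det_def)
    qed
    have 2: "det (M q) = y j * det (A q)" for q
    proof -
      have "(\<Sum>k\<in>UNIV. y k * A q $ k $ l) = ?b q l" for l
        by (rule sum.cong) (auto simp: A_def yi)
      then have "M q = (\<chi> k. if k = j then \<Sum>k\<in>UNIV. ((\<chi> k. y k) :: real^'n) $ k *s row k (A q) else row k (A q))"
        by (simp add: vec_eq_iff M_def row_def sum_component A_def)
      then show ?thesis using cramer_lemma_transpose[of j "(\<chi> k. y k) :: real^'n" "A q"] by simp
    qed
    have ng: "smooth V (\<lambda>q. g q (?d k q) (?d l q))" for k l by (rule g_fun[OF V(1) sd sd])
    have nM: "smooth_at p (\<lambda>q. M q $ k $ l)" for k l
    proof (rule smooth_near_fun[OF V(1,2)])
      have "smooth V (\<lambda>q. ?a q l)" "smooth V (\<lambda>q. ?b q l)" for l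
        by (intro smooth_sum smooth_mult smooth_const ng V(1))+
      then show "smooth V (\<lambda>q. M q $ k $ l)"
        using ng by (cases "k = j"; cases "k = i") (simp_all add: M_def)
    qed
    have a0: "?a p l = g p (?d l p) (RR p)" for l
      unfolding gram_vector[OF D Rt td] r_def by (rule sum.cong) (simp_all add: g_sym[OF td td])
    have b0: "?b p l = g p (?d l p) w" for l
      unfolding gram_vector[OF D wt td] y_def by (rule sum.cong) (simp_all add: g_sym[OF td td])
    have Nt: "NN p \<in> TM p" by (rule vf_tangent[OF NN(1) pW])
    have "NN p (\<lambda>q. det (M q)) = 0"
      by (rule derivative_det_two_rows[OF Nt nM ij])
         (use a0 b0 wg[OF td] g_radical(2)[OF p td] ij in \<open>auto simp: M_def\<close>)
    moreover have s\<delta>: "smooth_at p ?\<delta>"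
      by (rule smooth_near_fun[OF V(1,2) smooth_subset[OF gram_det_smooth[OF D(1)] V(4)]])
    have "NN p (\<lambda>q. det (M q)) = (y j * r i) * NN p ?\<delta>"
      using tangent_mult[OF Nt smooth_near_const s\<delta>, of "y j * r i"] tangent_const[OF Nt]
      by (simp add: 1 2 mult.assoc)
    ultimately have d0: "NN p ?\<delta> = 0" using yj i by simp
    have "NN p tau = NN p (\<lambda>q. ?\<delta> q * \<kappa> q)" by (rule tangent_cong[OF Nt V(1,2,6)])
    also have "\<dots> = ?\<delta> p * NN p \<kappa> + \<kappa> p * NN p ?\<delta>"
      by (rule tangent_mult[OF Nt s\<delta> smooth_near_fun[OF V(1,2,5)]])
    finally show False using NN_tau d0 sing_iff[OF D] pS by simp
  qed
  then have "w = tzero" using exp[OF wt] by (simp add: y_def)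
  from fun_cong[OF this] have "v f = c * RR p f" for f by (simp add: w_def)
  then show ?thesis by blast
qed

end

section \<open>The tensor \<Upsilon> and its values on the hypersurface\<close>

lemma Ups_smooth:
  assumes "open U" "U \<subseteq> W" "vf U A" "vf U B" "vf U C" "vf U E"
  shows "smooth U (\<lambda>q. Ups q (A q) (B q) (C q) (E q))"
proof -
  have "smooth_tensor4 At W Ups" using canonical by (simp add: canonical_data_def)
  then show ?thesis using assms by (simp add: smooth_tensor4_def)
qed

lemma Ups_linear:
  assumes "p \<in> W" "u \<in> TM p" "v \<in> TM p" "w \<in> TM p"
  shows "linear_form At p (\<lambda>x. Ups p x u v w)" "linear_form At p (\<lambda>x. Ups p u x v w)"
    "linear_form At p (\<lambda>x. Ups p u v x w)" "linear_form At p (\<lambda>x. Ups p u v w x)"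
proof -
  have "smooth_tensor4 At W Ups" using canonical by (simp add: canonical_data_def)
  then show "linear_form At p (\<lambda>x. Ups p x u v w)" "linear_form At p (\<lambda>x. Ups p u x v w)"
    "linear_form At p (\<lambda>x. Ups p u v x w)" "linear_form At p (\<lambda>x. Ups p u v w x)"
    using assms by (simp_all add: smooth_tensor4_def)
qed

lemma Ups_curvature:
  assumes "open U" "vf U A" "vf U B" "vf U C" "vf U E" "p \<in> U" "p \<in> W - Sg"
  shows "Ups p (A p) (B p) (C p) (E p) = tau p * g p (Riem A B C p) (E p)"
proof -
  have c: "\<forall>U A B C D. open U \<and> U \<subseteq> W - Sg \<and>
        vf U A \<and> vf U B \<and> vf U C \<and> vf U D \<longrightarrow>
        (\<forall>p\<in>U. Ups p (A p) (B p) (C p) (D p) =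
           g p (RR p) (RR p) * g p (Riem A B C p) (D p))"
    using canonical by (simp add: canonical_data_def)
  define V where "V = U \<inter> (W - Sg)"
  have V: "open V" "V \<subseteq> W - Sg" "V \<subseteq> U" "p \<in> V"
    using open_Int[OF assms(1) open_Int[OF W open_regular]] assms(6,7) by (auto simp: V_def Diff_eq)
  from c[THEN spec[where x = V], THEN spec[where x = A], THEN spec[where x = B], THEN spec[where x = C], THEN spec[where x = E]]
  show ?thesis
    using V vf_subset[OF assms(2) V(3)] vf_subset[OF assms(3) V(3)] vf_subset[OF assms(4) V(3)] vf_subset[OF assms(5) V(3)]
    by (simp add: tau_def)
qed

text \<open>By Cramer's rule the coordinates of \<open>\<nabla>\<^sub>XY\<close> multiplied by the Gram determinant are smooth, so
  \<open>\<tau>\<nabla>\<^sub>XY\<close> extends to \<open>\<Sigma>\<close>; its value there is radical, hence a multiple of \<open>R\<close>, and pairing with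
  \<open>R\<close> shows that the factor is \<open>\<box>\<^sub>XY(R)\<close>.\<close>

lemma nabla_product:
  assumes p: "p \<in> S" and U: "open U" "p \<in> U"
    and "vf U X" "vf U Y" "vf U B" "vf U C"
  obtains V F where "open V" "p \<in> V" "V \<subseteq> U" "V \<subseteq> W" "smooth V F"
    "\<And>q. q \<in> V - Sg \<Longrightarrow> F q = tau q * g q (nabla X Y q) (nabla B C q)"
    "F p = DC X Y RR p * DC B C RR p"
proof -
  obtain D \<phi> where D: "(D, \<phi>) \<in> At" "p \<in> D" by (rule ex_chart)
  let ?d = "\<lambda>i. coord_vec At (D, \<phi>) i" and ?\<delta> = "gram_det At g (D, \<phi>)"
  obtain V \<kappa> where V: "open V" "p \<in> V" "V \<subseteq> U" "V \<subseteq> W" "V \<subseteq> D" "smooth V \<kappa>"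
    and \<kappa>: "\<And>q. q \<in> V \<Longrightarrow> tau q = ?\<delta> q * \<kappa> q" "\<And>q. q \<in> V \<Longrightarrow> \<kappa> q \<noteq> 0"
    and div: "\<And>f. smooth V f \<Longrightarrow> (\<And>q. q \<in> V \<Longrightarrow> q \<in> Sg \<Longrightarrow> f q = 0) \<Longrightarrow>
       \<exists>h. smooth V h \<and> (\<forall>q\<in>V. f q = tau q * h q)"
    by (rule tau_division[OF p D U]) blast
  note sX = vf_subset[OF assms(4) V(3)] and sY = vf_subset[OF assms(5) V(3)]
    and sB = vf_subset[OF assms(6) V(3)] and sC = vf_subset[OF assms(7) V(3)]
    and sR = vf_subset[OF RR(1) V(4)] and sd = vf_subset[OF coord_vec_vf[OF D(1)] V(5)]
  note td = vf_tangent[OF sd] and tR = vf_tangent[OF sR]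
  have \<tau>: "tau q \<noteq> 0" if "q \<in> V - Sg" for q
    using that \<kappa>[of q] sing_iff[OF D(1), of q] V(5) by auto
  define V' where "V' = V - Sg"
  have V': "open V'" "V' \<subseteq> - Sg" "V' \<subseteq> V"
    using open_Int[OF V(1) open_regular] by (auto simp: V'_def Diff_eq)
  note sub = vf_subset[OF _ V'(3)]
  have nt: "nabla X Y q \<in> TM q" "nabla B C q \<in> TM q" if "q \<in> V - Sg" for q
    using vf_tangent[OF nabla(1)[OF V'(1,2) sub[OF sX] sub[OF sY]]] vf_tangent[OF nabla(1)[OF V'(1,2) sub[OF sB] sub[OF sC]]] that
    by (auto simp: V'_def)
  have ko: "g q (nabla X Y q) (Z q) = DC X Y Z q" "g q (nabla B C q) (Z q) = DC B C Z q"
    if "vf V Z" "q \<in> V - Sg" for Z q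
    using koszul[OF V'(1,2) sub[OF sX] sub[OF sY] sub[OF that(1)]] koszul[OF V'(1,2) sub[OF sB] sub[OF sC] sub[OF that(1)]] that(2)
    by (auto simp: V'_def)
  \<comment> \<open>The numerators in Cramer's rule for the coordinates of \<open>nabla X Y\<close>.
    They are built from functions smooth on all of \<open>V\<close>.\<close>
  define c where "c k q = det ((\<chi> i l. if i = k then DC X Y (?d l) q else g q (?d i q) (?d l q)) :: real^'n^'n)" for k q
  have sdc: "smooth V (DC X Y (?d l))" "smooth V (DC B C (?d l))" for l
    by (rule dual_conn_smooth[OF V(1) sX sY sd] dual_conn_smooth[OF V(1) sB sC sd])+
  have sg: "smooth V (\<lambda>q. g q (?d k q) (?d l q))" for k l by (rule g_fun[OF V(1) sd sd])
  have sc: "smooth V (c k)" for k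
    unfolding c_def[abs_def]
  proof (rule smooth_det[OF V(1)])
    show "smooth V (\<lambda>q. ((\<chi> i l. if i = k then DC X Y (?d l) q else g q (?d i q) (?d l q)) :: real^'n^'n) $ i $ j)" for i j
      by (cases "i = k") (simp_all add: sdc sg)
  qed
  have cramer: "c k q = nabla X Y q (\<lambda>q. \<phi> q $ k) * ?\<delta> q" if "q \<in> V - Sg" for k q
  proof -
    let ?x = "(\<chi> k. nabla X Y q (\<lambda>q. \<phi> q $ k)) :: real^'n" and ?G = "(\<chi> a b. g q (?d a q) (?d b q)) :: real^'n^'n"
    have qD: "q \<in> D" using that V(5) by auto
    have "(\<Sum>i\<in>UNIV. nabla X Y q (\<lambda>q. \<phi> q $ i) * g q (?d i q) (?d l q)) = DC X Y (?d l) q" for l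
    proof -
      have qV: "q \<in> V" using that by auto
      have "DC X Y (?d l) q = g q (?d l q) (nabla X Y q)"
        using ko(1)[OF sd that] g_sym[OF nt(1)[OF that] td[OF qV]] by simp
      also have "\<dots> = (\<Sum>i\<in>UNIV. nabla X Y q (\<lambda>q. \<phi> q $ i) * g q (?d i q) (?d l q))"
        unfolding gram_vector[OF D(1) qD nt(1)[OF that] td[OF qV]]
        by (rule sum.cong) (simp_all add: g_sym[OF td[OF qV] td[OF qV]])
      finally show ?thesis by simp
    qed
    then have "c k q = det (\<chi> i. if i = k then \<Sum>i\<in>UNIV. ?x $ i *s row i ?G else row i ?G)"
      unfolding c_def by (intro arg_cong[of _ _ det]) (simp add: vec_eq_iff row_def sum_component)
    then show ?thesis unfolding cramer_lemma_transpose by (simp add: gram_det_def)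
  qed
  have \<tau>c: "tau q * nabla X Y q (\<lambda>q. \<phi> q $ k) = \<kappa> q * c k q" if "q \<in> V - Sg" for k q
    using cramer[OF that, of k] \<kappa>(1)[of q] that by simp
  have prod: "(\<Sum>k\<in>UNIV. \<kappa> q * c k q * g q (?d k q) w) = tau q * g q (nabla X Y q) w"
    if "q \<in> V - Sg" "w \<in> TM q" for q w
  proof -
    have qD: "q \<in> D" and qV: "q \<in> V" using that V(5) by auto
    have "g q (nabla X Y q) w = (\<Sum>k\<in>UNIV. nabla X Y q (\<lambda>q. \<phi> q $ k) * g q (?d k q) w)"
      unfolding g_sym[OF nt(1)[OF that(1)] that(2)] gram_vector[OF D(1) qD nt(1)[OF that(1)] that(2)]
      by (rule sum.cong) (simp_all add: g_sym[OF td[OF qV] that(2)])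
    then show ?thesis
      by (simp add: sum_distrib_left \<tau>c[OF that(1), symmetric] mult.assoc)
  qed
  \<comment> \<open>At \<open>p\<close> pairing with R only gives 0 = 0, so the pairing is divided
    by \<tau> beforehand: \<theta> is the quotient of the products of R with the coordinate fields
    by \<tau>, smooth because R is radical on \<Sigma>.\<close>
  have "\<exists>h. smooth V h \<and> (\<forall>q\<in>V. g q (?d k q) (RR q) = tau q * h q)" for k
    by (rule div[OF g_fun[OF V(1) sd sR]]) (use g_radical(2) td V(4) in auto)
  then obtain \<theta> where \<theta>: "\<And>k. smooth V (\<theta> k)" "\<And>k q. q \<in> V \<Longrightarrow> g q (?d k q) (RR q) = tau q * \<theta> k q"
    by metis
  define r where "r k q = RR q (\<lambda>q. \<phi> q $ k)" for k q
  have sr: "smooth V (r k)" for k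
    unfolding r_def[abs_def] by (rule vf_coord_smooth[OF D(1) V(1,5) sR])
  \<comment> \<open>The definition \<tau> = <R,R>, divided by \<tau> off \<Sigma> and carried to
    \<open>p\<close> by density. Pairing with \<theta> thus recovers the factor of a multiple of
    R.\<close>
  have r1: "(\<Sum>k\<in>UNIV. r k p * \<theta> k p) = 1"
  proof (rule smooth_eq_sing[OF V(1) _ smooth_const _ V(2)])
    show "smooth V (\<lambda>q. \<Sum>k\<in>UNIV. r k q * \<theta> k q)"
      by (intro smooth_sum smooth_mult V(1) sr \<theta>(1))
    fix q assume q: "q \<in> V - Sg"
    then have qV: "q \<in> V" and qD: "q \<in> D" using V(5) by auto
    have "tau q = (\<Sum>k\<in>UNIV. r k q * g q (RR q) (?d k q))"
      unfolding tau_def r_def by (rule gram_vector[OF D(1) qD tR[OF qV] tR[OF qV]])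
    also have "\<dots> = tau q * (\<Sum>k\<in>UNIV. r k q * \<theta> k q)"
      unfolding sum_distrib_left
      by (rule sum.cong) (simp_all add: g_sym[OF tR[OF qV] td[OF qV]] \<theta>(2)[OF qV])
    finally show "(\<Sum>k\<in>UNIV. r k q * \<theta> k q) = 1" using \<tau>[OF q] by simp
  qed
  have \<beta>: "(\<Sum>k\<in>UNIV. \<kappa> p * c k p * \<theta> k p) = DC X Y RR p"
  proof (rule smooth_eq_sing[OF V(1) _ dual_conn_smooth[OF V(1) sX sY sR] _ V(2)])
    show "smooth V (\<lambda>q. \<Sum>k\<in>UNIV. \<kappa> q * c k q * \<theta> k q)"
      by (intro smooth_sum smooth_mult V(1,6) sc \<theta>(1))
    fix q assume q: "q \<in> V - Sg"
    then have qV: "q \<in> V" by auto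
    have "tau q * (\<Sum>k\<in>UNIV. \<kappa> q * c k q * \<theta> k q) = (\<Sum>k\<in>UNIV. \<kappa> q * c k q * g q (?d k q) (RR q))"
      unfolding sum_distrib_left by (rule sum.cong) (simp_all add: \<theta>(2)[OF qV])
    also have "\<dots> = tau q * DC X Y RR q"
      unfolding prod[OF q tR[OF qV]] ko(1)[OF sR q] ..
    finally show "(\<Sum>k\<in>UNIV. \<kappa> q * c k q * \<theta> k q) = DC X Y RR q" using \<tau>[OF q] by simp
  qed
  \<comment> \<open>The value at \<open>p\<close> of the smooth extension of \<tau> times
    \<open>nabla X Y\<close>. Its product with a coordinate vector is \<open>tau p\<close> times a
    finite number, so \<open>v\<close> is radical.\<close>
  define v where "v = (\<lambda>f. \<Sum>k\<in>UNIV. \<kappa> p * c k p * ?d k p f)"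
  have vt: "v \<in> TM p" unfolding v_def by (rule tangent_sum) (rule td[OF V(2)])
  have "g p v (?d l p) = 0" for l
  proof -
    have "g p v (?d l p) = (\<Sum>k\<in>UNIV. \<kappa> p * c k p * g p (?d k p) (?d l p))"
      unfolding v_def by (rule g_sum_left[OF td[OF V(2)] td[OF V(2)]])
    also have "\<dots> = tau p * DC X Y (?d l) p"
    proof (rule smooth_eq_sing[OF V(1) _ _ _ V(2)])
      show "smooth V (\<lambda>q. \<Sum>k\<in>UNIV. \<kappa> q * c k q * g q (?d k q) (?d l q))"
        by (intro smooth_sum smooth_mult V(1,6) sc sg)
      show "smooth V (\<lambda>q. tau q * DC X Y (?d l) q)"
        by (intro smooth_mult V(1) smooth_subset[OF tau_smooth V(4)] sdc)
      fix q assume q: "q \<in> V - Sg"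
      then have qV: "q \<in> V" by auto
      show "(\<Sum>k\<in>UNIV. \<kappa> q * c k q * g q (?d k q) (?d l q)) = tau q * DC X Y (?d l) q"
        unfolding prod[OF q td[OF qV]] ko(1)[OF sd q] ..
    qed
    finally show ?thesis using tau_zero[OF p] by simp
  qed
  then have "v \<in> Rad At g p" using radical_iff[OF D vt] by simp
  then obtain a where a: "v = (\<lambda>f. a * RR p f)" using radical_line[OF p] by blast
  have ck: "\<kappa> p * c k p = a * r k p" for k
  proof -
    have "v (\<lambda>q. \<phi> q $ k) = \<kappa> p * c k p"
      by (simp add: v_def coord_vec_coord[OF D] if_distrib[of "\<lambda>y. _ * y"] cong: if_cong)
    then show ?thesis by (simp add: a r_def)
  qed
  have "a * (\<Sum>k\<in>UNIV. r k p * \<theta> k p) = DC X Y RR p"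
    unfolding \<beta>[symmetric] ck sum_distrib_left by (simp add: mult.assoc)
  then have aeq: "a = DC X Y RR p" using r1 by simp
  \<comment> \<open>As \<tau> times \<open>nabla X Y\<close> has the coordinates
    \<open>\<kappa> q * c k q\<close>, its product with \<open>nabla B C\<close> involves only the
    products of the latter with coordinate fields, and these are values of the dual connection,
    smooth across \<Sigma>.\<close>
  define F where "F q = (\<Sum>k\<in>UNIV. \<kappa> q * c k q * DC B C (?d k) q)" for q
  have "F p = a * (\<Sum>k\<in>UNIV. r k p * DC B C (?d k) p)"
    unfolding F_def ck sum_distrib_left by (simp add: mult.assoc)
  also have "(\<Sum>k\<in>UNIV. r k p * DC B C (?d k) p) = DC B C (\<lambda>q f. \<Sum>k\<in>UNIV. r k p * ?d k q f) p"
    by (rule dual_conn_sum3[symmetric, OF V(1,2) finite sd sB sC])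
  also have "\<dots> = DC B C RR p"
  proof (rule dual_conn_cong3[OF V(1,2) _ sR _ sB sC])
    show "vf V (\<lambda>q f. \<Sum>k\<in>UNIV. r k p * ?d k q f)"
      by (intro vf_sum V(1) sd smooth_const)
    show "(\<lambda>f. \<Sum>k\<in>UNIV. r k p * ?d k p f) = RR p"
      unfolding r_def by (rule ext) (rule tangent_expansion[OF D tR[OF V(2)], symmetric])
  qed
  finally have "F p = DC X Y RR p * DC B C RR p" by (simp add: aeq)
  moreover have "smooth V F"
    unfolding F_def[abs_def] by (intro smooth_sum smooth_mult V(1,6) sc sdc)
  moreover have "F q = tau q * g q (nabla X Y q) (nabla B C q)" if q: "q \<in> V - Sg" for q
  proof -
    have qV: "q \<in> V" using q by auto
    have "F q = (\<Sum>k\<in>UNIV. \<kappa> q * c k q * g q (?d k q) (nabla B C q))"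
      unfolding F_def
      by (rule sum.cong) (simp_all add: ko(2)[OF sd q, symmetric] g_sym[OF nt(2)[OF q] td[OF qV]])
    then show ?thesis using prod[OF q nt(2)[OF q]] by simp
  qed
  ultimately show thesis using that V(1-4) by blast
qed

lemma Ups_singular:
  assumes p: "p \<in> S" and U: "open U" "p \<in> U"
    and s: "vf U A" "vf U B" "vf U C" "vf U E"
  shows "Ups p (A p) (B p) (C p) (E p) =
    DC A C RR p * DC B E RR p - DC B C RR p * DC A E RR p"
proof -
  obtain V1 F1 where 1: "open V1" "p \<in> V1" "V1 \<subseteq> U" "V1 \<subseteq> W" "smooth V1 F1"
    "\<And>q. q \<in> V1 - Sg \<Longrightarrow> F1 q = tau q * g q (nabla A C q) (nabla B E q)"
    "F1 p = DC A C RR p * DC B E RR p"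
    by (rule nabla_product[OF p U s(1,3,2,4)]) blast
  obtain V2 F2 where 2: "open V2" "p \<in> V2" "V2 \<subseteq> U" "V2 \<subseteq> W" "smooth V2 F2"
    "\<And>q. q \<in> V2 - Sg \<Longrightarrow> F2 q = tau q * g q (nabla B C q) (nabla A E q)"
    "F2 p = DC B C RR p * DC A E RR p"
    by (rule nabla_product[OF p U s(2,3,1,4)]) blast
  define V where "V = V1 \<inter> V2"
  have V: "open V" "p \<in> V" "V \<subseteq> V1" "V \<subseteq> V2" "V \<subseteq> U" "V \<subseteq> W" using 1 2 by (auto simp: V_def)
  note sV = s[THEN vf_subset, OF V(5)]
  \<comment> \<open>The curvature formula multiplied by \<tau>: the part written with the dual
    connection keeps the factor \<tau> and vanishes at \<open>p\<close>, so only \<open>F1\<close>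
    and \<open>F2\<close> survive there.\<close>
  define G where "G q = tau q * (A q (DC B C E) - B q (DC A C E) - DC (bracket A B) C E q)
     + F1 q - F2 q" for q
  have "Ups p (A p) (B p) (C p) (E p) = G p"
  proof (rule smooth_eq_sing[OF V(1) Ups_smooth[OF V(1,6) sV] _ _ V(2)])
    show "smooth V G"
      unfolding G_def[abs_def]
      by (intro smooth_diff smooth_add smooth_mult V(1) smooth_subset[OF tau_smooth V(6)]
          vf_fun[OF sV(1)] vf_fun[OF sV(2)] dual_conn_smooth sV vf_bracket
          smooth_subset[OF 1(5) V(3)] smooth_subset[OF 2(5) V(4)])
    fix q assume q: "q \<in> V - Sg"
    then have "q \<in> W - Sg" "q \<in> V" using V(6) by auto
    note u = Ups_curvature[OF V(1) sV this(2,1)] curvature_formula[OF V(1) sV q]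
    have "F1 q = tau q * g q (nabla A C q) (nabla B E q)" "F2 q = tau q * g q (nabla B C q) (nabla A E q)"
      using q V 1(6) 2(6) by auto
    then show "Ups q (A q) (B q) (C q) (E q) = G q"
      unfolding u G_def by (simp add: algebra_simps)
  qed
  then show ?thesis using tau_zero[OF p] 1(7) 2(7) by (simp add: G_def)
qed

section \<open>Splitting by N, R and the screen; the II-flat case\<close>

definition nuf :: "'a vfield \<Rightarrow> 'a \<Rightarrow> real" where
  "nuf X p = g p (X p) (NN p)"

text \<open>The coefficient \<open>\<rho>\<close> in terms of an extension of the field; the first summand removes the normal
  component.\<close>

definition rhof :: "'a vfield \<Rightarrow> 'a \<Rightarrow> real" where
  "rhof X p = nuf X p * DC NN RR NN p - DC X RR NN p"

lemma tangent_Sing_comb: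
  assumes "p \<in> S" "v \<in> TSg p" "w \<in> TSg p"
  shows "(\<lambda>f. a * v f + b * w f) \<in> TSg p"
proof -
  have t: "v \<in> TM p" "w \<in> TM p" using assms by (auto simp: tangent_Sing_def)
  then have "v tau = 0" "w tau = 0" using assms(2,3) tangent_Sing_iff[OF assms(1)] by blast+
  then show ?thesis
    unfolding tangent_Sing_iff[OF assms(1) tangent_comb[OF t]] by simp
qed

text \<open>From a constant-coefficient field Y subtract Y(\<tau>)/N(\<tau>) times N: the result
  kills \<tau>, hence is tangent to \<Sigma> at each of its points. The denominator is nonzero near
  \<open>p\<close> because it is 2 at \<open>p\<close>.\<close>

lemma tangential_extension:
  assumes p: "p \<in> S"
  obtains U where "open U" "p \<in> U" "U \<subseteq> W"
    "\<And>v. v \<in> TSg p \<Longrightarrow>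
       \<exists>X. vf U X \<and> X p = v \<and> (\<forall>q\<in>Sg \<inter> U. X q \<in> TSg q)"
proof -
  have pW: "p \<in> W" using p by auto
  obtain D \<phi> where D: "(D, \<phi>) \<in> At" "p \<in> D" by (rule ex_chart)
  define n where "n q = NN q tau" for q
  have sn: "smooth W n" unfolding n_def[abs_def] by (rule vf_fun[OF NN(1) W tau_smooth])
  define U where "U = D \<inter> (W \<inter> n -` (- {0}))"
  have "open (W \<inter> n -` (- {0}))"
    by (rule continuous_open_preimage[OF smooth_continuous[OF W sn] W]) auto
  then have U: "open U" "U \<subseteq> W" "U \<subseteq> D" using chart(2)[OF D(1)] by (auto simp: U_def)
  have pU: "p \<in> U" using D(2) pW NN_tau[OF p] by (simp add: U_def n_def)
  have n0: "n q \<noteq> 0" if "q \<in> U" for q using that by (simp add: U_def)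
  have "\<exists>X. vf U X \<and> X p = v \<and> (\<forall>q\<in>Sg \<inter> U. X q \<in> TSg q)"
    if v: "v \<in> TSg p" for v
  proof -
    have vt: "v \<in> TM p" using v by (simp add: tangent_Sing_def)
    obtain Y where Y: "vf D Y" "Y p = v" by (rule constant_coefficient_field[OF D vt])
    note sY = vf_subset[OF Y(1) U(3)] and sN = vf_subset[OF NN(1) U(2)]
    define k where "k q = - (Y q tau * inverse (n q))" for q
    have sk: "smooth U k"
      unfolding k_def[abs_def]
      by (intro smooth_minus smooth_mult smooth_inverse U(1) n0 smooth_subset[OF sn U(2)]
          vf_fun[OF sY U(1) smooth_subset[OF tau_smooth U(2)]])
    define X where "X = (\<lambda>q f. 1 * Y q f + k q * NN q f)"
    have sX: "vf U X"
      unfolding X_def by (rule vf_comb[OF U(1) sY sN smooth_const sk])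
    have X\<tau>: "X q tau = 0" if "q \<in> U" for q
      using n0[OF that] by (simp add: X_def k_def n_def)
    have "X q \<in> TSg q" if "q \<in> Sg \<inter> U" for q
      using tangent_Sing_iff[OF _ vf_tangent[OF sX]] X\<tau> that U(2) by auto
    moreover have "X p = v"
      using tangent_Sing_iff[OF p vt] v by (simp add: X_def k_def Y(2))
    ultimately show ?thesis using sX by blast
  qed
  with that U(1,2) pU show thesis by blast
qed

context
  fixes p U assumes p: "p \<in> S" and U: "open U" "p \<in> U" "U \<subseteq> W"
begin

lemmas NNU = vf_subset[OF NN(1) U(3)] and RRU = vf_subset[OF RR(1) U(3)]

lemma II_sym_local:
  assumes "vf U X" "vf U Y"
  shows "DC X Y RR p = DC Y X RR p"
  using dual_conn_torsion[OF U(1,2) assms RRU] bracket_radical[OF p assms U(1,2)] by simp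

text \<open>The third assumption is H(X,R) = 0 at \<open>p\<close>. Both <R,N> and <R,R> vanish on
  \<Sigma> and X is tangent, so compatibility turns the first into II(X,N) = -H(X,R) and the second
  into II(X,R) = 0; symmetry of II gives the rest.\<close>

lemma screen_values:
  assumes "vf U X" "X p \<in> TSg p" "DC X RR NN p = 0"
  shows "DC X NN RR p = 0" "DC X RR RR p = 0"
    "DC NN X RR p = 0" "DC RR X RR p = 0"
proof -
  have "X p (\<lambda>q. g q (RR q) (NN q)) = 0"
    by (rule tangent_SingD[OF assms(2) U(1,2) g_fun[OF U(1) RRU NNU]])
       (use g_radical(1) vf_tangent[OF NNU] U(3) in auto)
  then show 1: "DC X NN RR p = 0"
    using dual_conn_compat[OF U(1,2) assms(1) RRU NNU] assms(3) by simp
  have "X p (\<lambda>q. g q (RR q) (RR q)) = 0"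
    using tangent_Sing_iff[OF p vf_tangent[OF assms(1) U(2)]] assms(2) by (simp add: tau_def[abs_def])
  then show 2: "DC X RR RR p = 0"
    using dual_conn_compat[OF U(1,2) assms(1) RRU RRU] by simp
  show "DC NN X RR p = 0" "DC RR X RR p = 0"
    using 1 2 II_sym_local[OF assms(1) NNU] II_sym_local[OF assms(1) RRU] by simp_all
qed

text \<open>II-flatness concerns screen sections over an open set, while \<open>X\<close> and
  \<open>Y\<close> are known to lie in the screen only at \<open>p\<close>. Their screen projections
  are such sections and agree with them at \<open>p\<close>, which suffices because II is
  tensorial.\<close>

lemma flat_screen:
  assumes flat: "II_flat At g S N R"
    and X: "vf U X" "\<forall>q\<in>Sg \<inter> U. X q \<in> TSg q" "DC X RR NN p = 0"
    and Y: "vf U Y" "\<forall>q\<in>Sg \<inter> U. Y q \<in> TSg q" "DC Y RR NN p = 0"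
  shows "DC X Y RR p = 0"
proof -
  \<comment> \<open>the screen projection, as \<open>\<H>(R,R) = -1\<close>\<close>
  define scr where "scr X = (\<lambda>q f. 1 * X q f + DC X RR NN q * RR q f)" for X
  have N': "along (S \<inter> U) N" by (rule vf_along_subset[OF N_along Int_lower1])
  have R': "along (S \<inter> U) R" by (rule vf_along_subset[OF R_along Int_lower1])
  have ss: "vf U (scr X)" if "vf U X" for X
    unfolding scr_def by (rule vf_comb[OF U(1) that RRU smooth_const dual_conn_smooth[OF U(1) that RRU NNU]])
  have al: "along (S \<inter> U) (scr X)" if "vf U X" for X
    by (rule vf_extends_along[OF U(1) Int_lower2, where AA = "scr X"]) (use ss[OF that] in \<open>simp add: vf_extends_def\<close>)
  have scr: "screen_section At g (S \<inter> U) N R (scr X)"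
    if X: "vf U X" "\<forall>q\<in>Sg \<inter> U. X q \<in> TSg q" for X
    unfolding screen_section_def tangent_vf_along_def
  proof (intro conjI ballI al[OF X(1)])
    fix q assume q: "q \<in> S \<inter> U"
    then have qS: "q \<in> S" and qU: "q \<in> U" by auto
    show t: "scr X q \<in> TSg q"
      unfolding scr_def by (rule tangent_Sing_comb[OF qS]) (use X(2) RR_tangent q in auto)
    have c: "vf U (\<lambda>r f. 1 * X r f + DC X RR NN q * RR r f)"
      by (rule vf_comb[OF U(1) X(1) RRU smooth_const smooth_const])
    have "second_fundamental_form At g (S \<inter> U) N (scr X) R q = DC (scr X) RR NN q"
      unfolding second_fundamental_form_def
      by (rule dual_conn_along_tangent[OF al[OF X(1)] R' N' q U(1) qU ss[OF X(1)] RRU NNU refl _ t U(1) qU])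
         (use NN RR qS U(3) in auto)
    \<comment> \<open>The coefficient function of the projection is frozen at \<open>q\<close>, so
      that linearity with constant coefficients applies.\<close>
    also have "\<dots> = DC (\<lambda>r f. 1 * X r f + DC X RR NN q * RR r f) RR NN q"
      by (rule dual_conn_cong1[OF U(1) qU ss[OF X(1)] c _ RRU NNU]) (simp add: scr_def)
    also have "\<dots> = 0"
      unfolding dual_conn_comb1[OF U(1) qU X(1) RRU RRU NNU] using H_RR[OF qS] by simp
    finally show "second_fundamental_form At g (S \<inter> U) N (scr X) R q = 0" .
  qed
  have "second_II At g (S \<inter> U) R (scr X) (scr Y) p = 0"
  proof -
    have "\<forall>p\<in>S \<inter> U. second_II At g (S \<inter> U) R (scr X) (scr Y) p = 0"
      by (rule flat[unfolded II_flat_def, THEN spec[where x = U], THEN spec[where x = "scr X"],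
            THEN spec[where x = "scr Y"], THEN mp]) (intro conjI U(1) scr[OF X(1,2)] scr[OF Y(1,2)])
    then show ?thesis using p U(2) by simp
  qed
  moreover have "second_II At g (S \<inter> U) R (scr X) (scr Y) p = DC X Y RR p"
    unfolding second_II_def
    by (rule dual_conn_along_radical[OF al[OF X(1)] al[OF Y(1)] R' _ U(1,2) X(1) Y(1) RRU])
       (use p U RR RR_radical[OF p] X(3) Y(3) in \<open>auto simp: scr_def\<close>)
  ultimately show ?thesis by simp
qed

text \<open>With T a tangential extension of A - \<nu>(A)N, the screen part is X = T - \<rho>(A)R:
  from H(T,R) = -\<rho>(A) and H(R,R) = -1 follows H(X,R) = 0. The factors 1 give the sum the shape
  that the linearity lemmas expect.\<close>

lemma decomposition:
  assumes ext: "\<And>v. v \<in> TSg p \<Longrightarrow>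
       \<exists>X. vf U X \<and> X p = v \<and> (\<forall>q\<in>Sg \<inter> U. X q \<in> TSg q)"
    and A: "open U'" "p \<in> U'" "vf U' A"
  obtains X where "vf U X" "\<forall>q\<in>Sg \<inter> U. X q \<in> TSg q"
    "DC X RR NN p = 0"
    "A p = (\<lambda>f. nuf A p * NN p f + 1 * (1 * X p f + rhof A p * RR p f))"
proof -
  have At: "A p \<in> TM p" by (rule vf_tangent[OF A(3,2)])
  have Nt: "NN p \<in> TM p" by (rule vf_tangent[OF NNU U(2)])
  define v where "v = (\<lambda>f. 1 * A p f + (- nuf A p) * NN p f)"
  have vt: "v \<in> TM p" unfolding v_def by (rule tangent_comb[OF At Nt])
  have "v tau = 0" using normal_component[OF p At] NN_tau[OF p] by (simp add: v_def nuf_def)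
  then have "v \<in> TSg p" using tangent_Sing_iff[OF p vt] by simp
  then obtain T where T: "vf U T" "T p = v" "\<forall>q\<in>Sg \<inter> U. T q \<in> TSg q"
    using ext by blast
  have Tr: "DC T RR NN p = - rhof A p"
  proof -
    define V where "V = U \<inter> U'"
    have V: "open V" "p \<in> V" "V \<subseteq> U" "V \<subseteq> U'" using U A by (auto simp: V_def)
    note s = vf_subset[OF A(3) V(4)] vf_subset[OF NNU V(3)] vf_subset[OF RRU V(3)] vf_subset[OF T(1) V(3)]
    have "DC T RR NN p = DC (\<lambda>q f. 1 * A q f + (- nuf A p) * NN q f) RR NN p"
      by (rule dual_conn_cong1[OF V(1,2) s(4) _ _ s(3,2)])
         (use T(2) v_def in \<open>auto intro!: vf_comb[OF V(1) s(1,2), of "\<lambda>q. 1" "\<lambda>q. - nuf A p", simplified] smooth_const\<close>)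
    then show ?thesis unfolding dual_conn_comb1[OF V(1,2) s(1,2,3,2)] rhof_def by simp
  qed
  define X where "X = (\<lambda>q f. 1 * T q f + (- rhof A p) * RR q f)"
  have "vf U X" unfolding X_def by (rule vf_comb[OF U(1) T(1) RRU smooth_const smooth_const])
  moreover have "X q \<in> TSg q" if "q \<in> Sg \<inter> U" for q
    unfolding X_def by (rule tangent_Sing_comb) (use T(3) RR_tangent that U(3) in auto)
  moreover have "DC X RR NN p = 0"
    unfolding X_def dual_conn_comb1[OF U(1,2) T(1) RRU RRU NNU] using Tr H_RR[OF p] by simp
  moreover have "A p = (\<lambda>f. nuf A p * NN p f + 1 * (1 * X p f + rhof A p * RR p f))"
    by (rule HOL.ext) (simp add: X_def T(2) v_def)
  ultimately show thesis using that by blast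
qed

end

text \<open>Among the products of N, R and the screen parts only II(N,R) = II(R,N) = 1 survive:
  II(N,N) = 0 by the choice of the main normal, II(R,R) is R(\<tau>)/2 = 0, a screen part with N or
  R gives 0 by \<open>screen_values\<close>, and two screen parts give 0 by flatness.\<close>

lemma II_flat_value:
  assumes p: "p \<in> S" and flat: "II_flat At g S N R"
    and A: "open UA" "p \<in> UA" "vf UA A" and C: "open UC" "p \<in> UC" "vf UC C"
  shows "DC A C RR p = nuf A p * rhof C p + rhof A p * nuf C p"
proof -
  obtain U where U: "open U" "p \<in> U" "U \<subseteq> W" and ext: "\<And>v. v \<in> TSg p \<Longrightarrow>
       \<exists>X. vf U X \<and> X p = v \<and> (\<forall>q\<in>Sg \<inter> U. X q \<in> TSg q)"
    by (rule tangential_extension[OF p]) blast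
  obtain X where X: "vf U X" "\<forall>q\<in>Sg \<inter> U. X q \<in> TSg q"
    "DC X RR NN p = 0" "A p = (\<lambda>f. nuf A p * NN p f + 1 * (1 * X p f + rhof A p * RR p f))"
    by (rule decomposition[OF p U ext A])
  obtain Y where Y: "vf U Y" "\<forall>q\<in>Sg \<inter> U. Y q \<in> TSg q"
    "DC Y RR NN p = 0" "C p = (\<lambda>f. nuf C p * NN p f + 1 * (1 * Y p f + rhof C p * RR p f))"
    by (rule decomposition[OF p U ext C])
  note NNU = vf_subset[OF NN(1) U(3)] and RRU = vf_subset[OF RR(1) U(3)]
  let ?T = "\<lambda>X r q f. 1 * X q f + r * RR q f"
  let ?F = "\<lambda>n X r q f. n * NN q f + 1 * ?T X r q f"
  have sT: "vf U (?T X r)" and sF: "vf U (?F n X r)" if "vf U X" for X n r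
  proof -
    show "vf U (?T X r)" by (rule vf_comb[OF U(1) that RRU smooth_const smooth_const])
    from vf_comb[OF U(1) NNU this smooth_const[of U n] smooth_const[of U 1]]
    show "vf U (?F n X r)" .
  qed
  define V where "V = U \<inter> UA \<inter> UC"
  have V: "open V" "p \<in> V" "V \<subseteq> U" "V \<subseteq> UA" "V \<subseteq> UC" using U A C by (auto simp: V_def)
  note sA = vf_subset[OF A(3) V(4)] and sC = vf_subset[OF C(3) V(5)] and sR = vf_subset[OF RRU V(3)]
  note s' = vf_subset[OF sF[OF X(1)] V(3)] vf_subset[OF sF[OF Y(1)] V(3)]
  let ?a = "nuf A p" and ?b = "rhof A p" and ?c = "nuf C p" and ?d = "rhof C p"
  have "DC A C RR p = DC (?F ?a X ?b) C RR p"
    by (rule dual_conn_cong1[OF V(1,2) sA s'(1) X(4) sC sR])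
  also have "\<dots> = DC (?F ?a X ?b) (?F ?c Y ?d) RR p"
    by (rule dual_conn_cong2_radical[OF V(1,2) sC s'(2) Y(4) s'(1) sR RR_radical[OF p]])
  also have "\<dots> = ?a * ?d + ?b * ?c"
  proof -
    have pt: "Z p \<in> TSg p" if "\<forall>q\<in>Sg \<inter> U. Z q \<in> TSg q" for Z
      using that p U(2) by auto
    note sv = screen_values[OF p U X(1) pt[OF X(2)] X(3)] screen_values[OF p U Y(1) pt[OF Y(2)] Y(3)]
    have RRR: "DC RR RR RR p = 0"
      using II_X_R[OF p RR(1)] tangent_Sing_iff[OF p vf_tangent[OF RR(1)]] RR_tangent[OF p] p by simp
    have e: "DC Z (?F ?c Y ?d) RR p = ?c * DC Z NN RR p + (DC Z Y RR p + ?d * DC Z RR RR p)"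
      if "vf U Z" for Z
      unfolding dual_conn_comb2[OF U(1,2) NNU sT[OF Y(1)] that RRU] dual_conn_comb2[OF U(1,2) Y(1) RRU that RRU] by simp
    have "DC (?F ?a X ?b) (?F ?c Y ?d) RR p = ?a * DC NN (?F ?c Y ?d) RR p +
        (DC X (?F ?c Y ?d) RR p + ?b * DC RR (?F ?c Y ?d) RR p)"
      unfolding dual_conn_comb1[OF U(1,2) NNU sT[OF X(1)] sF[OF Y(1)] RRU]
        dual_conn_comb1[OF U(1,2) X(1) RRU sF[OF Y(1)] RRU] by simp
    then show ?thesis
      unfolding e[OF NNU] e[OF RRU] e[OF X(1)]
      using sv RRR II_NN[OF p] II_NR[OF p] II_RN[OF p] flat_screen[OF p U flat X(1-3) Y(1-3)] by simp
  qed
  finally show ?thesis .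
qed

lemma Ups_flat:
  assumes "p \<in> S" "II_flat At g S N R" "open U" "p \<in> U"
    and "vf U A" "vf U B" "vf U C" "vf U E"
  shows "Ups p (A p) (B p) (C p) (E p) =
    - ((nuf A p * rhof B p - nuf B p * rhof A p) * (nuf C p * rhof E p - nuf E p * rhof C p))"
  unfolding Ups_singular[OF assms(1,3-8)] II_flat_value[OF assms(1,2,3,4,5) assms(3,4,7)]
    II_flat_value[OF assms(1,2,3,4,6) assms(3,4,8)] II_flat_value[OF assms(1,2,3,4,6) assms(3,4,7)]
    II_flat_value[OF assms(1,2,3,4,5) assms(3,4,8)]
  by (simp add: algebra_simps)

lemma nuf_rhof_NN: "p \<in> S \<Longrightarrow> nuf NN p = 1" "p \<in> S \<Longrightarrow> rhof NN p = 0"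
  and nuf_rhof_RR: "p \<in> S \<Longrightarrow> nuf RR p = 0" "p \<in> S \<Longrightarrow> rhof RR p = 1"
  using NN_NN g_radical(1) vf_tangent[OF NN(1)] H_RR by (auto simp: nuf_def rhof_def)

text \<open>The definition of \<open>rho\<close> evaluates H on A - \<nu>(A)N, a field given only
  along \<Sigma>. It is tangent to \<Sigma>, so the value does not depend on the extensions
  chosen.\<close>

lemma nu_rho_eq:
  assumes p: "p \<in> S" and A: "along (Sg) A"
    and U: "open U" "p \<in> U" "extends (Sg) A U AA"
  shows "nu g N A p = nuf AA p" "rho At g S N R A p = rhof AA p"
proof -
  have AA: "vf U AA" "AA p = A p" using U p by (auto simp: vf_extends_def)
  show n: "nu g N A p = nuf AA p" using AA(2) NN(2)[OF p] by (simp add: nu_def nuf_def)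
  let ?B = "\<lambda>q f. A q f - nu g N A q * N q f"
  have al: "along S ?B"
    unfolding vf_along_def
  proof
    fix q assume q: "q \<in> S"
    obtain O' A' where O': "open O'" "q \<in> O'" "extends (Sg) A O' A'"
      using A q unfolding vf_along_def by blast
    define V where "V = O' \<inter> W"
    have V: "open V" "q \<in> V" "V \<subseteq> O'" "V \<subseteq> W" using O' W q by (auto simp: V_def)
    have s: "vf V A'" "vf V NN"
      using O'(3) vf_subset[OF _ V(3)] vf_subset[OF NN(1) V(4)] by (auto simp: vf_extends_def)
    have "vf V (\<lambda>q f. A' q f - g q (A' q) (NN q) * NN q f)"
      by (intro vf_diff vf_scale V(1) s g_fun)
    then have "extends S ?B V (\<lambda>q f. A' q f - g q (A' q) (NN q) * NN q f)"
      using O'(3) V(3,4) NN(2) by (auto simp: vf_extends_def nu_def)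
    then show "\<exists>U AA. open U \<and> q \<in> U \<and> extends S ?B U AA" using V by blast
  qed
  define V where "V = U \<inter> W"
  have V: "open V" "p \<in> V" "V \<subseteq> U" "V \<subseteq> W" using U W p by (auto simp: V_def)
  note s = vf_subset[OF AA(1) V(3)] vf_subset[OF NN(1) V(4)] vf_subset[OF RR(1) V(4)]
  define X where "X = (\<lambda>q f. 1 * AA q f + (- nuf AA p) * NN q f)"
  have sX: "vf V X" unfolding X_def by (rule vf_comb[OF V(1) s(1,2) smooth_const smooth_const])
  have Xp: "X p = ?B p" using AA(2) NN(2)[OF p] n by (simp add: X_def)
  have t: "?B p \<in> TSg p"
    unfolding Xp[symmetric] tangent_Sing_iff[OF p vf_tangent[OF sX V(2)]]
    using normal_component[OF p vf_tangent[OF s(1) V(2)]] NN_tau[OF p] by (simp add: X_def nuf_def)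
  have "second_fundamental_form At g S N ?B R p = DC X RR NN p"
    unfolding second_fundamental_form_def
    by (rule dual_conn_along_tangent[OF al R_along N_along p V(1,2) sX s(3,2) Xp NN(2)[OF p] t W])
       (use p RR(2) in auto)
  also have "\<dots> = - rhof AA p"
    unfolding X_def dual_conn_comb1[OF V(1,2) s(1,2,3,2)] rhof_def by simp
  finally show "rho At g S N R A p = rhof AA p" by (simp add: rho_def)
qed

section \<open>Well-definedness and the vanishing of the slots\<close>

lemma slot_difference_vanishes:
  assumes p: "p \<in> S" and V: "open V" "p \<in> V" "V \<subseteq> W"
    and s1: "vf V A1" "vf V B1" "vf V C1" "vf V E1"
    and s2: "vf V A2" "vf V B2" "vf V C2" "vf V E2"
    and eq: "\<And>q. q \<in> V \<Longrightarrow> Ups q (A2 q) (B2 q) (C2 q) (E2 q) = Ups q (A1 q) (B1 q) (C1 q) (E1 q) + tau q * G q"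
    and G: "smooth V G"
    and F1: "smooth V F1" "\<forall>q\<in>V - Sg. F1 q = g q (Riem A1 B1 C1 q) (E1 q)"
    and F2: "smooth V F2" "\<forall>q\<in>V - Sg. F2 q = g q (Riem A2 B2 C2 q) (E2 q)"
    and F: "F1 p = F2 p"
  shows "G p = 0"
proof -
  obtain D \<phi> where D: "(D, \<phi>) \<in> At" "p \<in> D" by (rule ex_chart)
  obtain V' \<kappa> where V': "open V'" "p \<in> V'" "V' \<subseteq> V" "V' \<subseteq> D"
    and \<kappa>: "\<And>q. q \<in> V' \<Longrightarrow> tau q = gram_det At g (D, \<phi>) q * \<kappa> q" "\<And>q. q \<in> V' \<Longrightarrow> \<kappa> q \<noteq> 0"
    by (rule tau_division[OF p D V(1,2)]) blast
  \<comment> \<open>Off \<Sigma>, \<Upsilon> is \<tau> times the curvature product, so cancelling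
    \<tau> in the assumed difference gives \<open>G = F2 - F1\<close>; density extends this to
    \<open>p\<close>, where the two boundary values agree.\<close>
  have "G p = F2 p - F1 p"
  proof (rule smooth_eq_sing[OF V'(1) smooth_subset[OF G V'(3)] _ _ V'(2)])
    show "smooth V' (\<lambda>q. F2 q - F1 q)"
      by (intro smooth_diff V'(1) smooth_subset[OF F1(1) V'(3)] smooth_subset[OF F2(1) V'(3)])
    fix q assume q: "q \<in> V' - Sg"
    then have qV: "q \<in> V" "q \<in> W - Sg" using V'(3) V(3) by auto
    have "tau q \<noteq> 0" using \<kappa>[of q] sing_iff[OF D(1), of q] q V'(4) by auto
    moreover have "tau q * F2 q = tau q * F1 q + tau q * G q"
      using eq[OF qV(1)] Ups_curvature[OF V(1) s1 qV] Ups_curvature[OF V(1) s2 qV] F1(2) F2(2) qV by simp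
    then have "tau q * (F2 q - F1 q) = tau q * G q" by (simp add: algebra_simps)
    ultimately show "G q = F2 q - F1 q" by simp
  qed
  then show ?thesis using F by simp
qed

lemma well_defined_slots:
  assumes wd: "curvature_well_defined At g nabla A B C E" and p: "p \<in> S"
    and al: "along (Sg) A" "along (Sg) B" "along (Sg) C" "along (Sg) E"
  shows "all_slots_vanish At Ups A B C E p"
proof -
  obtain F0 where F0: "\<And>U AA BB CC EE. open U \<Longrightarrow>
        extends (Sg) A U AA \<Longrightarrow> extends (Sg) B U BB \<Longrightarrow>
        extends (Sg) C U CC \<Longrightarrow> extends (Sg) E U EE \<Longrightarrow>
        (\<exists>F. smooth U F \<and>
           (\<forall>p\<in>U - Sg. F p = g p (Riem AA BB CC p) (EE p)) \<and>
           (\<forall>p\<in>U \<inter> Sg. F p = F0 p))"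
    using wd unfolding curvature_well_defined_def by metis
  have pW: "p \<in> W" and pS: "p \<in> Sg" using p by auto
  obtain D \<phi> where D: "(D, \<phi>) \<in> At" "p \<in> D" by (rule ex_chart)
  have oDW: "open (D \<inter> W)" using chart(2)[OF D(1)] W by auto
  obtain V AA BB CC EE where V: "open V" "p \<in> V" "V \<subseteq> D \<inter> W"
    and e: "extends (Sg) A V AA" "extends (Sg) B V BB"
      "extends (Sg) C V CC" "extends (Sg) E V EE"
    by (rule common_extension[OF al pS oDW]) (use D(2) pW in auto)
  have VW: "V \<subseteq> W" and VD: "V \<subseteq> D" using V(3) by auto
  have s: "vf V AA" "vf V BB" "vf V CC" "vf V EE"
    and v: "AA p = A p" "BB p = B p" "CC p = C p" "EE p = E p"
    using e V(2) pS by (auto simp: vf_extends_def)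
  note st = smooth_subset[OF tau_smooth VW]
  obtain F1 where F1: "smooth V F1" "\<forall>q\<in>V - Sg. F1 q = g q (Riem AA BB CC q) (EE q)"
    "F1 p = F0 p"
    using F0[OF V(1) e] V(2) pS by auto
  show ?thesis
    unfolding all_slots_vanish_def
  proof
    fix x assume x: "x \<in> TM p"
    obtain X where X: "vf D X" "X p = x" by (rule constant_coefficient_field[OF D x])
    note sX = vf_subset[OF X(1) VD]
    \<comment> \<open>As \<tau> vanishes on \<Sigma>, this is another extension of the same field
      along \<Sigma>; by linearity it changes \<Upsilon> by \<tau> times the value with
      \<open>X\<close> in that slot.\<close>
    let ?T = "\<lambda>Y q f. 1 * Y q f + tau q * X q f"
    have sT: "vf V (?T Y)" if "vf V Y" for Y
      by (rule vf_comb[OF V(1) that sX smooth_const st])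
    have eT: "extends (Sg) Z V (?T Y)" if "extends (Sg) Z V Y" for Z Y
    proof -
      have "vf V Y" using that by (simp add: vf_extends_def)
      from sT[OF this] show ?thesis
        using that tau_zero VW unfolding vf_extends_def by auto
    qed
    have lin: "L (\<lambda>f. 1 * Y q f + tau q * X q f) = L (Y q) + tau q * L (X q)"
      if "linear_form At q L" "vf V Y" "q \<in> V" for L Y q
      using that(1)[unfolded linear_form_def, rule_format, OF vf_tangent[OF that(2,3)] vf_tangent[OF sX that(3)], of 1 "tau q"]
      by simp
    note t = vf_tangent[OF s(1)] vf_tangent[OF s(2)] vf_tangent[OF s(3)] vf_tangent[OF s(4)]
    have ul: "linear_form At q (\<lambda>x. Ups q x (BB q) (CC q) (EE q))" "linear_form At q (\<lambda>x. Ups q (AA q) x (CC q) (EE q))"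
      "linear_form At q (\<lambda>x. Ups q (AA q) (BB q) x (EE q))" "linear_form At q (\<lambda>x. Ups q (AA q) (BB q) (CC q) x)" if "q \<in> V" for q
      using Ups_linear[of q] t that VW by auto
    have key: "G p = 0" if e2: "extends Sg A V A2" "extends Sg B V B2" "extends Sg C V C2" "extends Sg E V E2"
      and s2: "vf V A2" "vf V B2" "vf V C2" "vf V E2" and G: "smooth V G"
      and eq: "\<And>q. q \<in> V \<Longrightarrow> Ups q (A2 q) (B2 q) (C2 q) (E2 q) = Ups q (AA q) (BB q) (CC q) (EE q) + tau q * G q"
      for A2 B2 C2 E2 G
    proof -
      obtain F2 where "smooth V F2" "\<forall>q\<in>V - Sg. F2 q = g q (Riem A2 B2 C2 q) (E2 q)" "F2 p = F0 p"
        using F0[OF V(1) e2] V(2) pS by auto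
      then show ?thesis
        using slot_difference_vanishes[OF p V(1,2) VW s s2 eq G F1(1,2)] F1(3) by simp
    qed
    have 1: "Ups p (X p) (BB p) (CC p) (EE p) = 0"
      by (rule key[OF eT[OF e(1)] e(2,3,4) sT[OF s(1)] s(2,3,4) Ups_smooth[OF V(1) VW sX s(2,3,4)] lin[OF ul(1) s(1)]])
    have 2: "Ups p (AA p) (X p) (CC p) (EE p) = 0"
      by (rule key[OF e(1) eT[OF e(2)] e(3,4) s(1) sT[OF s(2)] s(3,4) Ups_smooth[OF V(1) VW s(1) sX s(3,4)] lin[OF ul(2) s(2)]])
    have 3: "Ups p (AA p) (BB p) (X p) (EE p) = 0"
      by (rule key[OF e(1,2) eT[OF e(3)] e(4) s(1,2) sT[OF s(3)] s(4) Ups_smooth[OF V(1) VW s(1,2) sX s(4)] lin[OF ul(3) s(3)]])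
    have 4: "Ups p (AA p) (BB p) (CC p) (X p) = 0"
      by (rule key[OF e(1,2,3) eT[OF e(4)] s(1,2,3) sT[OF s(4)] Ups_smooth[OF V(1) VW s(1,2,3) sX] lin[OF ul(4) s(4)]])
    show "Ups p x (B p) (C p) (E p) = 0 \<and> Ups p (A p) x (C p) (E p) = 0 \<and>
      Ups p (A p) (B p) x (E p) = 0 \<and> Ups p (A p) (B p) (C p) x = 0"
      using 1 2 3 4 by (simp add: X(2) v)
  qed
qed

lemma curvature_limit_exists:
  assumes p: "p \<in> S" and U: "open U" "p \<in> U"
    and e: "extends (Sg) A U AA" "extends (Sg) B U BB"
      "extends (Sg) C U CC" "extends (Sg) E U EE"
    and slots: "\<And>q. q \<in> S \<Longrightarrow> all_slots_vanish At Ups A B C E q"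
  obtains V h where "open V" "p \<in> V" "V \<subseteq> U" "V \<subseteq> W" "smooth V h"
    "\<And>q. q \<in> V - Sg \<Longrightarrow> h q = g q (Riem AA BB CC q) (EE q)"
proof -
  obtain D \<phi> where D: "(D, \<phi>) \<in> At" "p \<in> D" by (rule ex_chart)
  obtain V \<kappa> where V: "open V" "p \<in> V" "V \<subseteq> U" "V \<subseteq> W" "V \<subseteq> D"
    and \<kappa>: "\<And>q. q \<in> V \<Longrightarrow> tau q = gram_det At g (D, \<phi>) q * \<kappa> q" "\<And>q. q \<in> V \<Longrightarrow> \<kappa> q \<noteq> 0"
    and div: "\<And>f. smooth V f \<Longrightarrow> (\<And>q. q \<in> V \<Longrightarrow> q \<in> Sg \<Longrightarrow> f q = 0) \<Longrightarrow>
       \<exists>h. smooth V h \<and> (\<forall>q\<in>V. f q = tau q * h q)"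
    by (rule tau_division[OF p D U]) blast
  have s: "vf V AA" "vf V BB" "vf V CC" "vf V EE"
    using vf_extends_restrict[OF _ V(3)] e unfolding vf_extends_def by blast+
  have "Ups q (AA q) (BB q) (CC q) (EE q) = 0" if "q \<in> V" "q \<in> Sg" for q
  proof -
    have "AA q = A q" "BB q = B q" "CC q = C q" "EE q = E q" using e that V(3) by (auto simp: vf_extends_def)
    moreover have "AA q \<in> TM q" by (rule vf_tangent[OF s(1) that(1)])
    ultimately show ?thesis using slots[of q] that V(4) by (auto simp: all_slots_vanish_def)
  qed
  then obtain h where h: "smooth V h" "\<And>q. q \<in> V \<Longrightarrow> Ups q (AA q) (BB q) (CC q) (EE q) = tau q * h q"
    using div[OF Ups_smooth[OF V(1,4) s]] by blast
  have "h q = g q (Riem AA BB CC q) (EE q)" if q: "q \<in> V - Sg" for q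
  proof -
    have "q \<in> V" "q \<in> W - Sg" using q V(4) by auto
    moreover have "tau q \<noteq> 0" using \<kappa>[of q] sing_iff[OF D(1), of q] q V(5) by auto
    ultimately show ?thesis using h(2)[of q] Ups_curvature[OF V(1) s] by simp
  qed
  with that V(1-4) h(1) show thesis by blast
qed

text \<open>By density \<Upsilon> = \<tau>h also holds on \<Sigma>, and at \<open>p\<close> the
  product rule leaves \<open>h p\<close> times N(\<tau>) = 2.\<close>

lemma curvature_limit_derivative:
  assumes p: "p \<in> S" and V: "open V" "p \<in> V"
    and s: "vf V AA" "vf V BB" "vf V CC" "vf V EE"
    and h: "smooth V h" "\<forall>q\<in>V - Sg. h q = g q (Riem AA BB CC q) (EE q)"
  shows "2 * h p = NN p (\<lambda>q. Ups q (AA q) (BB q) (CC q) (EE q))"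
proof -
  define V' where "V' = V \<inter> W"
  have V': "open V'" "p \<in> V'" "V' \<subseteq> V" "V' \<subseteq> W" using V W p by (auto simp: V'_def)
  note s' = s[THEN vf_subset, OF V'(3)]
  have Nt: "NN p \<in> TM p" using vf_tangent[OF NN(1)] p by simp
  note st = smooth_subset[OF tau_smooth V'(4)] and sh = smooth_subset[OF h(1) V'(3)]
  have "Ups q (AA q) (BB q) (CC q) (EE q) = tau q * h q" if q: "q \<in> V'" for q
  proof (rule smooth_eq_sing[OF V'(1) Ups_smooth[OF V'(1,4) s'] smooth_mult[OF V'(1) st sh] _ q])
    fix r assume "r \<in> V' - Sg"
    then have "r \<in> V'" "r \<in> W - Sg" "r \<in> V - Sg" using V' by auto
    then show "Ups r (AA r) (BB r) (CC r) (EE r) = tau r * h r"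
      using Ups_curvature[OF V'(1) s'] h(2) by simp
  qed
  then have "NN p (\<lambda>q. Ups q (AA q) (BB q) (CC q) (EE q)) = NN p (\<lambda>q. tau q * h q)"
    by (rule tangent_cong[OF Nt V'(1,2)])
  also have "\<dots> = tau p * NN p h + h p * NN p tau"
    by (rule tangent_mult[OF Nt smooth_near_fun[OF V'(1,2) st] smooth_near_fun[OF V'(1,2) sh]])
  finally show ?thesis using tau_zero[OF p] NN_tau[OF p] by simp
qed

text \<open>Both values are half the N-derivative of \<Upsilon> on the respective extensions, and
  the extensions are exchanged slot by slot. At each stage the linear form in the exchanged slot is,
  at \<open>p\<close>, \<Upsilon> with the original fields in the other three slots, which vanishes
  by assumption.\<close>

lemma curvature_limit_unique:
  assumes p: "p \<in> S" and slots: "all_slots_vanish At Ups A B C E p"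
    and "curvature_limit A B C E p y" "curvature_limit A B C E p y'"
  shows "y = y'"
proof -
  have pS: "p \<in> Sg" and pW: "p \<in> W" using p by auto
  obtain V1 A1 B1 C1 E1 h1 where 1: "open V1" "p \<in> V1"
     "extends (Sg) A V1 A1" "extends (Sg) B V1 B1"
     "extends (Sg) C V1 C1" "extends (Sg) E V1 E1" "smooth V1 h1"
     "\<forall>q\<in>V1 - Sg. h1 q = g q (Riem A1 B1 C1 q) (E1 q)" "h1 p = y"
    using assms(3) unfolding curvature_limit_def by (elim exE conjE) (rule that)
  obtain V2 A2 B2 C2 E2 h2 where 2: "open V2" "p \<in> V2"
     "extends (Sg) A V2 A2" "extends (Sg) B V2 B2"
     "extends (Sg) C V2 C2" "extends (Sg) E V2 E2" "smooth V2 h2"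
     "\<forall>q\<in>V2 - Sg. h2 q = g q (Riem A2 B2 C2 q) (E2 q)" "h2 p = y'"
    using assms(4) unfolding curvature_limit_def by (elim exE conjE) (rule that)
  define V where "V = V1 \<inter> V2 \<inter> W"
  have V: "open V" "p \<in> V" "V \<subseteq> V1" "V \<subseteq> V2" "V \<subseteq> W" using 1(1,2) 2(1,2) W pW by (auto simp: V_def)
  have s1: "vf V1 A1" "vf V1 B1" "vf V1 C1" "vf V1 E1"
    and v1: "A1 p = A p" "B1 p = B p" "C1 p = C p" "E1 p = E p"
    using 1(2-6) pS by (auto simp: vf_extends_def)
  have s2: "vf V2 A2" "vf V2 B2" "vf V2 C2" "vf V2 E2"
    and v2: "A2 p = A p" "B2 p = B p" "C2 p = C p" "E2 p = E p"
    using 2(2-6) pS by (auto simp: vf_extends_def)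
  note s1' = s1[THEN vf_subset, OF V(3)]
  note s2' = s2[THEN vf_subset, OF V(4)]
  have Nt: "NN p \<in> TM p" by (rule vf_tangent[OF NN(1) pW])
  have VWq: "q \<in> W" if "q \<in> V" for q using that V(5) by auto
  have VW': "V' \<subseteq> W" if "V' \<subseteq> V" for V' using that V(5) by auto
  have sl: "Ups p x (B p) (C p) (E p) = 0" "Ups p (A p) x (C p) (E p) = 0"
    "Ups p (A p) (B p) x (E p) = 0" "Ups p (A p) (B p) (C p) x = 0" if "x \<in> TM p" for x
    using slots that by (auto simp: all_slots_vanish_def)
  have "NN p (\<lambda>q. Ups q (A1 q) (B1 q) (C1 q) (E1 q)) = NN p (\<lambda>q. Ups q (A2 q) (B1 q) (C1 q) (E1 q))"
    by (rule derivative_form_cong[OF V(1,2) Nt s1'(1) s2'(1), where L = "\<lambda>q x. Ups q x (B1 q) (C1 q) (E1 q)"])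
       (simp_all add: v1 v2 sl Ups_linear VWq vf_tangent[OF s1'(2)] vf_tangent[OF s1'(3)] vf_tangent[OF s1'(4)]
          Ups_smooth VW' vf_subset[OF s1'(2)] vf_subset[OF s1'(3)] vf_subset[OF s1'(4)])
  also have "\<dots> = NN p (\<lambda>q. Ups q (A2 q) (B2 q) (C1 q) (E1 q))"
    by (rule derivative_form_cong[OF V(1,2) Nt s1'(2) s2'(2), where L = "\<lambda>q x. Ups q (A2 q) x (C1 q) (E1 q)"])
       (simp_all add: v1 v2 sl Ups_linear VWq vf_tangent[OF s2'(1)] vf_tangent[OF s1'(3)] vf_tangent[OF s1'(4)]
          Ups_smooth VW' vf_subset[OF s2'(1)] vf_subset[OF s1'(3)] vf_subset[OF s1'(4)])
  also have "\<dots> = NN p (\<lambda>q. Ups q (A2 q) (B2 q) (C2 q) (E1 q))"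
    by (rule derivative_form_cong[OF V(1,2) Nt s1'(3) s2'(3), where L = "\<lambda>q x. Ups q (A2 q) (B2 q) x (E1 q)"])
       (simp_all add: v1 v2 sl Ups_linear VWq vf_tangent[OF s2'(1)] vf_tangent[OF s2'(2)] vf_tangent[OF s1'(4)]
          Ups_smooth VW' vf_subset[OF s2'(1)] vf_subset[OF s2'(2)] vf_subset[OF s1'(4)])
  also have "\<dots> = NN p (\<lambda>q. Ups q (A2 q) (B2 q) (C2 q) (E2 q))"
    by (rule derivative_form_cong[OF V(1,2) Nt s1'(4) s2'(4), where L = "\<lambda>q x. Ups q (A2 q) (B2 q) (C2 q) x"])
       (simp_all add: v1 v2 sl Ups_linear VWq vf_tangent[OF s2'(1)] vf_tangent[OF s2'(2)] vf_tangent[OF s2'(3)]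
          Ups_smooth VW' vf_subset[OF s2'(1)] vf_subset[OF s2'(2)] vf_subset[OF s2'(3)])
  finally show ?thesis
    using curvature_limit_derivative[OF p 1(1,2) s1 1(7,8)] curvature_limit_derivative[OF p 2(1,2) s2 2(7,8)] 1(9) 2(9)
    by simp
qed

text \<open>N and R have (\<nu>,\<rho>) equal to (1,0) and (0,1), so inserting them into a slot of
  \<Upsilon> = -det P det Q yields, up to sign, an entry of one matrix times the determinant of the
  other. All slots vanish iff (det Q = 0 or P = 0) and (det P = 0 or Q = 0); as a zero matrix has
  zero determinant, this is the stated alternative.\<close>

lemma flat_slots_iff:
  assumes p: "p \<in> S" and flat: "II_flat At g S N R"
    and al: "along (Sg) A" "along (Sg) B" "along (Sg) C" "along (Sg) E"
  shows "all_slots_vanish At Ups A B C E p \<longleftrightarrow>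
    (let P = nu_rho_matrix At g S N R A B p; Q = nu_rho_matrix At g S N R C E p
     in (det P = 0 \<and> det Q = 0) \<or> P = 0 \<or> Q = 0)"
proof -
  have pW: "p \<in> W" and pS: "p \<in> Sg" using p by auto
  obtain D \<phi> where D: "(D, \<phi>) \<in> At" "p \<in> D" by (rule ex_chart)
  have oDW: "open (D \<inter> W)" using chart(2)[OF D(1)] W by auto
  obtain V AA BB CC EE where V: "open V" "p \<in> V" "V \<subseteq> D \<inter> W"
    and e: "extends (Sg) A V AA" "extends (Sg) B V BB"
      "extends (Sg) C V CC" "extends (Sg) E V EE"
    by (rule common_extension[OF al pS oDW]) (use D(2) pW in auto)
  have VW: "V \<subseteq> W" and VD: "V \<subseteq> D" using V(3) by auto
  have s: "vf V AA" "vf V BB" "vf V CC" "vf V EE"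
    and v: "AA p = A p" "BB p = B p" "CC p = C p" "EE p = E p"
    using e V(2) pS by (auto simp: vf_extends_def)
  note nr = nu_rho_eq[OF p al(1) V(1,2) e(1)] nu_rho_eq[OF p al(2) V(1,2) e(2)]
    nu_rho_eq[OF p al(3) V(1,2) e(3)] nu_rho_eq[OF p al(4) V(1,2) e(4)]
  note sN = vf_subset[OF NN(1) VW] and sR = vf_subset[OF RR(1) VW]
  let ?a = "nuf AA p" and ?a' = "rhof AA p" and ?b = "nuf BB p" and ?b' = "rhof BB p"
    and ?c = "nuf CC p" and ?c' = "rhof CC p" and ?d = "nuf EE p" and ?d' = "rhof EE p"
  let ?P = "?a * ?b' - ?b * ?a'" and ?Q = "?c * ?d' - ?d * ?c'"
  note U = Ups_flat[OF p flat V(1,2)]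
  have slots: "Ups p (X p) (B p) (C p) (E p) = - ((nuf X p * ?b' - ?b * rhof X p) * ?Q)"
    "Ups p (A p) (X p) (C p) (E p) = - ((?a * rhof X p - nuf X p * ?a') * ?Q)"
    "Ups p (A p) (B p) (X p) (E p) = - (?P * (nuf X p * ?d' - ?d * rhof X p))"
    "Ups p (A p) (B p) (C p) (X p) = - (?P * (?c * rhof X p - nuf X p * ?c'))" if "vf V X" for X
    using U[OF that s(2,3,4)] U[OF s(1) that s(3,4)] U[OF s(1,2) that s(4)] U[OF s(1,2,3) that] by (simp_all add: v)
  have "all_slots_vanish At Ups A B C E p \<longleftrightarrow>
    (?Q = 0 \<or> ?a = 0 \<and> ?a' = 0 \<and> ?b = 0 \<and> ?b' = 0) \<and> (?P = 0 \<or> ?c = 0 \<and> ?c' = 0 \<and> ?d = 0 \<and> ?d' = 0)"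
  proof
    assume "all_slots_vanish At Ups A B C E p"
    then have "Ups p (X p) (B p) (C p) (E p) = 0" "Ups p (A p) (X p) (C p) (E p) = 0"
      "Ups p (A p) (B p) (X p) (E p) = 0" "Ups p (A p) (B p) (C p) (X p) = 0" if "vf V X" for X
      using vf_tangent[OF that V(2)] by (auto simp: all_slots_vanish_def)
    from this[OF sN] this[OF sR]
    show "(?Q = 0 \<or> ?a = 0 \<and> ?a' = 0 \<and> ?b = 0 \<and> ?b' = 0) \<and> (?P = 0 \<or> ?c = 0 \<and> ?c' = 0 \<and> ?d = 0 \<and> ?d' = 0)"
      unfolding slots[OF sN] slots[OF sR] nuf_rhof_NN[OF p] nuf_rhof_RR[OF p] by auto
  next
    assume c: "(?Q = 0 \<or> ?a = 0 \<and> ?a' = 0 \<and> ?b = 0 \<and> ?b' = 0) \<and> (?P = 0 \<or> ?c = 0 \<and> ?c' = 0 \<and> ?d = 0 \<and> ?d' = 0)"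
    show "all_slots_vanish At Ups A B C E p"
      unfolding all_slots_vanish_def
    proof
      fix x assume x: "x \<in> TM p"
      obtain X where X: "vf D X" "X p = x" by (rule constant_coefficient_field[OF D x])
      from slots[OF vf_subset[OF X(1) VD]] c
      show "Ups p x (B p) (C p) (E p) = 0 \<and> Ups p (A p) x (C p) (E p) = 0 \<and>
         Ups p (A p) (B p) x (E p) = 0 \<and> Ups p (A p) (B p) (C p) x = 0"
        unfolding X(2) by auto
    qed
  qed
  moreover have "det (nu_rho_matrix At g S N R A B p) = ?P" "det (nu_rho_matrix At g S N R C E p) = ?Q"
    by (simp_all add: nu_rho_matrix_def det_2 vector_2 nr)
  moreover have "nu_rho_matrix At g S N R A B p = 0 \<longleftrightarrow> ?a = 0 \<and> ?a' = 0 \<and> ?b = 0 \<and> ?b' = 0"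
    "nu_rho_matrix At g S N R C E p = 0 \<longleftrightarrow> ?c = 0 \<and> ?c' = 0 \<and> ?d = 0 \<and> ?d' = 0"
    by (auto simp: nu_rho_matrix_def vec_eq_iff forall_2 vector_2 nr)
  ultimately show ?thesis by (auto simp: Let_def)
qed

end

text \<open>Near a point of \<Sigma> the smooth extension is the quotient by \<tau> found in some
  patch, and off \<Sigma> it is the curvature product itself. The value on \<Sigma>, picked by
  \<open>THE\<close>, depends neither on the patch nor on the extensions, by uniqueness of
  \<open>curvature_limit\<close>.\<close>

lemma (in singular_connection) slots_well_defined:
  assumes cover: "Sg \<subseteq> (\<Union>i\<in>I. W i)"
    and can: "\<And>i. i \<in> I \<Longrightarrow> canonical_data At g nabla (W i) (N i) (R i) (NN i) (RR i) (Ups i)"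
    and slots: "\<And>i p. i \<in> I \<Longrightarrow> p \<in> Sg \<inter> W i \<Longrightarrow> all_slots_vanish At (Ups i) A B C E p"
  shows "curvature_well_defined At g nabla A B C E"
  unfolding curvature_well_defined_def
proof (rule exI[of _ "\<lambda>p. THE y. curvature_limit A B C E p y"], intro allI impI, elim conjE)
  fix U AA BB CC EE
  assume U: "open U" and e: "extends (Sg) A U AA" "extends (Sg) B U BB"
    "extends (Sg) C U CC" "extends (Sg) E U EE"
  have c: "canonical At g nabla (W i) (N i) (R i) (NN i) (RR i) (Ups i)" if "i \<in> I" for i
    by (intro canonical.intro canonical_axioms.intro singular_connection_axioms can that)
  define F where "F p = (if p \<in> Sg then THE y. curvature_limit A B C E p y
    else g p (Riem AA BB CC p) (EE p))" for p
  have unique: "(THE y. curvature_limit A B C E p y) = y" if p: "p \<in> Sg" and y: "curvature_limit A B C E p y" for p y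
  proof -
    obtain i where i: "i \<in> I" "p \<in> Sg \<inter> W i" using cover p by blast
    show ?thesis
      by (rule the_equality, rule y)
         (rule canonical.curvature_limit_unique[OF c[OF i(1)] i(2) slots[OF i] _ y])
  qed
  have "smooth U F"
  proof (rule smooth_local)
    fix p assume p: "p \<in> U"
    show "smooth_at p F"
    proof (cases "p \<in> Sg")
      case True
      then obtain i where i: "i \<in> I" "p \<in> Sg \<inter> W i" using cover by blast
      obtain V h where V: "open V" "p \<in> V" "V \<subseteq> U" "smooth V h"
        and h: "\<And>q. q \<in> V - Sg \<Longrightarrow> h q = g q (Riem AA BB CC q) (EE q)"
        by (rule canonical.curvature_limit_exists[OF c[OF i(1)] i(2) U p e slots[OF i(1)]]) blast+
      \<comment> \<open>The function \<open>h\<close> found at \<open>p\<close> also witnesses the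
        boundary values at the other points of \<Sigma> in \<open>V\<close>, so \<open>F\<close>
        coincides with \<open>h\<close> on a whole neighbourhood and is smooth there.\<close>
      have "h q = F q" if q: "q \<in> V" for q
      proof (cases "q \<in> Sg")
        case True
        have "curvature_limit A B C E q (h q)"
          unfolding curvature_limit_def
          by (rule exI[of _ V], rule exI[of _ AA], rule exI[of _ BB], rule exI[of _ CC], rule exI[of _ EE], rule exI[of _ h])
             (use V(1,4) q h e[THEN vf_extends_restrict[OF _ V(3)]] in auto)
        from unique[OF True this] show ?thesis using True by (simp add: F_def)
      next
        case False
        then show ?thesis using h q by (simp add: F_def)
      qed
      then have "smooth V F" by (rule smooth_cong[OF V(1) _ V(4)])
      then show ?thesis by (rule smooth_near_fun[OF V(1,2)])
    next
      case False
      define V where "V = U - Sg"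
      have V: "open V" "p \<in> V" "V \<subseteq> - Sg" "V \<subseteq> U"
        using open_Int[OF U open_regular] p False by (auto simp: V_def Diff_eq)
      have s: "vf V AA" "vf V BB" "vf V CC" "vf V EE"
        using e[THEN vf_extends_restrict[OF _ V(4)]] by (simp_all add: vf_extends_def)
      have "smooth V F"
        by (rule smooth_cong[OF V(1) _ g_fun[OF V(1) curvature_vf[OF V(1,3) s(1,2,3)] s(4)]])
           (use V(3) in \<open>auto simp: F_def\<close>)
      then show ?thesis by (rule smooth_near_fun[OF V(1,2)])
    qed
  qed
  then show "\<exists>F. smooth U F \<and>
       (\<forall>p\<in>U - Sg. F p = g p (Riem AA BB CC p) (EE p)) \<and>
       (\<forall>p\<in>U \<inter> Sg. F p = (THE y. curvature_limit A B C E p y))"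
    by (intro exI[of _ F]) (simp add: F_def)
qed

theorem theorem13:
  fixes At :: "('a::{t2_space, second_countable_topology}, 'n::finite) atlas"
    and g :: "'a tensor2"
    and nabla :: "'a vfield \<Rightarrow> 'a vfield \<Rightarrow> 'a vfield"
    and I :: "'i set" and W :: "'i \<Rightarrow> 'a set"
    and N R NN RR :: "'i \<Rightarrow> 'a vfield" and Ups :: "'i \<Rightarrow> 'a tensor4"
    and A B C D :: "'a vfield"
  assumes "smooth_atlas At" and "connected (UNIV :: 'a set)" and "CARD('n) > 2"
    and "transverse_singular_space At g"
    and "riemann_lorentz At g"
    and "tangent_radical At g"
    and "levi_civita At g (- Sing At g) nabla"
    and "Sing At g \<subseteq> (\<Union>i\<in>I. W i)"
    and "\<And>i. i \<in> I \<Longrightarrow> canonical_data At g nabla (W i) (N i) (R i) (NN i) (RR i) (Ups i)"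
    and "vf_along At (Sing At g) A" and "vf_along At (Sing At g) B"
    and "vf_along At (Sing At g) C" and "vf_along At (Sing At g) D"
  shows "(curvature_well_defined At g nabla A B C D \<longleftrightarrow>
            (\<forall>i\<in>I. \<forall>p\<in>Sing At g \<inter> W i. all_slots_vanish At (Ups i) A B C D p))
       \<and> ((\<forall>i\<in>I. II_flat At g (Sing At g \<inter> W i) (N i) (R i)) \<longrightarrow>
            ((\<forall>i\<in>I. \<forall>p\<in>Sing At g \<inter> W i. all_slots_vanish At (Ups i) A B C D p) \<longleftrightarrow>
             (\<forall>i\<in>I. \<forall>p\<in>Sing At g \<inter> W i.
                let P = nu_rho_matrix At g (Sing At g \<inter> W i) (N i) (R i) A B p;
                    Q = nu_rho_matrix At g (Sing At g \<inter> W i) (N i) (R i) C D p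
                in (det P = 0 \<and> det Q = 0) \<or> P = 0 \<or> Q = 0)))"
proof -
  interpret singular_connection At g nabla
    using assms(1,4,7) by unfold_locales (simp_all add: transverse_singular_space_def)
  have can: "canonical At g nabla (W i) (N i) (R i) (NN i) (RR i) (Ups i)" if "i \<in> I" for i
    by (intro canonical.intro canonical_axioms.intro singular_connection_axioms assms(9) that)
  have "curvature_well_defined At g nabla A B C D \<longleftrightarrow>
            (\<forall>i\<in>I. \<forall>p\<in>Sing At g \<inter> W i. all_slots_vanish At (Ups i) A B C D p)"
  proof (intro iffI ballI)
    fix i p assume "curvature_well_defined At g nabla A B C D" "i \<in> I" "p \<in> Sing At g \<inter> W i"
    then show "all_slots_vanish At (Ups i) A B C D p"
      by (intro canonical.well_defined_slots[OF can _ _ assms(10-13)])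
  next
    assume "\<forall>i\<in>I. \<forall>p\<in>Sing At g \<inter> W i. all_slots_vanish At (Ups i) A B C D p"
    then show "curvature_well_defined At g nabla A B C D"
      by (intro slots_well_defined[OF assms(8,9)]) auto
  qed
  moreover have "all_slots_vanish At (Ups i) A B C D p \<longleftrightarrow>
      (let P = nu_rho_matrix At g (Sing At g \<inter> W i) (N i) (R i) A B p;
           Q = nu_rho_matrix At g (Sing At g \<inter> W i) (N i) (R i) C D p
       in (det P = 0 \<and> det Q = 0) \<or> P = 0 \<or> Q = 0)"
    if "\<forall>i\<in>I. II_flat At g (Sing At g \<inter> W i) (N i) (R i)" "i \<in> I" "p \<in> Sing At g \<inter> W i" for i p
    by (rule canonical.flat_slots_iff[OF can[OF that(2)] that(3) _ assms(10-13)]) (use that in blast)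
  ultimately show ?thesis by simp
qed

end
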